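(* (BL) Let $\mu_{BL},\gamma_{BL},\nu_{BL}>0$. The Bartlett–Lewis rain cell arrival process $(N_t)_{t\ge0}$ with these parameters can be written as $N_t=N_t^1+N_t^2$, where $\boldsymbol N=(N_t^1,N_t^2,N_t^3)_{t\ge0}$ is a three-dimensional (degenerate, i.e. allowing negative entries in the kernel matrix) linear Hawkes process with intensity $\boldsymbol\lambda=(\lambda_t^1,\lambda_t^2,\lambda_t^3)_{t\ge0}$ given by $$\boldsymbol\lambda_t=\begin{pmatrix}\mu_{BL}\\0\\0\end{pmatrix}+\int_{[0,t)}\begin{pmatrix}0&0&0\\ \nu_{BL}&0&-\nu_{BL}\\ \gamma_{BL}&0&-\gamma_{BL}\end{pmatrix}d\boldsymbol N_s .$$ Moreover $\boldsymbol N$ has a well-defined nonlinear Hawkes representation: $\boldsymbol\lambda=\boldsymbol h\circ\boldsymbol\lambda$ with $\boldsymbol h(x_1,x_2,x_3)=((x_1)_+,(x_2)_+,(x_3)_+)$, $x_+=\max(x,0)$, and $\boldsymbol h$ is nonnegative and Lipschitz continuous. (NS) Let $\mu_{NS},\nu_{NS}>0$ and let $f_{NS}$ be a probability density on $[0,\infty)$. If $C$ is Poisson distributed with mean $\nu_{NS}$, the Neyman–Scott rain cell arrival process can be written as the second component $(N_t^2)_{t\ge0}$ of a bivariate linear Hawkes process $\boldsymbol N=(N_t^1,N_t^2)_{t\ge0}$ with intensity $\boldsymbol\lambda=(\lambda_t^1,\lambda_t^2)_{t\geq 0}$ given by $$\boldsymbol\lambda_t=\begin{pmatrix}\mu_{NS}\\0\end{pmatrix}+\int_{[0,t)}\begin{pmatrix}0&0\\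 \nu_{NS}f_{NS}(t-s)&0\end{pmatrix}d\boldsymbol N_s .$$
   Context: All processes start at time $0$ with no points before. A counting process has stochastic intensity $\lambda$ (with respect to a filtration) if $N_t-\int_0^t\lambda_s\,ds$ is a local martingale with $\int_0^t\lambda_s\,ds$ predictable. A $d$-dimensional linear Hawkes process with baseline vector $\boldsymbol\mu$ and matrix kernel $\boldsymbol\varphi$ is a vector of counting processes $\boldsymbol N=(N^1,\dots,N^d)$ with almost surely no simultaneous jumps, with intensity vector $\boldsymbol\lambda_t=\boldsymbol\mu+\int_{[0,t)}\boldsymbol\varphi(t-s)\,d\boldsymbol N_s$. A nonlinear Hawkes process with function $\boldsymbol h$ (acting componentwise, nonnegative, Lipschitz) is likewise a vector of counting processes with no simultaneous jumps and with intensity $\boldsymbol\lambda_t=\boldsymbol h\big(\boldsymbol\mu+\int_{[0,t)}\boldsymbol\varphi(t-s)\,d\boldsymbol N_s\big)$. Bartlett–Lewis (BL) rain cell arrival process: parent rain cells appear as a homogeneous Poisson process on $[0,\infty)$ with intensity $\mu_{BL}$; each parent independently has an exponentially distributed lifetime with parameter $\gamma_{BL}$, and during this lifetime new rain cells appear as a homogeneous Poisson process with intensity $\nu_{BL}$ (independent between parents). $N_t$ counts all parents and children up to time $t$. Neyman–Scott (NS) rain cell arrival process: parent rain cells appear as a homogeneous Poisson process on $[0,\infty)$ with intensity $\mu_{NS}$; each parent independently generates a random number $C$ of new rain cells, each independently displaced forward in time from the parent with common density $f_{NS}$. The arrival process counts only the children (parents excluded). *)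

theory Defs
  imports "HOL-Probability.Probability"
begin

section \<open>Stochastic intensities\<close>

text \<open>
  The time axis is \<open>[0,\<infinity>)\<close>.  Processes and filtrations are indexed by \<^typ>\<open>real\<close>, so that the
  library's \<^const>\<open>filtration\<close> and \<^const>\<open>stopping_time\<close> and Lebesgue--Stieltjes measures of paths
  apply; the defining conditions below only concern times \<open>t \<ge> 0\<close>, except that counting paths are
  required to vanish at negative times (no points before time \<open>0\<close>).
\<close>

definition filtration_on :: "'a measure \<Rightarrow> (real \<Rightarrow> 'a measure) \<Rightarrow> bool" where
  "filtration_on M F \<longleftrightarrow> filtration (space M) F \<and> (\<forall>t. subalgebra M (F t))"

definition adapted :: "(real \<Rightarrow> 'a measure) \<Rightarrow> (real \<Rightarrow> 'a \<Rightarrow> 'b::topological_space) \<Rightarrow> bool" where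
  "adapted F X \<longleftrightarrow> (\<forall>t\<ge>0. X t \<in> borel_measurable (F t))"

definition martingale :: "'a measure \<Rightarrow> (real \<Rightarrow> 'a measure) \<Rightarrow> (real \<Rightarrow> 'a \<Rightarrow> real) \<Rightarrow> bool" where
  "martingale M F X \<longleftrightarrow>
     adapted F X \<and> (\<forall>t\<ge>0. integrable M (X t)) \<and>
     (\<forall>s t. 0 \<le> s \<and> s \<le> t \<longrightarrow> (AE \<omega> in M. real_cond_exp M (F s) (X t) \<omega> = X s \<omega>))"

text \<open>
  Finite stopping times suffice for localisation: \<open>T n\<close> may always be replaced by \<open>min (T n) n\<close>.
\<close>

definition local_martingale ::
    "'a measure \<Rightarrow> (real \<Rightarrow> 'a measure) \<Rightarrow> (real \<Rightarrow> 'a \<Rightarrow> real) \<Rightarrow> bool" where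
  "local_martingale M F X \<longleftrightarrow>
     adapted F X \<and>
     (\<exists>T :: nat \<Rightarrow> 'a \<Rightarrow> real.
        (\<forall>n. stopping_time F (T n) \<and> (\<forall>\<omega>\<in>space M. 0 \<le> T n \<omega>)) \<and>
        (AE \<omega> in M. incseq (\<lambda>n. T n \<omega>) \<and> filterlim (\<lambda>n. T n \<omega>) at_top sequentially) \<and>
        (\<forall>n. martingale M F (\<lambda>t \<omega>. X (min t (T n \<omega>)) \<omega> - X 0 \<omega>)))"

definition predictable_algebra :: "'a set \<Rightarrow> (real \<Rightarrow> 'a measure) \<Rightarrow> (real \<times> 'a) measure" where
  "predictable_algebra \<Omega> F =
     sigma ({0..} \<times> \<Omega>)
       ({{0} \<times> A | A. A \<in> sets (F 0)} \<union>
        {{s<..t} \<times> A | s t A. 0 \<le> s \<and> s < t \<and> A \<in> sets (F s)})"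

definition predictable ::
    "'a measure \<Rightarrow> (real \<Rightarrow> 'a measure) \<Rightarrow> (real \<Rightarrow> 'a \<Rightarrow> real) \<Rightarrow> bool" where
  "predictable M F X \<longleftrightarrow>
     (\<lambda>(t, \<omega>). X t \<omega>) \<in> borel_measurable (predictable_algebra (space M) F)"

text \<open>A path counts the points of a locally finite subset of \<open>(0,\<infinity>)\<close>; all its jumps have size \<open>1\<close>.\<close>

definition counting_path :: "(real \<Rightarrow> nat) \<Rightarrow> bool" where
  "counting_path n \<longleftrightarrow>
     (\<exists>S \<subseteq> {0<..}. \<forall>t. finite (S \<inter> {..t}) \<and> n t = card (S \<inter> {..t}))"

definition counting_process ::
    "'a measure \<Rightarrow> (real \<Rightarrow> 'a measure) \<Rightarrow> (real \<Rightarrow> 'a \<Rightarrow> nat) \<Rightarrow> bool" where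
  "counting_process M F N \<longleftrightarrow>
     adapted F N \<and> (AE \<omega> in M. counting_path (\<lambda>t. N t \<omega>))"

definition compensator :: "(real \<Rightarrow> 'a \<Rightarrow> real) \<Rightarrow> real \<Rightarrow> 'a \<Rightarrow> real" where
  "compensator rate t \<omega> = (LINT s:{0..t}|lborel. rate s \<omega>)"

text \<open>
  The integrability clause makes the pathwise integrals of the intensity genuine (the Bochner
  integral of a non-integrable function is \<open>0\<close> by convention).
\<close>

definition has_intensity ::
    "'a measure \<Rightarrow> (real \<Rightarrow> 'a measure) \<Rightarrow> (real \<Rightarrow> 'a \<Rightarrow> nat) \<Rightarrow> (real \<Rightarrow> 'a \<Rightarrow> real) \<Rightarrow> bool" where
  "has_intensity M F N rate \<longleftrightarrow>
     (AE \<omega> in M. \<forall>t\<ge>0. set_integrable lborel {0..t} (\<lambda>s. rate s \<omega>)) \<and>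
     predictable M F (compensator rate) \<and>
     local_martingale M F (\<lambda>t \<omega>. real (N t \<omega>) - compensator rate t \<omega>)"


section \<open>Hawkes processes\<close>

text \<open>
  \<open>hawkes_drive \<mu> \<phi> N t \<omega>\<close> is \<open>\<mu> + \<integral>\<^bsub>[0,t)\<^esub> \<phi>(t - s) dN\<^sub>s\<close>, where \<open>dN\<close> is the Lebesgue--Stieltjes
  measure of the path.  No sign condition is imposed on the kernel.
\<close>

definition hawkes_drive ::
    "real ^ 'd \<Rightarrow> (real \<Rightarrow> real ^ 'd ^ 'd) \<Rightarrow> (real \<Rightarrow> 'a \<Rightarrow> nat ^ 'd) \<Rightarrow> real \<Rightarrow> 'a \<Rightarrow> real ^ 'd" where
  "hawkes_drive \<mu> \<phi> N t \<omega> =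
     (\<chi> i. \<mu> $ i +
        (\<Sum>j\<in>UNIV. LINT s:{0..<t}|interval_measure (\<lambda>u. real (N u \<omega> $ j)). \<phi> (t - s) $ i $ j))"

definition multivariate_counting_process ::
    "'a measure \<Rightarrow> (real \<Rightarrow> 'a measure) \<Rightarrow> (real \<Rightarrow> 'a \<Rightarrow> nat ^ 'd) \<Rightarrow> bool" where
  "multivariate_counting_process M F N \<longleftrightarrow>
     filtration_on M F \<and>
     (\<forall>i. counting_process M F (\<lambda>t \<omega>. N t \<omega> $ i)) \<and>
     (AE \<omega> in M. \<forall>i j t. i \<noteq> j \<longrightarrow>
        isCont (\<lambda>u. N u \<omega> $ i) t \<or> isCont (\<lambda>u. N u \<omega> $ j) t)"

definition linear_hawkes ::
    "'a measure \<Rightarrow> (real \<Rightarrow> 'a measure) \<Rightarrow> real ^ 'd \<Rightarrow> (real \<Rightarrow> real ^ 'd ^ 'd) \<Rightarrow>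
     (real \<Rightarrow> 'a \<Rightarrow> nat ^ 'd) \<Rightarrow> bool" where
  "linear_hawkes M F \<mu> \<phi> N \<longleftrightarrow>
     multivariate_counting_process M F N \<and>
     (\<forall>i. has_intensity M F (\<lambda>t \<omega>. N t \<omega> $ i) (\<lambda>t \<omega>. hawkes_drive \<mu> \<phi> N t \<omega> $ i))"

definition admissible_link :: "(real ^ 'd \<Rightarrow> real ^ 'd) \<Rightarrow> bool" where
  "admissible_link h \<longleftrightarrow>
     (\<forall>x y i. x $ i = y $ i \<longrightarrow> h x $ i = h y $ i) \<and>
     (\<forall>x i. 0 \<le> h x $ i) \<and>
     (\<exists>C. C-lipschitz_on UNIV h)"

definition nonlinear_hawkes ::
    "'a measure \<Rightarrow> (real \<Rightarrow> 'a measure) \<Rightarrow> (real ^ 'd \<Rightarrow> real ^ 'd) \<Rightarrow> real ^ 'd \<Rightarrow>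
     (real \<Rightarrow> real ^ 'd ^ 'd) \<Rightarrow> (real \<Rightarrow> 'a \<Rightarrow> nat ^ 'd) \<Rightarrow> bool" where
  "nonlinear_hawkes M F h \<mu> \<phi> N \<longleftrightarrow>
     admissible_link h \<and>
     multivariate_counting_process M F N \<and>
     (\<forall>i. has_intensity M F (\<lambda>t \<omega>. N t \<omega> $ i) (\<lambda>t \<omega>. h (hawkes_drive \<mu> \<phi> N t \<omega>) $ i))"

definition positive_parts :: "real ^ 'd \<Rightarrow> real ^ 'd" where
  "positive_parts x = (\<chi> i. max (x $ i) 0)"


section \<open>Poisson cluster processes\<close>

text \<open>
  In the increments below the truncated subtraction on \<^typ>\<open>nat\<close> is harmless, as almost all
  paths are nondecreasing.
\<close>

definition poisson_process :: "'a measure \<Rightarrow> real \<Rightarrow> (real \<Rightarrow> 'a \<Rightarrow> nat) \<Rightarrow> bool" where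
  "poisson_process M r N \<longleftrightarrow>
     (\<forall>t. N t \<in> measurable M (count_space UNIV)) \<and>
     (AE \<omega> in M. counting_path (\<lambda>t. N t \<omega>)) \<and>
     (\<forall>s t. 0 \<le> s \<and> s < t \<longrightarrow>
        distr M (count_space UNIV) (\<lambda>\<omega>. N t \<omega> - N s \<omega>) = measure_pmf (poisson_pmf (r * (t - s)))) \<and>
     (\<forall>\<tau> :: nat \<Rightarrow> real. 0 \<le> \<tau> 0 \<and> mono \<tau> \<longrightarrow>
        prob_space.indep_vars M (\<lambda>_. count_space UNIV) (\<lambda>k \<omega>. N (\<tau> (Suc k)) \<omega> - N (\<tau> k) \<omega>) UNIV)"

text \<open>The time of the \<open>(i + 1)\<close>-st point of a counting path.\<close>

definition arrival_time :: "(real \<Rightarrow> nat) \<Rightarrow> nat \<Rightarrow> real" where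
  "arrival_time n i = Inf {t. i < n t}"

text \<open>The events of the \<open>\<sigma>\<close>-algebra generated by a family of random variables.\<close>

definition generated_events :: "'a measure \<Rightarrow> ('t \<Rightarrow> 'a \<Rightarrow> 'b::topological_space) \<Rightarrow> 'a set set" where
  "generated_events M X = sigma_sets (space M) {X t -` A \<inter> space M | t A. A \<in> sets borel}"

datatype bl_source = BL_Parents | BL_Lifetime nat | BL_Offspring nat

text \<open>
  \<open>P\<close> counts the parents, \<open>L i\<close> is the lifetime of the \<open>i\<close>-th parent, and \<open>K i\<close> is the offspring
  process of the \<open>i\<close>-th parent as a function of that parent's age, of which only the points up to
  age \<open>L i\<close> are used.  \<open>X\<close> counts parents and children.
\<close>

definition bartlett_lewis ::
    "'a measure \<Rightarrow> real \<Rightarrow> real \<Rightarrow> real \<Rightarrow> (real \<Rightarrow> 'a \<Rightarrow> nat) \<Rightarrow> bool" where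
  "bartlett_lewis M \<mu> \<gamma> \<nu> X \<longleftrightarrow>
     (\<exists>(P :: real \<Rightarrow> 'a \<Rightarrow> nat) (L :: nat \<Rightarrow> 'a \<Rightarrow> real) (K :: nat \<Rightarrow> real \<Rightarrow> 'a \<Rightarrow> nat).
        poisson_process M \<mu> P \<and>
        (\<forall>i. distributed M lborel (L i) (exponential_density \<gamma>)) \<and>
        (\<forall>i. poisson_process M \<nu> (K i)) \<and>
        prob_space.indep_sets M
          (\<lambda>k. case k of
             BL_Parents \<Rightarrow> generated_events M P
           | BL_Lifetime i \<Rightarrow> generated_events M (\<lambda>_ :: unit. L i)
           | BL_Offspring i \<Rightarrow> generated_events M (K i)) UNIV \<and>
        (\<forall>\<omega>\<in>space M. \<forall>t\<ge>0.
           X t \<omega> = P t \<omega> +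
             (\<Sum>i<P t \<omega>. K i (min (t - arrival_time (\<lambda>u. P u \<omega>) i) (L i \<omega>)) \<omega>)))"

datatype ns_source = NS_Parents | NS_Number nat | NS_Displacement nat nat

text \<open>
  The \<open>i\<close>-th parent has \<open>C i\<close> children, where \<open>C i\<close> has law \<open>c\<close>; the \<open>j\<close>-th of them arrives
  \<open>D i j\<close> time units after its parent.  \<open>X\<close> counts the children only.
\<close>

definition neyman_scott ::
    "'a measure \<Rightarrow> real \<Rightarrow> nat pmf \<Rightarrow> (real \<Rightarrow> real) \<Rightarrow> (real \<Rightarrow> 'a \<Rightarrow> nat) \<Rightarrow> bool" where
  "neyman_scott M \<mu> c f X \<longleftrightarrow>
     (\<exists>(P :: real \<Rightarrow> 'a \<Rightarrow> nat) (C :: nat \<Rightarrow> 'a \<Rightarrow> nat) (D :: nat \<Rightarrow> nat \<Rightarrow> 'a \<Rightarrow> real).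
        poisson_process M \<mu> P \<and>
        (\<forall>i. C i \<in> measurable M (count_space UNIV) \<and>
             distr M (count_space UNIV) (C i) = measure_pmf c) \<and>
        (\<forall>i j. distributed M lborel (D i j) f) \<and>
        prob_space.indep_sets M
          (\<lambda>k. case k of
             NS_Parents \<Rightarrow> generated_events M P
           | NS_Number i \<Rightarrow> generated_events M (\<lambda>_ :: unit. C i)
           | NS_Displacement i j \<Rightarrow> generated_events M (\<lambda>_ :: unit. D i j)) UNIV \<and>
        (\<forall>\<omega>\<in>space M. \<forall>t\<ge>0.
           X t \<omega> = (\<Sum>i<P t \<omega>.
             card {j. j < C i \<omega> \<and> arrival_time (\<lambda>u. P u \<omega>) i + D i j \<omega> \<le> t})))"

definition probability_density_nonneg :: "(real \<Rightarrow> real) \<Rightarrow> bool" where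
  "probability_density_nonneg f \<longleftrightarrow>
     f \<in> borel_measurable borel \<and> (\<forall>x. 0 \<le> f x) \<and> (\<forall>x<0. f x = 0) \<and>
     (\<integral>\<^sup>+x. ennreal (f x) \<partial>lborel) = 1"

end

theory Submission
  imports Defs
begin

text \<open>
  Each cluster process is built from independent sources: the parents, and for every parent its
  marks (lifetime and offspring, or number and displacements of children).  Write
  \<open>A \<in> revealed E S G \<tau> s\<close> if \<open>A\<close> can be decided from everything outside a given source (\<open>E\<close>) and
  from that source (\<open>S\<close>) up to its own age \<open>s - \<tau>\<close>.  The filtration of the Hawkes process is the
  intersection of these \<open>\<sigma>\<close>-algebras over all sources.  A martingale property that involves one
  source only is checked in the \<open>\<sigma>\<close>-algebra of that source, where independence replaces the
  sample point by two independent copies, one for \<open>E\<close> and one for \<open>S\<close>; with the first copy fixed, it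
  is a martingale property of a Poisson process, of an exponential time, or of a Poisson number of
  i.i.d. points (Mecke's formula), shifted by a constant.  Summing over the parents gives the
  compensators, and the points of different sources never coincide because their laws are diffuse.

  The sources are first modified on null sets so that all paths are regular, which is why null
  sets are added to their \<open>\<sigma>\<close>-algebras.
\<close>

section \<open>Independent sources and revealed information\<close>

text \<open>The natural filtration of the Hawkes process would require the law of each cluster given
  the superposition of all of them. The intersection exploits an asymmetry instead: a martingale
  identity on it follows from the identity on any one of the larger \<sigma>-algebras, while
  adaptedness must be checked in all of them. The latter is cheap: for a given source, a point time
  is either built from outside information, hence known at once, or is the sum of an outside time
  and a time of the source itself. The delay \<open>\<tau>\<close> is read from the first copy, so
  it is a constant once that copy is fixed.

  The two models are cut differently. Lifetime and offspring may be separate sources, since knowing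
  the lifetime does not change the birth rate \<open>\<nu>\<close> before death. The number of
  Neyman--Scott children must share a source with their displacements: once it is known, the rate of
  the next child depends on how many are still to come. Hidden and Poisson, it gives a deterministic
  compensator after the parent time, \<open>\<nu>\<close> times the displacement distribution
  function.\<close>

definition null_completion :: "'a measure \<Rightarrow> 'a set set \<Rightarrow> 'a set set" where
  "null_completion M G = {A \<in> sets M. \<exists>B\<in>G. AE \<omega> in M. \<omega> \<in> A \<longleftrightarrow> \<omega> \<in> B}"

lemma null_completionI:
  "A \<in> sets M \<Longrightarrow> B \<in> G \<Longrightarrow> (AE \<omega> in M. \<omega> \<in> A \<longleftrightarrow> \<omega> \<in> B) \<Longrightarrow> A \<in> null_completion M G"
  by (auto simp: null_completion_def)

lemma null_completion_sets: "null_completion M G \<subseteq> sets M"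
  by (auto simp: null_completion_def)

lemma subset_null_completion: "G \<subseteq> sets M \<Longrightarrow> G \<subseteq> null_completion M G"
  by (auto simp: null_completion_def)

lemma sigma_algebra_null_completion:
  assumes "sigma_algebra (space M) G"
  shows "sigma_algebra (space M) (null_completion M G)"
proof -
  interpret G: sigma_algebra "space M" G by fact
  show ?thesis
    unfolding sigma_algebra_iff2
  proof (intro conjI ballI allI impI)
    show "null_completion M G \<subseteq> Pow (space M)"
      by (auto simp: null_completion_def dest: sets.sets_into_space)
    show "{} \<in> null_completion M G"
      by (rule null_completionI[where B="{}"]) auto
  next
    fix A assume "A \<in> null_completion M G"
    then obtain B where "A \<in> sets M" "B \<in> G" "AE \<omega> in M. \<omega> \<in> A \<longleftrightarrow> \<omega> \<in> B"
      by (auto simp: null_completion_def)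
    then show "space M - A \<in> null_completion M G"
      by (intro null_completionI[where B="space M - B"]) auto
  next
    fix A :: "nat \<Rightarrow> 'a set" assume A: "range A \<subseteq> null_completion M G"
    then have "\<exists>B\<in>G. AE \<omega> in M. \<omega> \<in> A i \<longleftrightarrow> \<omega> \<in> B" for i
      unfolding null_completion_def by blast
    then obtain B where B: "\<And>i. B i \<in> G" "\<And>i. AE \<omega> in M. \<omega> \<in> A i \<longleftrightarrow> \<omega> \<in> B i"
      by metis
    from B(2) have "AE \<omega> in M. \<forall>i. \<omega> \<in> A i \<longleftrightarrow> \<omega> \<in> B i" by (simp add: AE_all_countable)
    then have "AE \<omega> in M. \<omega> \<in> \<Union>(range A) \<longleftrightarrow> \<omega> \<in> \<Union>(range B)"
      by eventually_elim auto
    moreover have "\<Union>(range A) \<in> sets M" using A by (auto simp: null_completion_def)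
    moreover have "\<Union>(range B) \<in> G" using B(1) by auto
    ultimately show "\<Union>(range A) \<in> null_completion M G"
      by (rule null_completionI[rotated 2])
  qed
qed

text \<open>Each event changes only by a null set, and so does every finite intersection; the
  product formula therefore carries over from the original events.\<close>

lemma (in prob_space) indep_sets_null_completion:
  assumes "indep_sets G I"
  shows "indep_sets (\<lambda>i. null_completion M (G i)) I"
proof (rule indep_setsI)
  show "null_completion M (G i) \<subseteq> events" for i by (rule null_completion_sets)
next
  fix A J assume J: "J \<noteq> {}" "J \<subseteq> I" "finite J" and A: "\<forall>j\<in>J. A j \<in> null_completion M (G j)"
  then have "\<forall>j\<in>J. \<exists>B\<in>G j. AE \<omega> in M. \<omega> \<in> A j \<longleftrightarrow> \<omega> \<in> B"
    unfolding null_completion_def by blast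
  then obtain B where B: "\<And>j. j \<in> J \<Longrightarrow> B j \<in> G j" "\<And>j. j \<in> J \<Longrightarrow> AE \<omega> in M. \<omega> \<in> A j \<longleftrightarrow> \<omega> \<in> B j"
    by metis
  have Bev: "B j \<in> events" if "j \<in> J" for j
    using assms B(1)[OF that] J that by (auto simp: indep_sets_def)
  have Aev: "A j \<in> events" if "j \<in> J" for j
    using A that by (auto simp: null_completion_def)
  have "AE \<omega> in M. \<forall>j\<in>J. \<omega> \<in> A j \<longleftrightarrow> \<omega> \<in> B j"
    using B(2) J by (intro AE_finite_allI) auto
  then have "prob (\<Inter>j\<in>J. A j) = prob (\<Inter>j\<in>J. B j)"
    using J Aev Bev by (intro finite_measure_eq_AE) auto
  also have "\<dots> = (\<Prod>j\<in>J. prob (B j))"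
    using assms B J by (intro indep_setsD) auto
  also have "\<dots> = (\<Prod>j\<in>J. prob (A j))"
  proof (intro prod.cong refl finite_measure_eq_AE)
    fix j assume "j \<in> J"
    then show "AE \<omega> in M. \<omega> \<in> B j \<longleftrightarrow> \<omega> \<in> A j"
      using B(2)[of j] by (auto elim: eventually_mono)
  qed (auto simp: Aev Bev)
  finally show "prob (\<Inter>j\<in>J. A j) = (\<Prod>j\<in>J. prob (A j))" .
qed

section \<open>Two independent copies of a sample point, and delayed information\<close>

locale independent_pair = prob_space M for M :: "'a measure" +
  fixes E S :: "'a measure"
  assumes subE: "subalgebra M E" and subS: "subalgebra M S"
    and indep: "indep_set (sets E) (sets S)"
begin

lemma space_E [simp]: "space E = space M" and space_S [simp]: "space S = space M"
  using subE subS by (auto simp: subalgebra_def)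

lemma ident_E: "(\<lambda>\<omega>. \<omega>) \<in> measurable M E"
  and ident_S: "(\<lambda>\<omega>. \<omega>) \<in> measurable M S"
  using subE subS by (auto simp: subalgebra_def measurable_def Int_absorb2 sets.Int_space_eq2
      dest: sets.sets_into_space)

lemma diag: "(\<lambda>\<omega>. (\<omega>, \<omega>)) \<in> measurable M (E \<Otimes>\<^sub>M S)"
  by (rule measurable_Pair[OF ident_E ident_S])

lemma diag_measurable: "f \<in> measurable (E \<Otimes>\<^sub>M S) N \<Longrightarrow> (\<lambda>\<omega>. f (\<omega>, \<omega>)) \<in> measurable M N"
  by (rule measurable_compose[OF diag])

text \<open>Read as maps into \<open>E\<close> and into \<open>S\<close>, the identity is a pair of
  independent random variables. Hence the diagonal map sends \<open>M\<close> to a product measure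
  on \<open>E \<Otimes>\<^sub>M S\<close>, although both of its components are the same point; this
  is what licenses the two copies.\<close>

lemma distr_diag:
  "distr M (E \<Otimes>\<^sub>M S) (\<lambda>\<omega>. (\<omega>, \<omega>)) = distr M E (\<lambda>\<omega>. \<omega>) \<Otimes>\<^sub>M distr M S (\<lambda>\<omega>. \<omega>)"
proof -
  \<comment> \<open>\<open>indep_var_eq\<close> speaks of the \<sigma>-algebra generated by
    preimages, which for the identity map is the target \<sigma>-algebra itself.\<close>
  have *: "sigma_sets (space M) {(\<lambda>\<omega>. \<omega>) -` A \<inter> space M |A. A \<in> sets N} = sets N"
    if "space N = space M" for N :: "'a measure"
  proof -
    have "{(\<lambda>\<omega>. \<omega>) -` A \<inter> space M |A. A \<in> sets N} = sets N"
      using that sets.sets_into_space[of _ N] by auto (metis Int_absorb2)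
    then show ?thesis using sets.sigma_sets_eq[of N] that by simp
  qed
  have "indep_var E (\<lambda>\<omega>. \<omega>) S (\<lambda>\<omega>. \<omega>)"
    unfolding indep_var_eq using indep *[OF space_E] *[OF space_S] by (simp add: ident_E ident_S)
  then show ?thesis unfolding indep_var_distribution_eq by simp
qed

lemma nn_integral_diag:
  assumes [measurable]: "f \<in> borel_measurable (E \<Otimes>\<^sub>M S)"
  shows "(\<integral>\<^sup>+\<omega>. f (\<omega>, \<omega>) \<partial>M) = (\<integral>\<^sup>+\<omega>\<^sub>1. (\<integral>\<^sup>+\<omega>\<^sub>2. f (\<omega>\<^sub>1, \<omega>\<^sub>2) \<partial>M) \<partial>M)"
proof -
  interpret X: prob_space "distr M E (\<lambda>\<omega>. \<omega>)" by (rule prob_space_distr, rule ident_E)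
  interpret Y: prob_space "distr M S (\<lambda>\<omega>. \<omega>)" by (rule prob_space_distr, rule ident_S)
  interpret XY: pair_prob_space "distr M E (\<lambda>\<omega>. \<omega>)" "distr M S (\<lambda>\<omega>. \<omega>)" ..
  have "(\<integral>\<^sup>+\<omega>. f (\<omega>, \<omega>) \<partial>M) = (\<integral>\<^sup>+z. f z \<partial>distr M (E \<Otimes>\<^sub>M S) (\<lambda>\<omega>. (\<omega>, \<omega>)))"
    by (subst nn_integral_distr) (auto intro: diag ident_E)
  also have "\<dots> = (\<integral>\<^sup>+x. (\<integral>\<^sup>+y. f (x, y) \<partial>distr M S (\<lambda>\<omega>. \<omega>)) \<partial>distr M E (\<lambda>\<omega>. \<omega>))"
    unfolding distr_diag by (subst Y.nn_integral_fst) auto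
  also have "\<dots> = (\<integral>\<^sup>+\<omega>\<^sub>1. (\<integral>\<^sup>+\<omega>\<^sub>2. f (\<omega>\<^sub>1, \<omega>\<^sub>2) \<partial>distr M S (\<lambda>\<omega>. \<omega>)) \<partial>M)"
    by (subst nn_integral_distr) (auto intro: diag ident_E)
  also have "\<dots> = (\<integral>\<^sup>+\<omega>\<^sub>1. (\<integral>\<^sup>+\<omega>\<^sub>2. f (\<omega>\<^sub>1, \<omega>\<^sub>2) \<partial>M) \<partial>M)"
    by (intro nn_integral_cong) (subst nn_integral_distr, auto intro: ident_S)
  finally show ?thesis .
qed

text \<open>Fubini for the product law of the diagonal map; integrability along the diagonal is
  integrability under that law.\<close>

lemma integral_diag:
  fixes f :: "'a \<times> 'a \<Rightarrow> real"
  assumes [measurable]: "f \<in> borel_measurable (E \<Otimes>\<^sub>M S)"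
    and int: "integrable M (\<lambda>\<omega>. f (\<omega>, \<omega>))"
  shows "(\<integral>\<omega>. f (\<omega>, \<omega>) \<partial>M) = (\<integral>\<omega>\<^sub>1. (\<integral>\<omega>\<^sub>2. f (\<omega>\<^sub>1, \<omega>\<^sub>2) \<partial>M) \<partial>M)"
proof -
  interpret X: prob_space "distr M E (\<lambda>\<omega>. \<omega>)" by (rule prob_space_distr, rule ident_E)
  interpret Y: prob_space "distr M S (\<lambda>\<omega>. \<omega>)" by (rule prob_space_distr, rule ident_S)
  interpret XY: pair_prob_space "distr M E (\<lambda>\<omega>. \<omega>)" "distr M S (\<lambda>\<omega>. \<omega>)" ..
  have "integrable (distr M (E \<Otimes>\<^sub>M S) (\<lambda>\<omega>. (\<omega>, \<omega>))) f"
    using int by (subst integrable_distr_eq) (auto intro: diag)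
  note int' = this[unfolded distr_diag]
  have "(\<integral>\<omega>. f (\<omega>, \<omega>) \<partial>M) = (\<integral>z. f z \<partial>distr M (E \<Otimes>\<^sub>M S) (\<lambda>\<omega>. (\<omega>, \<omega>)))"
    by (subst integral_distr) (auto intro: diag ident_E)
  also have "\<dots> = (\<integral>x. (\<integral>y. f (x, y) \<partial>distr M S (\<lambda>\<omega>. \<omega>)) \<partial>distr M E (\<lambda>\<omega>. \<omega>))"
    unfolding distr_diag by (rule XY.integral_fst'[symmetric]) (rule int')
  also have "\<dots> = (\<integral>\<omega>\<^sub>1. (\<integral>\<omega>\<^sub>2. f (\<omega>\<^sub>1, \<omega>\<^sub>2) \<partial>distr M S (\<lambda>\<omega>. \<omega>)) \<partial>M)"
    by (subst integral_distr) (auto intro: diag ident_E)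
  also have "\<dots> = (\<integral>\<omega>\<^sub>1. (\<integral>\<omega>\<^sub>2. f (\<omega>\<^sub>1, \<omega>\<^sub>2) \<partial>M) \<partial>M)"
    by (rule Bochner_Integration.integral_cong[OF refl]) (subst integral_distr, auto intro: ident_S)
  finally show ?thesis .
qed

text \<open>The exceptional set has a null section for every first copy, hence mass zero under the
  product law, which is the law of the diagonal.\<close>

lemma AE_diag:
  assumes [measurable]: "Measurable.pred (E \<Otimes>\<^sub>M S) Q"
    and Q: "\<And>\<omega>\<^sub>1. \<omega>\<^sub>1 \<in> space M \<Longrightarrow> AE \<omega>\<^sub>2 in M. Q (\<omega>\<^sub>1, \<omega>\<^sub>2)"
  shows "AE \<omega> in M. Q (\<omega>, \<omega>)"
proof -
  let ?f = "\<lambda>z. indicator {z. \<not> Q z} z :: ennreal"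
  have [measurable]: "?f \<in> borel_measurable (E \<Otimes>\<^sub>M S)" by measurable
  have "(\<integral>\<^sup>+\<omega>. ?f (\<omega>, \<omega>) \<partial>M) = (\<integral>\<^sup>+\<omega>\<^sub>1. (\<integral>\<^sup>+\<omega>\<^sub>2. ?f (\<omega>\<^sub>1, \<omega>\<^sub>2) \<partial>M) \<partial>M)"
    by (rule nn_integral_diag) measurable
  also have "\<dots> = (\<integral>\<^sup>+\<omega>\<^sub>1. 0 \<partial>M)"
  proof (rule nn_integral_cong)
    fix \<omega>\<^sub>1 assume "\<omega>\<^sub>1 \<in> space M"
    from Q[OF this] have "(\<integral>\<^sup>+\<omega>\<^sub>2. ?f (\<omega>\<^sub>1, \<omega>\<^sub>2) \<partial>M) = (\<integral>\<^sup>+\<omega>\<^sub>2. 0 \<partial>M)"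
      by (intro nn_integral_cong_AE) auto
    then show "(\<integral>\<^sup>+\<omega>\<^sub>2. ?f (\<omega>\<^sub>1, \<omega>\<^sub>2) \<partial>M) = 0" by simp
  qed
  finally have "(\<integral>\<^sup>+\<omega>. ?f (\<omega>, \<omega>) \<partial>M) = 0" by simp
  then have "AE \<omega> in M. ?f (\<omega>, \<omega>) = 0"
    by (subst (asm) nn_integral_0_iff_AE) (auto intro!: diag_measurable)
  then show ?thesis by eventually_elim (auto simp: indicator_def split: if_splits)
qed

end

text \<open>All of \<open>E\<close> is revealed from the start, whereas \<open>S\<close> is revealed progressively through \<open>G\<close>
  with a delay \<open>\<tau>\<close>.\<close>

definition revealed ::
    "'a measure \<Rightarrow> 'a measure \<Rightarrow> (real \<Rightarrow> 'a measure) \<Rightarrow> ('a \<Rightarrow> real) \<Rightarrow> real \<Rightarrow> 'a set set" where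
  "revealed E S G \<tau> s =
     {A. \<exists>B\<in>sets (E \<Otimes>\<^sub>M S). A = {\<omega>\<in>space E. (\<omega>, \<omega>) \<in> B} \<and>
        (\<forall>\<omega>\<^sub>1\<in>space E. {\<omega>\<^sub>2\<in>space S. (\<omega>\<^sub>1, \<omega>\<^sub>2) \<in> B} \<in> sets (G (s - \<tau> \<omega>\<^sub>1)))}"

locale delayed_pair = independent_pair M E S for M E S :: "'a measure" +
  fixes G :: "real \<Rightarrow> 'a measure" and \<tau> :: "'a \<Rightarrow> real"
  assumes space_G [simp]: "\<And>a. space (G a) = space M"
    and mono_G: "\<And>a b. a \<le> b \<Longrightarrow> sets (G a) \<subseteq> sets (G b)"
begin

text \<open>The two arguments of \<open>Q\<close> separate what is read from \<open>E\<close> and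
  what is read from \<open>S\<close>. One event on the diagonal may be split in several ways, and
  the splitting decides whether the sections belong to the history \<open>G\<close>.\<close>

lemma revealedI:
  assumes "Measurable.pred (E \<Otimes>\<^sub>M S) (\<lambda>(\<omega>\<^sub>1, \<omega>\<^sub>2). Q \<omega>\<^sub>1 \<omega>\<^sub>2)"
    and "\<And>\<omega>\<^sub>1. \<omega>\<^sub>1 \<in> space M \<Longrightarrow> Measurable.pred (G (s - \<tau> \<omega>\<^sub>1)) (Q \<omega>\<^sub>1)"
  shows "{\<omega>\<in>space M. Q \<omega> \<omega>} \<in> revealed E S G \<tau> s"
proof -
  define B where "B = {z\<in>space (E \<Otimes>\<^sub>M S). case z of (\<omega>\<^sub>1, \<omega>\<^sub>2) \<Rightarrow> Q \<omega>\<^sub>1 \<omega>\<^sub>2}"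
  have "B \<in> sets (E \<Otimes>\<^sub>M S)" using assms(1) by (simp add: pred_def B_def)
  moreover have "\<forall>\<omega>\<^sub>1\<in>space M. {\<omega>\<^sub>2\<in>space S. (\<omega>\<^sub>1, \<omega>\<^sub>2) \<in> B} \<in> sets (G (s - \<tau> \<omega>\<^sub>1))"
  proof
    fix \<omega>\<^sub>1 assume "\<omega>\<^sub>1 \<in> space M"
    then show "{\<omega>\<^sub>2\<in>space S. (\<omega>\<^sub>1, \<omega>\<^sub>2) \<in> B} \<in> sets (G (s - \<tau> \<omega>\<^sub>1))"
      using assms(2)[of \<omega>\<^sub>1] by (simp add: pred_def space_pair_measure B_def)
  qed
  moreover have "{\<omega>\<in>space M. Q \<omega> \<omega>} = {\<omega>\<in>space E. (\<omega>, \<omega>) \<in> B}"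
    by (auto simp: space_pair_measure B_def)
  ultimately show ?thesis
    unfolding revealed_def mem_Collect_eq space_E by (intro bexI[of _ B] conjI)
qed

lemma revealed_sets: "revealed E S G \<tau> s \<subseteq> sets M"
proof
  fix A assume "A \<in> revealed E S G \<tau> s"
  then obtain B where B: "B \<in> sets (E \<Otimes>\<^sub>M S)" "A = {\<omega>\<in>space M. (\<omega>, \<omega>) \<in> B}"
    by (auto simp: revealed_def)
  from measurable_sets[OF diag B(1)] show "A \<in> sets M"
    by (simp add: B(2) vimage_def Int_def conj_commute)
qed

lemma revealedE:
  assumes "A \<in> revealed E S G \<tau> s"
  obtains B where "B \<in> sets (E \<Otimes>\<^sub>M S)" "A = {\<omega>\<in>space M. (\<omega>, \<omega>) \<in> B}"
    "\<And>\<omega>\<^sub>1. \<omega>\<^sub>1 \<in> space M \<Longrightarrow> Measurable.pred (G (s - \<tau> \<omega>\<^sub>1)) (\<lambda>\<omega>\<^sub>2. (\<omega>\<^sub>1, \<omega>\<^sub>2) \<in> B)"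
  using assms unfolding revealed_def by (auto simp: pred_def)

text \<open>An event of \<open>M\<close> is the trace of \<open>B\<close> on the diagonal and does
  not determine \<open>B\<close>. Complements and countable unions are therefore formed on chosen
  witnesses \<open>B\<close>, where the condition on sections can be checked for each first
  copy.\<close>

lemma sigma_algebra_revealed: "sigma_algebra (space M) (revealed E S G \<tau> s)"
  unfolding sigma_algebra_iff2
proof (intro conjI ballI allI impI)
  show "revealed E S G \<tau> s \<subseteq> Pow (space M)" by (auto simp: revealed_def)
  show "{} \<in> revealed E S G \<tau> s"
    using revealedI[of "\<lambda>_ _. False" s] by simp
next
  fix A assume "A \<in> revealed E S G \<tau> s"
  then obtain B where B [measurable]: "B \<in> sets (E \<Otimes>\<^sub>M S)" and A: "A = {\<omega>\<in>space M. (\<omega>, \<omega>) \<in> B}"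
    and sec: "\<And>\<omega>\<^sub>1. \<omega>\<^sub>1 \<in> space M \<Longrightarrow> Measurable.pred (G (s - \<tau> \<omega>\<^sub>1)) (\<lambda>\<omega>\<^sub>2. (\<omega>\<^sub>1, \<omega>\<^sub>2) \<in> B)"
    by (rule revealedE) blast
  have "{\<omega>\<in>space M. (\<omega>, \<omega>) \<notin> B} \<in> revealed E S G \<tau> s"
    by (rule revealedI) (use sec in \<open>auto simp: case_prod_beta\<close>)
  then show "space M - A \<in> revealed E S G \<tau> s"
    by (rule back_subst[of "\<lambda>A. A \<in> revealed E S G \<tau> s"]) (auto simp: A)
next
  fix A :: "nat \<Rightarrow> 'a set" assume "range A \<subseteq> revealed E S G \<tau> s"
  then have A': "A i \<in> revealed E S G \<tau> s" for i by auto
  define R where "R i B \<longleftrightarrow> B \<in> sets (E \<Otimes>\<^sub>M S) \<and> A i = {\<omega>\<in>space M. (\<omega>, \<omega>) \<in> B} \<and>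
      (\<forall>\<omega>\<^sub>1\<in>space M. Measurable.pred (G (s - \<tau> \<omega>\<^sub>1)) (\<lambda>\<omega>\<^sub>2. (\<omega>\<^sub>1, \<omega>\<^sub>2) \<in> B))" for i B
  have "\<exists>B. R i B" for i
    by (rule revealedE[OF A'[of i]]) (auto simp: R_def)
  then obtain B where R: "\<And>i. R i (B i)" by metis
  then have B [measurable]: "\<And>i. B i \<in> sets (E \<Otimes>\<^sub>M S)"
    and A: "\<And>i. A i = {\<omega>\<in>space M. (\<omega>, \<omega>) \<in> B i}"
    and sec: "\<And>i \<omega>\<^sub>1. \<omega>\<^sub>1 \<in> space M \<Longrightarrow>
      Measurable.pred (G (s - \<tau> \<omega>\<^sub>1)) (\<lambda>\<omega>\<^sub>2. (\<omega>\<^sub>1, \<omega>\<^sub>2) \<in> B i)"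
    by (simp_all add: R_def)
  have "{\<omega>\<in>space M. \<exists>i. (\<omega>, \<omega>) \<in> B i} \<in> revealed E S G \<tau> s"
    by (rule revealedI) (use sec in \<open>auto simp: case_prod_beta\<close>)
  then show "\<Union>(range A) \<in> revealed E S G \<tau> s"
    by (rule back_subst[of "\<lambda>A. A \<in> revealed E S G \<tau> s"]) (auto simp: A)
qed

lemma revealed_mono:
  assumes "s \<le> t" shows "revealed E S G \<tau> s \<subseteq> revealed E S G \<tau> t"
proof
  fix A assume "A \<in> revealed E S G \<tau> s"
  moreover have "sets (G (s - \<tau> \<omega>)) \<subseteq> sets (G (t - \<tau> \<omega>))" for \<omega>
    using assms by (intro mono_G) auto
  ultimately show "A \<in> revealed E S G \<tau> t" unfolding revealed_def by blast
qed

lemma sets_E_revealed: "sets E \<subseteq> revealed E S G \<tau> s"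
proof
  fix A assume A [measurable]: "A \<in> sets E"
  have "{\<omega>\<in>space M. \<omega> \<in> A} \<in> revealed E S G \<tau> s"
    by (rule revealedI[where Q="\<lambda>\<omega>\<^sub>1 \<omega>\<^sub>2. \<omega>\<^sub>1 \<in> A"]) (auto simp: case_prod_beta)
  moreover have "{\<omega>\<in>space M. \<omega> \<in> A} = A" using sets.sets_into_space[OF A] by auto
  ultimately show "A \<in> revealed E S G \<tau> s" by simp
qed

text \<open>Both integrals are disintegrated over the first copy. With it fixed, the section of the
  witness is an event of \<open>G\<close> at age \<open>s - \<tau> \<omega>\<^sub>1\<close>, to
  which \<open>eq\<close> applies. As \<open>eq\<close> is available for every first copy, the inner
  integrals agree pointwise.\<close>

lemma revealed_martingale:
  fixes \<Phi> \<Psi> :: "'a \<Rightarrow> 'a \<Rightarrow> real"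
  assumes [measurable]: "(\<lambda>(\<omega>\<^sub>1, \<omega>\<^sub>2). \<Phi> \<omega>\<^sub>1 \<omega>\<^sub>2) \<in> borel_measurable (E \<Otimes>\<^sub>M S)"
      "(\<lambda>(\<omega>\<^sub>1, \<omega>\<^sub>2). \<Psi> \<omega>\<^sub>1 \<omega>\<^sub>2) \<in> borel_measurable (E \<Otimes>\<^sub>M S)"
    and int: "integrable M (\<lambda>\<omega>. \<Phi> \<omega> \<omega>)" "integrable M (\<lambda>\<omega>. \<Psi> \<omega> \<omega>)"
    and A: "A \<in> revealed E S G \<tau> s"
    and eq: "\<And>\<omega>\<^sub>1 A'. \<omega>\<^sub>1 \<in> space M \<Longrightarrow> A' \<in> sets (G (s - \<tau> \<omega>\<^sub>1)) \<Longrightarrow>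
      (LINT \<omega>\<^sub>2:A'|M. \<Phi> \<omega>\<^sub>1 \<omega>\<^sub>2) = (LINT \<omega>\<^sub>2:A'|M. \<Psi> \<omega>\<^sub>1 \<omega>\<^sub>2)"
  shows "(LINT \<omega>:A|M. \<Phi> \<omega> \<omega>) = (LINT \<omega>:A|M. \<Psi> \<omega> \<omega>)"
proof -
  from A obtain B where B [measurable]: "B \<in> sets (E \<Otimes>\<^sub>M S)" and AB: "A = {\<omega>\<in>space M. (\<omega>, \<omega>) \<in> B}"
    and sec: "\<And>\<omega>\<^sub>1. \<omega>\<^sub>1 \<in> space M \<Longrightarrow> {\<omega>\<^sub>2\<in>space M. (\<omega>\<^sub>1, \<omega>\<^sub>2) \<in> B} \<in> sets (G (s - \<tau> \<omega>\<^sub>1))"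
    by (auto simp: revealed_def)
  have [measurable]: "A \<in> sets M" using A revealed_sets by blast
  have *: "(LINT \<omega>:A|M. \<Theta> \<omega> \<omega>) = (\<integral>\<omega>\<^sub>1. (LINT \<omega>\<^sub>2:{\<omega>\<^sub>2\<in>space M. (\<omega>\<^sub>1, \<omega>\<^sub>2) \<in> B}|M. \<Theta> \<omega>\<^sub>1 \<omega>\<^sub>2) \<partial>M)"
    if [measurable]: "(\<lambda>(\<omega>\<^sub>1, \<omega>\<^sub>2). \<Theta> \<omega>\<^sub>1 \<omega>\<^sub>2) \<in> borel_measurable (E \<Otimes>\<^sub>M S)"
    and int: "integrable M (\<lambda>\<omega>. \<Theta> \<omega> \<omega>)" for \<Theta> :: "'a \<Rightarrow> 'a \<Rightarrow> real"
  proof -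
    let ?f = "\<lambda>z. indicator B z * (case z of (\<omega>\<^sub>1, \<omega>\<^sub>2) \<Rightarrow> \<Theta> \<omega>\<^sub>1 \<omega>\<^sub>2)"
    have "(LINT \<omega>:A|M. \<Theta> \<omega> \<omega>) = (\<integral>\<omega>. ?f (\<omega>, \<omega>) \<partial>M)"
      unfolding set_lebesgue_integral_def
      by (intro Bochner_Integration.integral_cong) (auto simp: AB indicator_def)
    also have "\<dots> = (\<integral>\<omega>\<^sub>1. (\<integral>\<omega>\<^sub>2. ?f (\<omega>\<^sub>1, \<omega>\<^sub>2) \<partial>M) \<partial>M)"
    proof (rule integral_diag)
      have "integrable M (\<lambda>\<omega>. indicator A \<omega> *\<^sub>R \<Theta> \<omega> \<omega>)"
        by (intro integrable_mult_indicator int) simp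
      then show "integrable M (\<lambda>\<omega>. ?f (\<omega>, \<omega>))"
        by (rule Bochner_Integration.integrable_cong[THEN iffD1, rotated -1])
           (auto simp: AB indicator_def)
    qed measurable
    also have "\<dots> = (\<integral>\<omega>\<^sub>1. (LINT \<omega>\<^sub>2:{\<omega>\<^sub>2\<in>space M. (\<omega>\<^sub>1, \<omega>\<^sub>2) \<in> B}|M. \<Theta> \<omega>\<^sub>1 \<omega>\<^sub>2) \<partial>M)"
      unfolding set_lebesgue_integral_def
      by (intro Bochner_Integration.integral_cong[OF refl]) (auto simp: indicator_def)
    finally show ?thesis .
  qed
  show ?thesis
    unfolding *[OF assms(1) int(1)] *[OF assms(2) int(2)]
    by (intro Bochner_Integration.integral_cong[OF refl] eq sec)
qed

end

section \<open>Poisson processes\<close>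

lemma counting_path_mono: "counting_path n \<Longrightarrow> s \<le> t \<Longrightarrow> n s \<le> n t"
  unfolding counting_path_def by (auto intro!: card_mono)

lemma counting_path_zero: "counting_path n \<Longrightarrow> t \<le> 0 \<Longrightarrow> n t = 0"
proof -
  assume "counting_path n" "t \<le> 0"
  then obtain S where S: "S \<subseteq> {0<..}" "\<And>t. n t = card (S \<inter> {..t})"
    unfolding counting_path_def by blast
  have "S \<inter> {..t} = {}" using S(1) \<open>t \<le> 0\<close> by auto
  then show "n t = 0" using S(2) by simp
qed

text \<open>Counting paths are right-continuous, so the infimum in \<open>arrival_time\<close> is
  attained.\<close>

lemma arrival_time_le_iff:
  assumes n: "counting_path n" and unbounded: "\<exists>t. i < n t"
  shows "arrival_time n i \<le> t \<longleftrightarrow> i < n t"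
proof -
  from n obtain S where S: "S \<subseteq> {0<..}" "\<And>t. finite (S \<inter> {..t})" "\<And>t. n t = card (S \<inter> {..t})"
    unfolding counting_path_def by blast
  let ?A = "{t. i < n t}" and ?a = "arrival_time n i"
  have bdd: "bdd_below ?A"
  proof (rule bdd_belowI[of _ 0])
    show "0 \<le> t" if "t \<in> ?A" for t using counting_path_zero[OF n, of t] that by (cases "t \<le> 0") auto
  qed
  have ne: "?A \<noteq> {}" using unbounded by auto
  \<comment> \<open>Local finiteness gives an interval \<open>(?a, b]\<close> free of points: of
    length one if possible, otherwise reaching half way to the next point. The count is constant on
    it, so a time \<open>t' < b\<close> with \<open>i < n t'\<close> forces
    \<open>i < n ?a\<close>.\<close>
  have "\<exists>b>?a. S \<inter> {?a<..b} = {}"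
  proof (cases "S \<inter> {?a<..?a+1} = {}")
    case False
    have fin: "finite (S \<inter> {?a<..?a+1})" by (rule finite_subset[OF _ S(2)[of "?a+1"]]) auto
    let ?m = "Min (S \<inter> {?a<..?a+1})"
    have m: "?m \<in> S \<inter> {?a<..?a+1}" by (rule Min_in[OF fin False])
    have "S \<inter> {?a<..(?a + ?m) / 2} = {}"
    proof (rule ccontr)
      assume "S \<inter> {?a<..(?a + ?m) / 2} \<noteq> {}"
      then obtain x where "x \<in> S" "?a < x" "x \<le> (?a + ?m) / 2" by auto
      moreover from this m have "?m \<le> x" by (intro Min_le fin) auto
      ultimately show False using m by auto
    qed
    then show ?thesis using m by (intro exI[of _ "(?a + ?m) / 2"]) auto
  qed (auto intro: exI[of _ "?a + 1"])
  then obtain b where b: "b > ?a" "S \<inter> {?a<..b} = {}" by blast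
  then have "S \<inter> {..b} = S \<inter> {..?a}" by force
  then have nb: "n b = n ?a" by (simp add: S(3))
  from b(1) obtain t' where "t' \<in> ?A" "t' < b"
    using cInf_lessD[OF ne] unfolding arrival_time_def by blast
  then have "i < n ?a" using counting_path_mono[OF n, of t' b] nb by auto
  then show ?thesis
    using counting_path_mono[OF n, of ?a t] cInf_lower[OF _ bdd, of t]
    unfolding arrival_time_def[symmetric] by auto
qed

text \<open>Jumps have size one: the arrival of the point with index \<open>Suc i\<close> adds at
  most one to the count, so the count exceeded \<open>i\<close> at some strictly earlier
  time.\<close>

lemma arrival_time_strict_mono:
  assumes n: "counting_path n" and unbounded: "\<And>i. \<exists>t. i < n t"
  shows "strict_mono (arrival_time n)"
proof (rule strict_monoI_Suc)
  fix i
  from n obtain S where S: "S \<subseteq> {0<..}" "\<And>t. finite (S \<inter> {..t})" "\<And>t. n t = card (S \<inter> {..t})"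
    unfolding counting_path_def by blast
  note iff = arrival_time_le_iff[OF n unbounded]
  let ?a = "arrival_time n (Suc i)"
  have Suc: "Suc i < n ?a" using iff[of "Suc i" ?a] by simp
  then have le: "arrival_time n i \<le> ?a" using iff[of i ?a] by simp
  have "\<exists>u<?a. S \<inter> {..<?a} \<subseteq> {..u}"
  proof (cases "S \<inter> {..<?a} = {}")
    case False
    have fin: "finite (S \<inter> {..<?a})" by (rule finite_subset[OF _ S(2)[of "?a"]]) auto
    show ?thesis using Max_in[OF fin False] Max_ge[OF fin] by blast
  qed (auto intro: exI[of _ "?a - 1"])
  then obtain u where u: "u < ?a" "S \<inter> {..<?a} \<subseteq> {..u}" by blast
  then have "S \<inter> {..?a} \<subseteq> insert ?a (S \<inter> {..u})" by force
  then have "n ?a \<le> card (insert ?a (S \<inter> {..u}))"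
    unfolding S(3)[of ?a] by (intro card_mono) (auto simp: S)
  also have "\<dots> \<le> Suc (n u)" unfolding S(3)[of u] by (rule card_insert_le_m1) auto
  finally have "i < n u" using Suc by simp
  then have "arrival_time n i \<le> u" by (simp add: iff)
  then show "arrival_time n i < arrival_time n (Suc i)" using u by simp
qed

lemma arrival_time_pos:
  assumes n: "counting_path n" and unbounded: "\<And>i. \<exists>t. i < n t"
  shows "0 < arrival_time n i"
  using arrival_time_le_iff[OF n unbounded, of i 0] counting_path_zero[OF n, of 0] by simp

text \<open>The factor \<open>Suc n\<close> cancels against the factorial in the Poisson weight of
  \<open>Suc n\<close>, so the series of the mean is \<open>exp (- r) * r\<close> times the
  exponential series.\<close>

lemma
  assumes "0 < r"
  shows integrable_poisson: "integrable (measure_pmf (poisson_pmf r)) real"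
    and expectation_poisson: "measure_pmf.expectation (poisson_pmf r) real = r"
proof -
  have "(\<lambda>n. exp (- r) * r * (r ^ n /\<^sub>R fact n)) sums (exp (- r) * r * exp r)"
    by (intro sums_mult exp_converges)
  then have "(\<lambda>n. pmf (poisson_pmf r) (Suc n) * real (Suc n)) sums r"
    using assms by (simp add: exp_minus field_simps del: of_nat_Suc)
  then have *: "(\<lambda>n. pmf (poisson_pmf r) n * real n) sums r"
    by (subst (asm) sums_Suc_iff) simp
  have "(\<integral>\<^sup>+n. ennreal (real n) \<partial>measure_pmf (poisson_pmf r)) = (\<Sum>n. ennreal (pmf (poisson_pmf r) n * real n))"
    by (subst nn_integral_measure_pmf) (simp add: nn_integral_count_space_nat ennreal_mult'')
  also have "\<dots> = ennreal r"
    by (rule suminf_ennreal_eq[OF _ *]) simp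
  finally have "(\<integral>\<^sup>+n. ennreal (real n) \<partial>measure_pmf (poisson_pmf r)) = ennreal r" .
  then show "integrable (measure_pmf (poisson_pmf r)) real"
    and "measure_pmf.expectation (poisson_pmf r) real = r"
    using assms by (auto intro!: integrableI_nn_integral_finite[where x=r] integral_eq_nn_integral[THEN trans] simp: nn_integral_eq_integral)
qed

section \<open>Point sequences, their histories and their compensators\<close>

definition points_history :: "'a measure \<Rightarrow> ('i \<Rightarrow> 'a \<Rightarrow> real) \<Rightarrow> real \<Rightarrow> 'a measure" where
  "points_history M T s = sigma (space M) {{\<omega>\<in>space M. T i \<omega> \<le> u} |i u. u \<le> s}"

lemma space_points_history [simp]: "space (points_history M T s) = space M"
  by (simp add: points_history_def space_measure_of_conv)

lemma sets_points_history:
  "sets (points_history M T s) = sigma_sets (space M) {{\<omega>\<in>space M. T i \<omega> \<le> u} |i u. u \<le> s}"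
  unfolding points_history_def by (rule sets_measure_of) auto

lemma points_history_mono: "s \<le> t \<Longrightarrow> sets (points_history M T s) \<subseteq> sets (points_history M T t)"
  unfolding sets_points_history by (rule sigma_sets_mono') force

lemma points_history_pred: "u \<le> s \<Longrightarrow> Measurable.pred (points_history M T s) (\<lambda>\<omega>. T i \<omega> \<le> u)"
  unfolding pred_def sets_points_history space_points_history by (rule sigma_sets.Basic) auto

text \<open>Collects what the later arguments use of a Poisson process: regular paths at every
  sample point, and the compensator identity in place of independent increments. The terms
  \<open>max 0\<close> keep the identity valid at negative times, which occur as ages of parents
  that have not yet arrived.\<close>

definition poisson_points :: "'a measure \<Rightarrow> real \<Rightarrow> (nat \<Rightarrow> 'a \<Rightarrow> real) \<Rightarrow> bool" where
  "poisson_points M r T \<longleftrightarrow>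
    (\<forall>\<omega>. strict_mono (\<lambda>i. T i \<omega>)) \<and> (\<forall>i \<omega>. 0 < T i \<omega>) \<and> (\<forall>\<omega> t. finite {i. T i \<omega> \<le> t}) \<and>
    (\<forall>i. T i \<in> borel_measurable M) \<and>
    (\<forall>t. integrable M (\<lambda>\<omega>. real (card {i. T i \<omega> \<le> t}))) \<and>
    (\<forall>s t A. s \<le> t \<longrightarrow> A \<in> sets (points_history M T s) \<longrightarrow>
      (LINT \<omega>:A|M. real (card {i. T i \<omega> \<le> t}) - real (card {i. T i \<omega> \<le> s})) =
        r * (max 0 t - max 0 s) * measure M A)"

lemma poisson_pointsD:
  assumes "poisson_points M r T"
  shows "strict_mono (\<lambda>i. T i \<omega>)" "0 < T i \<omega>" "finite {i. T i \<omega> \<le> t}" "T i \<in> borel_measurable M"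
    "integrable M (\<lambda>\<omega>. real (card {i. T i \<omega> \<le> t}))"
    "s \<le> t \<Longrightarrow> A \<in> sets (points_history M T s) \<Longrightarrow>
      (LINT \<omega>:A|M. real (card {i. T i \<omega> \<le> t}) - real (card {i. T i \<omega> \<le> s})) =
        r * (max 0 t - max 0 s) * measure M A"
  using assms unfolding poisson_points_def by auto

section \<open>From a Poisson process to a regular point sequence\<close>

context prob_space
begin

text \<open>The event that the count never exceeds \<open>k\<close> has probability at most the
  Poisson mass of \<open>{..k}\<close> with mean \<open>r * m\<close>, which vanishes as
  \<open>m\<close> grows.\<close>

lemma poisson_process_unbounded:
  assumes N: "poisson_process M r N" and r: "0 < r"
  shows "AE \<omega> in M. \<forall>k. \<exists>t. k < N t \<omega>"
  unfolding AE_all_countable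
proof
  fix k
  have [measurable]: "N t \<in> measurable M (count_space UNIV)" for t
    using N by (auto simp: poisson_process_def)
  let ?A = "{\<omega>\<in>space M. \<forall>m::nat. N (real m) \<omega> \<le> k}"
  have le: "prob ?A \<le> (\<Sum>j\<le>k. (r * real m) ^ j / exp (r * real m) / fact j)" if m: "0 < m" for m :: nat
  proof -
    \<comment> \<open>The truncated difference is at most \<open>N (real m)\<close>, whatever the
      value of \<open>N 0\<close>.\<close>
    have "prob ?A \<le> prob ((\<lambda>\<omega>. N (real m) \<omega> - N 0 \<omega>) -` {..k} \<inter> space M)"
      by (intro finite_measure_mono) (auto intro: le_trans[OF diff_le_self])
    also have "\<dots> = measure (distr M (count_space UNIV) (\<lambda>\<omega>. N (real m) \<omega> - N 0 \<omega>)) {..k}"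
      by (subst measure_distr) auto
    also have "distr M (count_space UNIV) (\<lambda>\<omega>. N (real m) \<omega> - N 0 \<omega>)
        = measure_pmf (poisson_pmf (r * (real m - 0)))"
      using N m unfolding poisson_process_def by fastforce
    also have "measure \<dots> {..k} = (\<Sum>j\<le>k. pmf (poisson_pmf (r * (real m - 0))) j)"
      by (simp add: measure_measure_pmf_finite)
    also have "\<dots> = (\<Sum>j\<le>k. (r * real m) ^ j / exp (r * real m) / fact j)"
      using m r by (intro sum.cong refl) (simp add: exp_minus field_simps)
    finally show ?thesis .
  qed
  have "filterlim (\<lambda>m::nat. r * real m) at_top sequentially"
    using r by (intro filterlim_tendsto_pos_mult_at_top[OF tendsto_const]) (auto simp: filterlim_real_sequentially)
  then have "(\<lambda>m::nat. (\<Sum>j\<le>k. (r * real m) ^ j / exp (r * real m) / fact j)) \<longlonglongrightarrow> (\<Sum>j\<le>k. 0 / fact j)"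
    by (intro tendsto_sum tendsto_divide tendsto_const filterlim_compose[OF tendsto_power_div_exp_0]) auto
  then have "prob ?A \<le> (\<Sum>j\<le>k. 0 / fact j)"
    by (rule LIMSEQ_le_const) (use le in \<open>auto intro!: exI[of _ 1]\<close>)
  then have "prob ?A = 0" using measure_nonneg[of M ?A] by simp
  then have "AE \<omega> in M. \<omega> \<notin> ?A"
    by (subst AE_iff_measurable[OF _ refl]) (auto simp: emeasure_eq_measure)
  then show "AE \<omega> in M. \<exists>t. k < N t \<omega>"
    by (rule AE_mp) (auto simp: not_le intro!: AE_I2)
qed

text \<open>Independence of increments is given along monotone sequences of times. A grid through
  \<open>0\<close>, \<open>s\<close> and the points of \<open>J\<close> writes every
  \<open>N u\<close> as a sum of increments up to \<open>s\<close>, while \<open>N t - N s\<close>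
  is one further increment.\<close>

lemma poisson_increment_indep:
  assumes N: "poisson_process M r N" and st: "0 \<le> s" "s < t" and J: "finite J" "J \<subseteq> {0..s}"
  shows "prob {\<omega>\<in>space M. (\<forall>u\<in>J. N u \<omega> \<in> B u) \<and> N t \<omega> - N s \<omega> \<in> C} =
    prob {\<omega>\<in>space M. \<forall>u\<in>J. N u \<omega> \<in> B u} * prob {\<omega>\<in>space M. N t \<omega> - N s \<omega> \<in> C}"
proof -
  have [measurable]: "N t \<in> measurable M (count_space UNIV)" for t
    using N by (auto simp: poisson_process_def)
  have path: "AE \<omega> in M. counting_path (\<lambda>t. N t \<omega>)" using N by (auto simp: poisson_process_def)
  let ?J = "insert 0 (insert s J)"
  define xs where "xs = sorted_list_of_set ?J"
  define n where "n = length xs - 1"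
  \<comment> \<open>The sequence is constantly \<open>t\<close> beyond the grid: increment
    \<open>n\<close> is then \<open>N t - N s\<close>, and all later ones vanish.\<close>
  define \<tau> where "\<tau> k = (if k \<le> n then xs ! k else t)" for k
  have set_xs: "set xs = ?J" and srt: "sorted xs"
    using J unfolding xs_def by (simp_all del: sorted_list_of_set_insert_remove)
  then have len: "length xs = Suc n" unfolding n_def by (cases xs) auto
  have rng: "x \<in> {0..s}" if "x \<in> set xs" for x using that J st unfolding set_xs by auto
  have bnd: "xs ! k \<in> {0..s}" if "k \<le> n" for k using that len by (intro rng nth_mem) simp
  have x0: "xs ! 0 = 0"
  proof -
    have "0 \<in> set xs" by (simp add: set_xs)
    then obtain i where "i \<le> n" "xs ! i = 0" using len by (auto simp: in_set_conv_nth less_Suc_eq_le)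
    then show ?thesis using sorted_nth_mono[OF srt, of 0 i] len bnd[of 0] by auto
  qed
  have xn: "xs ! n = s"
  proof -
    have "s \<in> set xs" by (simp add: set_xs)
    then obtain i where "i \<le> n" "xs ! i = s" using len by (auto simp: in_set_conv_nth less_Suc_eq_le)
    then show ?thesis using sorted_nth_mono[OF srt, of i n] len bnd[of n] by auto
  qed
  have \<tau>: "mono \<tau>" "0 \<le> \<tau> 0"
  proof -
    have "\<tau> i \<le> \<tau> j" if "i \<le> j" for i j
      using that sorted_nth_mono[OF srt, of i j] len bnd[of i] st by (auto simp: \<tau>_def)
    then show "mono \<tau>" by (rule monoI)
  qed (use x0 in \<open>simp add: \<tau>_def\<close>)
  define X where "X k \<omega> = N (\<tau> (Suc k)) \<omega> - N (\<tau> k) \<omega>" for k \<omega>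
  have indepX: "indep_vars (\<lambda>_. count_space UNIV) X UNIV"
    using N \<tau> unfolding poisson_process_def X_def[abs_def] by blast
  have Xn: "X n = (\<lambda>\<omega>. N t \<omega> - N s \<omega>)" by (auto simp: X_def \<tau>_def xn)
  have "\<forall>u\<in>J. \<exists>k\<le>n. xs ! k = u"
    using set_xs len by (metis in_set_conv_nth insertCI less_Suc_eq_le)
  then obtain k where k: "\<And>u. u \<in> J \<Longrightarrow> k u \<le> n \<and> xs ! k u = u" by metis
  \<comment> \<open>Adding the differences recovers \<open>N\<close>, because the path starts at
    zero and is monotone, which makes the truncated subtraction exact.\<close>
  have tele: "(\<Sum>j<k. X j \<omega>) = N (\<tau> k) \<omega>" if "counting_path (\<lambda>t. N t \<omega>)" for k \<omega>
  proof (induction k)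
    case 0 then show ?case using counting_path_zero[OF that, of 0] by (simp add: \<tau>_def x0)
  next
    case (Suc k)
    then show ?case
      using counting_path_mono[OF that monoD[OF \<tau>(1), of k "Suc k"]] by (simp add: X_def)
  qed
  define f where "f x \<longleftrightarrow> (\<forall>u\<in>J. (\<Sum>j<k u. x j) \<in> B u)" for x :: "nat \<Rightarrow> nat"
  have f_restrict: "f (restrict (\<lambda>i. X i \<omega>) {..<n}) \<longleftrightarrow> f (\<lambda>i. X i \<omega>)" for \<omega>
  proof -
    have "(\<Sum>j<k u. restrict (\<lambda>i. X i \<omega>) {..<n} j) = (\<Sum>j<k u. X j \<omega>)" if "u \<in> J" for u
      using k[OF that] by (intro sum.cong) auto
    then show ?thesis by (simp add: f_def)
  qed
  have fX: "AE \<omega> in M. f (\<lambda>i. X i \<omega>) \<longleftrightarrow> (\<forall>u\<in>J. N u \<omega> \<in> B u)"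
    using path
  proof eventually_elim
    case (elim \<omega>)
    have "(\<Sum>j<k u. X j \<omega>) = N u \<omega>" if "u \<in> J" for u
      using k[OF that] tele[OF elim] by (simp add: \<tau>_def)
    then show ?case by (simp add: f_def)
  qed
  have [measurable]: "X k \<in> measurable M (count_space UNIV)" for k
    unfolding X_def[abs_def] by measurable
  \<comment> \<open>A finite product of discrete spaces is discrete, so every function of the first
    \<open>n\<close> increments is measurable.\<close>
  have PiM: "PiM {..<n} (\<lambda>_. count_space (UNIV::nat set)) = count_space (PiE {..<n} (\<lambda>_. UNIV))"
    by (rule count_space_PiM_finite) auto
  have "indep_var (PiM {..<n} (\<lambda>_. count_space UNIV)) (\<lambda>\<omega>. restrict (\<lambda>i. X i \<omega>) {..<n})
      (PiM {n} (\<lambda>_. count_space UNIV)) (\<lambda>\<omega>. restrict (\<lambda>i. X i \<omega>) {n})"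
    by (rule indep_var_restrict[OF indepX]) auto
  then have "indep_var (count_space UNIV) (f \<circ> (\<lambda>\<omega>. restrict (\<lambda>i. X i \<omega>) {..<n}))
      (count_space UNIV) ((\<lambda>x. x n \<in> C) \<circ> (\<lambda>\<omega>. restrict (\<lambda>i. X i \<omega>) {n}))"
    by (rule indep_var_compose) (auto simp: PiM)
  then have indep: "indep_var (count_space UNIV) (\<lambda>\<omega>. f (\<lambda>i. X i \<omega>)) (count_space UNIV) (\<lambda>\<omega>. X n \<omega> \<in> C)"
    by (simp add: comp_def f_restrict)
  have [measurable]: "Measurable.pred M (\<lambda>\<omega>. f (\<lambda>i. X i \<omega>))"
    using indep_var_rv1[OF indep] .
  have mJ [measurable]: "{\<omega>\<in>space M. \<forall>u\<in>J. N u \<omega> \<in> B u} \<in> events"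
    using J by (intro sets.sets_Collect_finite_All) auto
  have "prob {\<omega>\<in>space M. (\<forall>u\<in>J. N u \<omega> \<in> B u) \<and> N t \<omega> - N s \<omega> \<in> C}
      = prob {\<omega>\<in>space M. f (\<lambda>i. X i \<omega>) \<and> X n \<omega> \<in> C}"
  proof (rule finite_measure_eq_AE)
    show "AE \<omega> in M. \<omega> \<in> {\<omega>\<in>space M. (\<forall>u\<in>J. N u \<omega> \<in> B u) \<and> N t \<omega> - N s \<omega> \<in> C} \<longleftrightarrow>
        \<omega> \<in> {\<omega>\<in>space M. f (\<lambda>i. X i \<omega>) \<and> X n \<omega> \<in> C}"
      using fX by eventually_elim (auto simp: Xn)
    have "{\<omega>\<in>space M. (\<forall>u\<in>J. N u \<omega> \<in> B u) \<and> N t \<omega> - N s \<omega> \<in> C}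
       = {\<omega>\<in>space M. \<forall>u\<in>J. N u \<omega> \<in> B u} \<inter> {\<omega>\<in>space M. N t \<omega> - N s \<omega> \<in> C}" by auto
    also have "\<dots> \<in> events" by measurable
    finally show "{\<omega>\<in>space M. (\<forall>u\<in>J. N u \<omega> \<in> B u) \<and> N t \<omega> - N s \<omega> \<in> C} \<in> events" .
  qed measurable
  also have "\<dots> = prob ((\<lambda>\<omega>. (f (\<lambda>i. X i \<omega>), X n \<omega> \<in> C)) -` ({True} \<times> {True}) \<inter> space M)"
    by (rule arg_cong[where f=prob]) auto
  also have "\<dots> = prob ((\<lambda>\<omega>. f (\<lambda>i. X i \<omega>)) -` {True} \<inter> space M) * prob ((\<lambda>\<omega>. X n \<omega> \<in> C) -` {True} \<inter> space M)"
    by (rule indep_varD[OF indep]) auto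
  also have "prob ((\<lambda>\<omega>. X n \<omega> \<in> C) -` {True} \<inter> space M) = prob {\<omega>\<in>space M. N t \<omega> - N s \<omega> \<in> C}"
    by (rule arg_cong[where f=prob]) (auto simp: Xn)
  also have "prob ((\<lambda>\<omega>. f (\<lambda>i. X i \<omega>)) -` {True} \<inter> space M) = prob {\<omega>\<in>space M. \<forall>u\<in>J. N u \<omega> \<in> B u}"
    by (rule finite_measure_eq_AE) (use fX in \<open>auto elim!: eventually_mono\<close>)
  finally show ?thesis .
qed

text \<open>On two independent copies the indicator of \<open>A\<close> and the function
  \<open>f\<close> depend on different coordinates, so the iterated integral factorises.\<close>

lemma indep_set_integral:
  fixes f :: "'a \<Rightarrow> real"
  assumes indep: "indep_set \<A> \<B>" and \<A>: "sigma_algebra (space M) \<A>" and \<B>: "sigma_algebra (space M) \<B>"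
    and A: "A \<in> \<A>" and f: "\<And>B. B \<in> sets borel \<Longrightarrow> f -` B \<inter> space M \<in> \<B>" and int: "integrable M f"
  shows "(LINT \<omega>:A|M. f \<omega>) = prob A * expectation f"
proof -
  let ?E = "sigma (space M) \<A>" and ?S = "sigma (space M) \<B>"
  have sub: "\<A> \<subseteq> events" "\<B> \<subseteq> events"
    using indep_setD_ev1[OF indep] indep_setD_ev2[OF indep] by auto
  have sets: "sets ?E = \<A>" "sets ?S = \<B>"
    using \<A> \<B> by (simp_all add: sigma_algebra.sets_measure_of_eq)
  interpret independent_pair M ?E ?S
    by unfold_locales (use sub indep in \<open>auto simp: subalgebra_def sets space_measure_of_conv\<close>)
  have [measurable]: "A \<in> sets ?E" "A \<in> events" using A sub by (auto simp: sets)
  have [measurable]: "f \<in> borel_measurable ?S"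
    using f by (auto simp: measurable_def sets space_measure_of_conv)
  have "(LINT \<omega>:A|M. f \<omega>) = (\<integral>\<omega>. (case (\<omega>, \<omega>) of (\<omega>\<^sub>1, \<omega>\<^sub>2) \<Rightarrow> indicator A \<omega>\<^sub>1 * f \<omega>\<^sub>2) \<partial>M)"
    by (simp add: set_lebesgue_integral_def)
  also have "\<dots> = (\<integral>\<omega>\<^sub>1. (\<integral>\<omega>\<^sub>2. (case (\<omega>\<^sub>1, \<omega>\<^sub>2) of (\<omega>\<^sub>1, \<omega>\<^sub>2) \<Rightarrow> indicator A \<omega>\<^sub>1 * f \<omega>\<^sub>2) \<partial>M) \<partial>M)"
    using integrable_mult_indicator[OF \<open>A \<in> events\<close> int]
    by (intro integral_diag) (auto simp: case_prod_beta)
  also have "\<dots> = prob A * expectation f"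
    using \<open>A \<in> events\<close> by simp
  finally show ?thesis .
qed

end

context prob_space
begin

lemma sigma_sets_subset_null_completion:
  assumes "sigma_algebra (space M) G" "\<And>A. A \<in> \<E> \<Longrightarrow> A \<in> null_completion M G"
  shows "sigma_sets (space M) \<E> \<subseteq> null_completion M G"
  using assms by (intro sigma_algebra.sigma_sets_subset sigma_algebra_null_completion) auto

text \<open>Up to null sets, each event of the history at \<open>s\<close> is determined by values
  of \<open>N\<close> on \<open>[0,s]\<close>. The cylinder events with finitely many times form an
  intersection-stable family independent of the increment after \<open>s\<close>; independence
  extends to the generated and then to the completed \<sigma>-algebra.\<close>

lemma poisson_process_history:
  assumes N: "poisson_process M r N" and r: "0 < r"
    and meas: "\<And>i u. {\<omega>\<in>space M. T i \<omega> \<le> u} \<in> events"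
    and T: "AE \<omega> in M. \<forall>t i. T i \<omega> \<le> t \<longleftrightarrow> i < N t \<omega>"
    and st: "0 \<le> s" "s < t" and A: "A \<in> sets (points_history M T s)"
  shows "(LINT \<omega>:A|M. real (N t \<omega> - N s \<omega>)) = r * (t - s) * prob A"
proof -
  have [measurable]: "N t \<in> measurable M (count_space UNIV)" for t
    using N by (auto simp: poisson_process_def)
  have path: "AE \<omega> in M. counting_path (\<lambda>t. N t \<omega>)" using N by (auto simp: poisson_process_def)
  let ?D = "\<lambda>\<omega>. N t \<omega> - N s \<omega>"
  have D [measurable]: "?D \<in> measurable M (count_space UNIV)" by measurable
  have distr: "distr M (count_space UNIV) ?D = measure_pmf (poisson_pmf (r * (t - s)))"
    using N st by (auto simp: poisson_process_def)
  have rst: "0 < r * (t - s)" using r st by simp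
  have int: "integrable M (\<lambda>\<omega>. real (?D \<omega>))"
    using integrable_poisson[OF rst] unfolding distr[symmetric]
    by (subst (asm) integrable_distr_eq) auto
  have E: "expectation (\<lambda>\<omega>. real (?D \<omega>)) = r * (t - s)"
    using expectation_poisson[OF rst] unfolding distr[symmetric]
    by (subst (asm) integral_distr) auto
  define \<A> where "\<A> = {{\<omega>\<in>space M. \<forall>u\<in>J. N u \<omega> \<in> B u} |J B. finite J \<and> J \<subseteq> {0..s}}"
  define \<D> where "\<D> = {{\<omega>\<in>space M. ?D \<omega> \<in> C} |C. True}"
  have AE: "\<A> \<subseteq> events" unfolding \<A>_def by (auto intro!: sets.sets_Collect_finite_All)
  have DE: "\<D> \<subseteq> events" unfolding \<D>_def by auto
  have "indep_set \<A> \<D>"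
  proof (rule indep_setI[OF AE DE])
    fix a b assume "a \<in> \<A>" "b \<in> \<D>"
    then obtain J B C where "a = {\<omega>\<in>space M. \<forall>u\<in>J. N u \<omega> \<in> B u}" "finite J" "J \<subseteq> {0..s}"
      "b = {\<omega>\<in>space M. ?D \<omega> \<in> C}" by (auto simp: \<A>_def \<D>_def)
    moreover from this have "a \<inter> b = {\<omega>\<in>space M. (\<forall>u\<in>J. N u \<omega> \<in> B u) \<and> ?D \<omega> \<in> C}" by auto
    ultimately show "prob (a \<inter> b) = prob a * prob b"
      using poisson_increment_indep[OF N st] by simp
  qed
  moreover have "Int_stable \<A>"
  proof (rule Int_stableI)
    fix a b assume "a \<in> \<A>" "b \<in> \<A>"
    then obtain J B J' B' where "a = {\<omega>\<in>space M. \<forall>u\<in>J. N u \<omega> \<in> B u}" "finite J" "J \<subseteq> {0..s}"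
      "b = {\<omega>\<in>space M. \<forall>u\<in>J'. N u \<omega> \<in> B' u}" "finite J'" "J' \<subseteq> {0..s}" by (auto simp: \<A>_def)
    \<comment> \<open>Both constraints are put on the union of the two time sets; at times where one
      of them is silent its set is \<open>UNIV\<close>.\<close>
    then show "a \<inter> b \<in> \<A>" unfolding \<A>_def mem_Collect_eq
      by (intro exI[of _ "J \<union> J'"] exI[of _ "\<lambda>u. (if u \<in> J then B u else UNIV) \<inter> (if u \<in> J' then B' u else UNIV)"])
         (auto split: if_splits)
  qed
  moreover have "Int_stable \<D>"
  proof (rule Int_stableI)
    fix a b assume "a \<in> \<D>" "b \<in> \<D>"
    then obtain C C' where "a = {\<omega>\<in>space M. ?D \<omega> \<in> C}" "b = {\<omega>\<in>space M. ?D \<omega> \<in> C'}"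
      by (auto simp: \<D>_def)
    then show "a \<inter> b \<in> \<D>" unfolding \<D>_def by (auto intro!: exI[of _ "C \<inter> C'"])
  qed
  ultimately have "indep_set (sigma_sets (space M) \<A>) (sigma_sets (space M) \<D>)"
    by (rule indep_set_sigma_sets)
  \<comment> \<open>The completion enters because \<open>T\<close> obeys the counting relation only
    almost surely, so its events are cylinder events only up to null sets.\<close>
  then have "indep_sets (\<lambda>b. null_completion M (case b of True \<Rightarrow> sigma_sets (space M) \<A> | False \<Rightarrow> sigma_sets (space M) \<D>)) UNIV"
    unfolding indep_set_def by (rule indep_sets_null_completion)
  then have indep: "indep_set (null_completion M (sigma_sets (space M) \<A>)) (null_completion M (sigma_sets (space M) \<D>))"
    unfolding indep_set_def by (rule indep_sets_cong[THEN iffD1, rotated -1]) (auto split: bool.split)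
  have sa: "sigma_algebra (space M) (sigma_sets (space M) \<A>)" "sigma_algebra (space M) (sigma_sets (space M) \<D>)"
    using AE DE sets.space_closed[of M] by (blast intro!: sigma_algebra_sigma_sets)+
  have "sets (points_history M T s) \<subseteq> null_completion M (sigma_sets (space M) \<A>)"
    unfolding sets_points_history
  proof (rule sigma_sets_subset_null_completion[OF sa(1)])
    fix B assume "B \<in> {{\<omega>\<in>space M. T i \<omega> \<le> u} |i u. u \<le> s}"
    then obtain i u where B: "B = {\<omega>\<in>space M. T i \<omega> \<le> u}" "u \<le> s" by auto
    show "B \<in> null_completion M (sigma_sets (space M) \<A>)"
    proof (cases "0 \<le> u")
      case True
      have "{\<omega>\<in>space M. \<forall>v\<in>{u}. N v \<omega> \<in> {i<..}} \<in> \<A>"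
        using B True unfolding \<A>_def mem_Collect_eq by (intro exI[of _ "{u}"] exI[of _ "\<lambda>_. {i<..}"]) auto
      moreover have "AE \<omega> in M. \<omega> \<in> B \<longleftrightarrow> \<omega> \<in> {\<omega>\<in>space M. \<forall>v\<in>{u}. N v \<omega> \<in> {i<..}}"
        using T by eventually_elim (auto simp: B)
      ultimately show ?thesis using meas B by (intro null_completionI) auto
    next
      case False
      have "AE \<omega> in M. \<omega> \<in> B \<longleftrightarrow> \<omega> \<in> {}"
        using T path
      proof eventually_elim
        case (elim \<omega>) then show ?case using counting_path_zero[OF elim(2), of u] False by (auto simp: B)
      qed
      then show ?thesis using meas B by (intro null_completionI[where B="{}"]) (auto intro: sigma_sets.Empty)
    qed
  qed
  then have A': "A \<in> null_completion M (sigma_sets (space M) \<A>)" using A by auto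
  have "(LINT \<omega>:A|M. real (?D \<omega>)) = prob A * expectation (\<lambda>\<omega>. real (?D \<omega>))"
  proof (rule indep_set_integral[OF indep _ _ A' _ int])
    fix B :: "real set" assume "B \<in> sets borel"
    have "(\<lambda>\<omega>. real (?D \<omega>)) -` B \<inter> space M = {\<omega>\<in>space M. ?D \<omega> \<in> real -` B}" by auto
    also have "\<dots> \<in> sigma_sets (space M) \<D>" by (rule sigma_sets.Basic) (auto simp: \<D>_def)
    also have "sigma_sets (space M) \<D> \<subseteq> null_completion M (sigma_sets (space M) \<D>)"
      by (intro subset_null_completion sets.sigma_sets_subset DE)
    finally show "(\<lambda>\<omega>. real (?D \<omega>)) -` B \<inter> space M \<in> null_completion M (sigma_sets (space M) \<D>)" .
  qed (intro sigma_algebra_null_completion sa)+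
  then show ?thesis by (simp add: E)
qed

text \<open>Takes the arrival times outside a null set \<open>Z\<close> and the sequence
  \<open>1, 2, ...\<close> on it, so that order, positivity and local finiteness hold at every
  sample point. In exchange, the events of \<open>T\<close> lie only in the completion of those
  generated by \<open>N\<close>.\<close>

lemma poisson_process_points:
  assumes N: "poisson_process M r N" and r: "0 < r"
  shows "\<exists>T. poisson_points M r T \<and>
    (\<forall>i u. {\<omega>\<in>space M. T i \<omega> \<le> u} \<in> null_completion M (generated_events M N)) \<and>
    (AE \<omega> in M. (\<forall>t i. T i \<omega> \<le> t \<longleftrightarrow> i < N t \<omega>) \<and> (\<forall>i. T i \<omega> = arrival_time (\<lambda>t. N t \<omega>) i))"
proof -
  have [measurable]: "N t \<in> measurable M (count_space UNIV)" for t
    using N by (auto simp: poisson_process_def)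
  have AE_good: "AE \<omega> in M. counting_path (\<lambda>t. N t \<omega>) \<and> (\<forall>k. \<exists>t. k < N t \<omega>)"
    using N poisson_process_unbounded[OF N r] by (auto simp: poisson_process_def)
  obtain Z where Z: "Z \<in> null_sets M"
    and good: "\<And>\<omega>. \<omega> \<in> space M - Z \<Longrightarrow> counting_path (\<lambda>t. N t \<omega>) \<and> (\<forall>k. \<exists>t. k < N t \<omega>)"
    by (rule AE_E3[OF AE_good]) blast
  define T where "T i \<omega> = (if \<omega> \<in> space M - Z then arrival_time (\<lambda>t. N t \<omega>) i else real i + 1)" for i \<omega>
  have AEZ: "AE \<omega> in M. \<omega> \<in> space M - Z"
    using AE_not_in[OF Z] by (auto elim: eventually_mono intro: AE_conjI)
  have iff: "T i \<omega> \<le> t \<longleftrightarrow> i < N t \<omega>" if "\<omega> \<in> space M - Z" for \<omega> i t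
    using arrival_time_le_iff[of "\<lambda>t. N t \<omega>" i t] good[OF that] that by (simp add: T_def)
  have 1: "strict_mono (\<lambda>i. T i \<omega>)" for \<omega>
  proof (cases "\<omega> \<in> space M - Z")
    case True
    then show ?thesis
      using arrival_time_strict_mono[of "\<lambda>t. N t \<omega>"] good[OF True] by (auto simp: T_def strict_mono_def)
  next
    case False then show ?thesis by (auto simp: T_def strict_mono_def)
  qed
  have 2: "0 < T i \<omega>" for i \<omega>
    using arrival_time_pos[of "\<lambda>t. N t \<omega>" i] good[of \<omega>] by (auto simp: T_def)
  have 3: "finite {i. T i \<omega> \<le> t}" for \<omega> t
  proof (cases "\<omega> \<in> space M - Z")
    case True then show ?thesis by (simp add: iff)
  next
    case False
    then have "{i. T i \<omega> \<le> t} = {i. real i + 1 \<le> t}" by (simp only: T_def if_False)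
    also have "\<dots> \<subseteq> {..nat \<lfloor>t\<rfloor>}"
    proof
      fix i assume "i \<in> {i. real i + 1 \<le> t}"
      then show "i \<in> {..nat \<lfloor>t\<rfloor>}" by simp linarith
    qed
    finally have "{i. T i \<omega> \<le> t} \<subseteq> {..nat \<lfloor>t\<rfloor>}" .
    then show ?thesis by (rule finite_subset) simp
  qed
  have 5: "AE \<omega> in M. (\<forall>t i. T i \<omega> \<le> t \<longleftrightarrow> i < N t \<omega>) \<and> (\<forall>i. T i \<omega> = arrival_time (\<lambda>t. N t \<omega>) i)"
    using AEZ by eventually_elim (auto simp: iff, simp add: T_def)
  have meas: "{\<omega>\<in>space M. T i \<omega> \<le> u} \<in> events" for i u
  proof -
    have "{\<omega>\<in>space M. T i \<omega> \<le> u} = ({\<omega>\<in>space M. i < N u \<omega>} - Z) \<union> (if real i + 1 \<le> u then Z else {})"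
    proof (rule set_eqI)
      fix \<omega>
      consider "\<omega> \<in> space M - Z" | "\<omega> \<in> Z" | "\<omega> \<notin> space M \<union> Z" by blast
      then show "\<omega> \<in> {\<omega>\<in>space M. T i \<omega> \<le> u} \<longleftrightarrow>
          \<omega> \<in> ({\<omega>\<in>space M. i < N u \<omega>} - Z) \<union> (if real i + 1 \<le> u then Z else {})"
      proof cases
        case 1 then show ?thesis by (simp add: iff)
      next
        case 2 then show ?thesis using null_setsD2[OF Z] sets.sets_into_space[of Z M] by (auto simp: T_def)
      qed auto
    qed
    also have "\<dots> \<in> events" using null_setsD2[OF Z] by auto
    finally show ?thesis .
  qed
  have gen: "sigma_algebra (space M) (generated_events M N)" "generated_events M N \<subseteq> events"
    unfolding generated_events_def sets_borel_eq_count_space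
    by (auto intro!: sigma_algebra_sigma_sets sets.sigma_sets_subset)
  have 4: "{\<omega>\<in>space M. T i \<omega> \<le> u} \<in> null_completion M (generated_events M N)" for i u
  proof (rule null_completionI[OF meas])
    have "N u -` {i<..} \<inter> space M \<in> generated_events M N"
      unfolding generated_events_def by (rule sigma_sets.Basic) (auto simp: sets_borel_eq_count_space)
    then show "{\<omega>\<in>space M. i < N u \<omega>} \<in> generated_events M N"
      by (rule back_subst[of "\<lambda>A. A \<in> _"]) auto
    show "AE \<omega> in M. \<omega> \<in> {\<omega>\<in>space M. T i \<omega> \<le> u} \<longleftrightarrow> \<omega> \<in> {\<omega>\<in>space M. i < N u \<omega>}"
      using 5 by eventually_elim auto
  qed
  let ?n = "\<lambda>t \<omega>. card {i. T i \<omega> \<le> t}"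
  have n: "AE \<omega> in M. \<forall>t. ?n t \<omega> = N t \<omega>"
    using AEZ by eventually_elim (simp add: iff)
  have [measurable]: "?n t \<in> measurable M (count_space UNIV)" for t
    using meas by (intro measurable_card) auto
  have zero: "?n t \<omega> = 0" if "t \<le> 0" for t \<omega>
  proof -
    have "{i. T i \<omega> \<le> t} = {}" using 2[of _ \<omega>] that by (auto simp: not_le intro: le_less_trans)
    then show ?thesis by simp
  qed
  have path: "AE \<omega> in M. counting_path (\<lambda>t. N t \<omega>)" using N by (auto simp: poisson_process_def)
  have mart: "(LINT \<omega>:A|M. real (?n t \<omega>) - real (?n s \<omega>)) = r * (t - s) * prob A"
    if st: "0 \<le> s" "s < t" and A: "A \<in> sets (points_history M T s)" for s t A
  proof -
    have "sets (points_history M T s) \<subseteq> events"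
      unfolding sets_points_history using meas by (intro sets.sigma_sets_subset) auto
    then have [measurable]: "A \<in> events" using A by auto
    have "(LINT \<omega>:A|M. real (?n t \<omega>) - real (?n s \<omega>)) = (LINT \<omega>:A|M. real (N t \<omega> - N s \<omega>))"
    proof (rule set_lebesgue_integral_cong_AE)
      show "AE \<omega>\<in>A in M. real (?n t \<omega>) - real (?n s \<omega>) = real (N t \<omega> - N s \<omega>)"
        using n path
      proof eventually_elim
        case (elim \<omega>)
        then show ?case using counting_path_mono[OF elim(2), of s t] st by simp
      qed
    qed measurable
    also have "\<dots> = r * (t - s) * prob A"
      by (rule poisson_process_history[OF N r meas _ st A]) (use 5 in \<open>auto elim: eventually_mono\<close>)
    finally show ?thesis .
  qed
  have 6: "integrable M (\<lambda>\<omega>. real (?n t \<omega>))" for t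
  proof (cases "0 < t")
    case True
    have distr: "distr M (count_space UNIV) (\<lambda>\<omega>. N t \<omega> - N 0 \<omega>) = measure_pmf (poisson_pmf (r * t))"
      using N True by (auto simp: poisson_process_def)
    have "0 < r * t" using r True by simp
    from integrable_poisson[OF this] have "integrable M (\<lambda>\<omega>. real (N t \<omega> - N 0 \<omega>))"
      unfolding distr[symmetric] by (subst (asm) integrable_distr_eq) auto
    moreover have "AE \<omega> in M. real (N t \<omega> - N 0 \<omega>) = real (?n t \<omega>)"
      using n path
    proof eventually_elim
      case (elim \<omega>) then show ?case using counting_path_zero[OF elim(2), of 0] by simp
    qed
    ultimately show ?thesis by (subst (asm) integrable_cong_AE) auto
  qed (simp add: zero)
  have 7: "(LINT \<omega>:A|M. real (?n t \<omega>) - real (?n s \<omega>)) = r * (max 0 t - max 0 s) * prob A"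
    if st: "s \<le> t" and A: "A \<in> sets (points_history M T s)" for s t A
  proof -
    \<comment> \<open>No point lies at a time \<open>\<le> 0\<close>, so a negative \<open>s\<close>
      can be moved to \<open>0\<close>, where the history is at least as large; only the case
      \<open>0 \<le> s < t\<close> has content.\<close>
    consider "t \<le> 0" | "0 < t" "s < 0" | "0 \<le> s" "s = t" | "0 \<le> s" "s < t" using st by linarith
    then show ?thesis
    proof cases
      case 1 then show ?thesis using st by (simp add: zero)
    next
      case 2
      have "sets (points_history M T s) \<subseteq> sets (points_history M T 0)"
        using 2 by (intro points_history_mono) simp
      then show ?thesis using mart[of 0 t A] A 2 by (auto simp: zero)
    next
      case 3 then show ?thesis by simp
    next
      case 4 then show ?thesis using mart[OF 4 A] by simp
    qed
  qed
  have 8: "T i \<in> borel_measurable M" for i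
    by (intro borel_measurableI_le meas)
  have "poisson_points M r T"
    unfolding poisson_points_def using 1 2 3 6 7 8 by simp
  then show ?thesis using 4 5 by blast
qed

end

section \<open>Intensities and point configurations\<close>

definition common_filtration :: "'a measure \<Rightarrow> ('k \<Rightarrow> real \<Rightarrow> 'a set set) \<Rightarrow> real \<Rightarrow> 'a measure" where
  "common_filtration M R s = sigma (space M) (\<Inter>k. R k s)"

lemma space_common_filtration [simp]: "space (common_filtration M R s) = space M"
  by (simp add: common_filtration_def space_measure_of_conv)

lemma sets_common_filtration:
  assumes "\<And>k. sigma_algebra (space M) (R k s)"
  shows "sets (common_filtration M R s) = (\<Inter>k. R k s)"
proof -
  have "sigma_algebra (space M) (\<Inter>k. R k s)"
    unfolding sigma_algebra_iff2
  proof (intro conjI ballI allI impI)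
    show "(\<Inter>k. R k s) \<subseteq> Pow (space M)"
      using assms unfolding sigma_algebra_iff2 by blast
    show "{} \<in> (\<Inter>k. R k s)"
      using assms unfolding sigma_algebra_iff2 by blast
    show "space M - A \<in> (\<Inter>k. R k s)" if "A \<in> (\<Inter>k. R k s)" for A
      using assms that unfolding sigma_algebra_iff2 by blast
    show "\<Union>(range A) \<in> (\<Inter>k. R k s)" if "range A \<subseteq> (\<Inter>k. R k s)" for A :: "nat \<Rightarrow> _"
    proof
      fix k
      have "range A \<subseteq> R k s" using that by blast
      then show "\<Union>(range A) \<in> R k s" using assms[of k] unfolding sigma_algebra_iff2 by blast
    qed
  qed
  then show ?thesis unfolding common_filtration_def by (rule sigma_algebra.sets_measure_of_eq)
qed

lemma filtration_on_common_filtration: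
  fixes R :: "'k \<Rightarrow> real \<Rightarrow> 'a set set"
  assumes "\<And>k s. sigma_algebra (space M) (R k s)" "\<And>k s. R k s \<subseteq> sets M"
    and "\<And>k s t. s \<le> t \<Longrightarrow> R k s \<subseteq> R k t"
  shows "filtration_on M (common_filtration M R)"
proof -
  note sets = sets_common_filtration[of M R, OF assms(1)]
  have "sets (common_filtration M R s) \<subseteq> sets (common_filtration M R t)" if "s \<le> t" for s t
    unfolding sets using assms(3)[OF that] by blast
  moreover have "sets (common_filtration M R t) \<subseteq> sets M" for t
    unfolding sets using assms(2)[of undefined t] by blast
  ultimately show ?thesis
    unfolding filtration_on_def filtration_def subalgebra_def by auto
qed

lemma filtration_onD:
  assumes "filtration_on M F"
  shows "space (F t) = space M" "s \<le> t \<Longrightarrow> sets (F s) \<subseteq> sets (F t)" "sets (F t) \<subseteq> sets M"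
  using assms unfolding filtration_on_def filtration_def subalgebra_def by auto

lemma measurable_filtration_mono:
  assumes F: "filtration_on M F" and "s \<le> t" and f: "f \<in> measurable (F s) N"
  shows "f \<in> measurable (F t) N"
proof -
  have "subalgebra (F t) (F s)"
    using filtration_onD[OF F] \<open>s \<le> t\<close> by (auto simp: subalgebra_def)
  then show ?thesis using f measurable_from_subalg by blast
qed

section \<open>Martingales, predictability and intensities\<close>

lemma (in prob_space) martingaleI:
  assumes F: "filtration_on M F" and X: "adapted F X"
    and int: "\<And>t. 0 \<le> t \<Longrightarrow> integrable M (X t)"
    and eq: "\<And>s t A. 0 \<le> s \<Longrightarrow> s \<le> t \<Longrightarrow> A \<in> sets (F s) \<Longrightarrow> (LINT \<omega>:A|M. X t \<omega>) = (LINT \<omega>:A|M. X s \<omega>)"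
  shows "martingale M F X"
  unfolding martingale_def
proof (intro conjI allI impI X int)
  fix s t :: real assume st: "0 \<le> s \<and> s \<le> t"
  interpret sigma_finite_subalgebra M "F s"
    by (intro finite_measure_subalgebra_is_sigma_finite finite_measure_subalgebra.intro
        finite_measure_subalgebra_axioms.intro finite_measure_axioms)
      (use F in \<open>auto simp: filtration_on_def\<close>)
  show "AE \<omega> in M. real_cond_exp M (F s) (X t) \<omega> = X s \<omega>"
    using st X by (intro real_cond_exp_charact eq int) (auto simp: adapted_def)
qed auto

text \<open>The deterministic times \<open>n\<close> localise. At a time beyond \<open>n\<close> the
  stopped value \<open>X n\<close> is already measurable, so conditioning leaves it
  unchanged.\<close>

lemma (in prob_space) martingale_imp_local_martingale:
  assumes F: "filtration_on M F" and X: "martingale M F X" and zero: "\<And>\<omega>. X 0 \<omega> = 0"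
  shows "local_martingale M F X"
  unfolding local_martingale_def
proof (intro conjI exI[of _ "\<lambda>n _. real n"] allI)
  show adX: "adapted F X" using X by (simp add: martingale_def)
  show "AE \<omega> in M. incseq (\<lambda>n. real n) \<and> filterlim (\<lambda>n. real n) at_top sequentially"
    by (auto simp: filterlim_real_sequentially incseq_def)
  fix n
  show "stopping_time F (\<lambda>_. real n)" by (rule stopping_time_const)
  show "martingale M F (\<lambda>t \<omega>. X (min t (real n)) \<omega> - X 0 \<omega>)"
    unfolding martingale_def
  proof (intro conjI allI impI)
    show "adapted F (\<lambda>t \<omega>. X (min t (real n)) \<omega> - X 0 \<omega>)"
      unfolding adapted_def zero
    proof (intro allI impI)
      fix t :: real assume "0 \<le> t"
      have "X (min t (real n)) \<in> borel_measurable (F t)"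
        by (rule measurable_filtration_mono[OF F, of "min t (real n)"]) (use adX \<open>0 \<le> t\<close> in \<open>auto simp: adapted_def\<close>)
      then show "(\<lambda>\<omega>. X (min t (real n)) \<omega> - 0) \<in> borel_measurable (F t)" by simp
    qed
    show "integrable M (\<lambda>\<omega>. X (min t (real n)) \<omega> - X 0 \<omega>)" if "0 \<le> t" for t
      using X that by (auto simp: martingale_def zero)
    fix s t :: real assume st: "0 \<le> s \<and> s \<le> t"
    have sub: "subalgebra M (F s)" using F by (simp add: filtration_on_def)
    show "AE \<omega> in M. real_cond_exp M (F s) (\<lambda>\<omega>. X (min t (real n)) \<omega> - X 0 \<omega>) \<omega> = X (min s (real n)) \<omega> - X 0 \<omega>"
    proof (cases "s \<le> real n")
      case True
      then show ?thesis using X st by (auto simp: martingale_def zero min_def)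
    next
      case False
      have "X (real n) \<in> borel_measurable (F s)"
        by (rule measurable_filtration_mono[OF F, of "real n" s]) (use adX False in \<open>auto simp: adapted_def\<close>)
      have "integrable M (X (real n))" using X by (simp add: martingale_def)
      interpret sigma_finite_subalgebra M "F s"
        by (intro finite_measure_subalgebra_is_sigma_finite finite_measure_subalgebra.intro
            finite_measure_subalgebra_axioms.intro finite_measure_axioms sub)
      show ?thesis
        using real_cond_exp_F_meas[OF \<open>integrable M (X (real n))\<close> \<open>X (real n) \<in> borel_measurable (F s)\<close>]
          False st by (simp add: zero min_def)
    qed
  qed
qed auto

lemma compensator_zero [simp]: "compensator rate 0 \<omega> = 0"
proof -
  have "AE s in lborel. indicator {0..0} s *\<^sub>R rate s \<omega> = 0"
    using AE_lborel_singleton[of "0::real"] by eventually_elim (auto simp: indicator_def)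
  then show ?thesis unfolding compensator_def set_lebesgue_integral_def
    by (rule integral_eq_zero_AE)
qed

text \<open>On every \<open>[0,T]\<close> the compensator is an indefinite gauge integral, hence
  continuous; near \<open>t\<close> the half-line coincides with \<open>[0,t+1]\<close>.\<close>

lemma continuous_on_compensator:
  assumes "\<And>t. 0 \<le> t \<Longrightarrow> set_integrable lborel {0..t} (\<lambda>s. rate s \<omega>)"
  shows "continuous_on {0..} (\<lambda>t. compensator rate t \<omega>)"
proof -
  have eq: "compensator rate t \<omega> = integral {0..t} (\<lambda>s. rate s \<omega>)" if "0 \<le> t" for t
    unfolding compensator_def using assms[OF that] by (rule set_borel_integral_eq_integral(2))
  have contT: "continuous_on {0..T} (\<lambda>t. compensator rate t \<omega>)" if "0 \<le> T" for T
    using indefinite_integral_continuous_1[OF set_borel_integral_eq_integral(1)[OF assms[OF that]]]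
    by (rule continuous_on_eq) (auto simp: eq)
  show ?thesis
    unfolding continuous_on_eq_continuous_within
  proof
    fix t :: real assume t: "t \<in> {0..}"
    have "continuous (at t within {0..t + 1}) (\<lambda>t. compensator rate t \<omega>)"
      using contT[of "t + 1"] t by (auto simp: continuous_on_eq_continuous_within)
    moreover have "at t within {0..t + 1} = at t within {0..}"
      by (rule at_within_nhd[of t "{..<t + 1}"]) auto
    ultimately show "continuous (at t within {0..}) (\<lambda>t. compensator rate t \<omega>)" by simp
  qed
qed

lemma space_predictable_algebra: "space (predictable_algebra \<Omega> F) = {0..} \<times> \<Omega>"
  by (simp add: predictable_algebra_def space_measure_of_conv)

text \<open>Continuity lets the process be approximated from the left by step processes. On a cell
  \<open>(k/(n+1), (k+1)/(n+1)]\<close> the value is taken at the left end, where it is already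
  known, so each step process is built from predictable rectangles.\<close>

lemma predictable_continuous:
  assumes F: "filtration_on M F" and X: "adapted F X"
    and cont: "\<And>\<omega>. \<omega> \<in> space M \<Longrightarrow> continuous_on {0..} (\<lambda>t. X t \<omega>)"
  shows "predictable M F X"
proof -
  let ?P = "predictable_algebra (space M) F"
  have subM: "sets (F s) \<subseteq> Pow (space M)" for s
    using filtration_onD(3)[OF F, of s] sets.space_closed[of M] by blast
  then have setsP: "sets ?P = sigma_sets ({0..} \<times> space M)
       ({{0} \<times> A | A. A \<in> sets (F 0)} \<union>
        {{s<..t} \<times> A | s t A. 0 \<le> s \<and> s < t \<and> A \<in> sets (F s)})"
    unfolding predictable_algebra_def
  proof (intro sets_measure_of subsetI)
    fix x assume "x \<in> {{0} \<times> A | A. A \<in> sets (F 0)} \<union>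
      {{s<..t} \<times> A | s t A. 0 \<le> s \<and> s < t \<and> A \<in> sets (F s)}"
    then show "x \<in> Pow ({0..} \<times> space M)"
    proof
      assume "x \<in> {{0} \<times> A | A. A \<in> sets (F 0)}"
      then show ?thesis using subM[of 0] by auto
    next
      assume "x \<in> {{s<..t} \<times> A | s t A. 0 \<le> s \<and> s < t \<and> A \<in> sets (F s)}"
      then obtain s t A where "x = {s<..t} \<times> A" "0 \<le> s" "A \<in> sets (F s)" by auto
      then show ?thesis using subM[of s] by auto
    qed
  qed
  have rect0: "{0} \<times> A \<in> sets ?P" if "A \<in> sets (F 0)" for A
    unfolding setsP using that by (intro sigma_sets.Basic) auto
  have rect: "{s<..t} \<times> A \<in> sets ?P" if "0 \<le> s" "s < t" "A \<in> sets (F s)" for s t A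
    unfolding setsP using that by (intro sigma_sets.Basic) auto
  \<comment> \<open>Left end of the cell containing \<open>t\<close>. The cells are open on the left
    like the predictable rectangles, whence the ceiling minus one rather than the floor; time
    \<open>0\<close> lies in no cell and is treated apart.\<close>
  define q where "q n t = (if t = 0 then 0 else (real_of_int \<lceil>t * real (Suc n)\<rceil> - 1) / real (Suc n))" for n t
  have q_eq: "q n t = real k / real (Suc n) \<longleftrightarrow> t \<in> {real k / real (Suc n)<..real (Suc k) / real (Suc n)}"
    if "0 < t" for n t k
  proof -
    have "q n t = real k / real (Suc n) \<longleftrightarrow> real_of_int \<lceil>t * real (Suc n)\<rceil> = real (Suc k)"
      using that by (simp add: q_def field_simps)
    also have "\<dots> \<longleftrightarrow> \<lceil>t * real (Suc n)\<rceil> = int (Suc k)"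
      by (metis of_int_eq_iff of_int_of_nat_eq)
    also have "\<dots> \<longleftrightarrow> real k < t * real (Suc n) \<and> t * real (Suc n) \<le> real (Suc k)"
      by (subst ceiling_eq_iff) simp
    also have "\<dots> \<longleftrightarrow> t \<in> {real k / real (Suc n)<..real (Suc k) / real (Suc n)}"
      by (simp add: divide_less_eq le_divide_eq del: of_nat_Suc)
    finally show ?thesis .
  qed
  have q_ex: "\<exists>k. t \<in> {real k / real (Suc n)<..real (Suc k) / real (Suc n)}" if "0 < t" for n t
  proof -
    have "1 \<le> \<lceil>t * real (Suc n)\<rceil>" using that by (simp add: one_le_ceiling)
    then have "q n t = real (nat (\<lceil>t * real (Suc n)\<rceil> - 1)) / real (Suc n)"
      using that by (simp add: q_def)
    then show ?thesis using q_eq[OF that] by blast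
  qed
  have q_bounds: "0 \<le> q n t" "q n t \<le> t" "t - 1 / real (Suc n) \<le> q n t" if "0 \<le> t" for n t
  proof -
    have "0 \<le> q n t \<and> q n t \<le> t \<and> t - 1 / real (Suc n) \<le> q n t"
    proof (cases "t = 0")
      case False
      then have "0 < t" using that by simp
      then obtain k where k: "t \<in> {real k / real (Suc n)<..real (Suc k) / real (Suc n)}"
        using q_ex[of t n] by blast
      then have "q n t = real k / real (Suc n)" using q_eq[of t n k] False that by auto
      then show ?thesis using k by (simp add: add_divide_distrib)
    qed (simp add: q_def)
    then show "0 \<le> q n t" "q n t \<le> t" "t - 1 / real (Suc n) \<le> q n t" by auto
  qed
  have "(\<lambda>(t, \<omega>). X (q n t) \<omega>) \<in> borel_measurable ?P" for n
  proof (rule measurableI)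
    fix B :: "real set" assume B: "B \<in> sets borel"
    have pre: "X s -` B \<inter> space M \<in> sets (F s)" if "0 \<le> s" for s
      using measurable_sets[of "X s" "F s" borel B] X B that filtration_onD(1)[OF F] by (auto simp: adapted_def)
    have "(\<lambda>(t, \<omega>). X (q n t) \<omega>) -` B \<inter> space ?P = {0} \<times> (X 0 -` B \<inter> space M) \<union>
      (\<Union>k. {real k / real (Suc n)<..real (Suc k) / real (Suc n)} \<times> (X (real k / real (Suc n)) -` B \<inter> space M))"
      (is "?L = ?R")
    proof (rule set_eqI)
      fix z :: "real \<times> 'a"
      obtain t \<omega> where z: "z = (t, \<omega>)" by (cases z)
      consider "t < 0" | "t = 0" | "0 < t" by linarith
      then show "z \<in> ?L \<longleftrightarrow> z \<in> ?R"
      proof cases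
        case 1
        moreover have "\<not> real k / real (Suc n) < t" for k
          using 1 by (meson divide_nonneg_nonneg not_less of_nat_0_le_iff order.strict_trans2 less_imp_le)
        ultimately show ?thesis by (auto simp: z space_predictable_algebra simp del: of_nat_Suc)
      next
        case 2
        have "\<not> real k / real (Suc n) < 0" for k by (simp add: not_less)
        with 2 show ?thesis by (auto simp: z space_predictable_algebra q_def simp del: of_nat_Suc)
      next
        case 3
        obtain k where k: "t \<in> {real k / real (Suc n)<..real (Suc k) / real (Suc n)}"
          using q_ex[OF 3] by blast
        have uniq: "j = k" if "t \<in> {real j / real (Suc n)<..real (Suc j) / real (Suc n)}" for j
          using k[folded q_eq[OF 3]] that[folded q_eq[OF 3]] by simp
        have "z \<in> ?R \<longleftrightarrow> (\<exists>j. t \<in> {real j / real (Suc n)<..real (Suc j) / real (Suc n)} \<and>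
            X (real j / real (Suc n)) \<omega> \<in> B \<and> \<omega> \<in> space M)"
          using 3 by (simp add: z del: of_nat_Suc greaterThanAtMost_iff)
        also have "\<dots> \<longleftrightarrow> X (real k / real (Suc n)) \<omega> \<in> B \<and> \<omega> \<in> space M"
          using k uniq by blast
        finally have "z \<in> ?R \<longleftrightarrow> X (real k / real (Suc n)) \<omega> \<in> B \<and> \<omega> \<in> space M" .
        then show ?thesis
          using 3 k[folded q_eq[OF 3]] by (auto simp: z space_predictable_algebra)
      qed
    qed
    also have "\<dots> \<in> sets ?P"
    proof (intro sets.Un rect0 pre sets.countable_UN image_subsetI)
      fix k
      show "{real k / real (Suc n)<..real (Suc k) / real (Suc n)} \<times> (X (real k / real (Suc n)) -` B \<inter> space M) \<in> sets ?P"
        by (intro rect pre) (simp_all add: divide_strict_right_mono)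
    qed simp
    finally show "(\<lambda>(t, \<omega>). X (q n t) \<omega>) -` B \<inter> space ?P \<in> sets ?P" .
  qed auto
  moreover have "(\<lambda>n. case z of (t, \<omega>) \<Rightarrow> X (q n t) \<omega>) \<longlonglongrightarrow> (case z of (t, \<omega>) \<Rightarrow> X t \<omega>)"
    if zP: "z \<in> space ?P" for z
  proof -
    obtain t \<omega> where z: "z = (t, \<omega>)" "0 \<le> t" "\<omega> \<in> space M"
      using zP by (cases z) (auto simp: space_predictable_algebra)
    have "(\<lambda>n. q n t) \<longlonglongrightarrow> t"
    proof (rule tendsto_sandwich)
      show "(\<lambda>n. t - 1 / real (Suc n)) \<longlonglongrightarrow> t"
        using tendsto_diff[OF tendsto_const LIMSEQ_inverse_real_of_nat, of t] by (simp add: inverse_eq_divide)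
    qed (use q_bounds[OF z(2)] in \<open>auto simp del: of_nat_Suc\<close>)
    then have "(\<lambda>n. X (q n t) \<omega>) \<longlonglongrightarrow> X t \<omega>"
      using continuous_on_tendsto_compose[OF cont[OF z(3)], of "\<lambda>n. q n t" t] z q_bounds[OF z(2)]
      by (auto simp del: of_nat_Suc)
    then show ?thesis by (simp add: z)
  qed
  ultimately show ?thesis unfolding predictable_def by (rule borel_measurable_LIMSEQ_real[rotated])
qed

lemma borel_measurable_nat_iff:
  "f \<in> borel_measurable M \<longleftrightarrow> f \<in> measurable M (count_space UNIV)" for f :: "'a \<Rightarrow> nat"
  by (simp add: measurable_cong_sets[OF refl sets_borel_eq_count_space])

lemma (in prob_space) has_intensityI:
  assumes F: "filtration_on M F"
    and int: "\<And>\<omega> t. 0 \<le> t \<Longrightarrow> set_integrable lborel {0..t} (\<lambda>s. rate s \<omega>)"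
    and A: "adapted F (compensator rate)" and N: "adapted F N" and N0: "\<And>\<omega>. N 0 \<omega> = 0"
    and intX: "\<And>t. 0 \<le> t \<Longrightarrow> integrable M (\<lambda>\<omega>. real (N t \<omega>) - compensator rate t \<omega>)"
    and eq: "\<And>s t A. 0 \<le> s \<Longrightarrow> s \<le> t \<Longrightarrow> A \<in> sets (F s) \<Longrightarrow>
      (LINT \<omega>:A|M. real (N t \<omega>) - compensator rate t \<omega>) = (LINT \<omega>:A|M. real (N s \<omega>) - compensator rate s \<omega>)"
  shows "has_intensity M F N rate"
  unfolding has_intensity_def
proof (intro conjI)
  show "AE \<omega> in M. \<forall>t\<ge>0. set_integrable lborel {0..t} (\<lambda>s. rate s \<omega>)" using int by simp
  show "predictable M F (compensator rate)"
    by (intro predictable_continuous F A continuous_on_compensator int)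
  have "adapted F (\<lambda>t \<omega>. real (N t \<omega>) - compensator rate t \<omega>)"
    using A N unfolding adapted_def borel_measurable_nat_iff
    by (auto intro!: borel_measurable_diff measurable_compose[of "N _" _ "count_space UNIV" real])
  then show "local_martingale M F (\<lambda>t \<omega>. real (N t \<omega>) - compensator rate t \<omega>)"
    by (intro martingale_imp_local_martingale F martingaleI intX eq) (simp_all add: N0)
qed

text \<open>At each sample point only finitely many terms are nonzero, but their number may vary
  without bound; summability of the mean absolute values justifies integrating term by term.\<close>

lemma
  fixes f :: "nat \<Rightarrow> 'a \<Rightarrow> real"
  assumes int: "\<And>i. integrable M (f i)" and fin: "\<And>\<omega>. finite {i. f i \<omega> \<noteq> 0}"
    and bnd: "summable (\<lambda>i. \<integral>\<omega>. \<bar>f i \<omega>\<bar> \<partial>M)"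
  shows integrable_suminf_finite: "integrable M (\<lambda>\<omega>. \<Sum>i. f i \<omega>)"
    and set_integral_suminf_finite: "A \<in> sets M \<Longrightarrow> (LINT \<omega>:A|M. (\<Sum>i. f i \<omega>)) = (\<Sum>i. LINT \<omega>:A|M. f i \<omega>)"
proof -
  have sm: "summable (\<lambda>i. norm (g * f i \<omega>))" for g \<omega>
    using fin[of \<omega>] by (intro summable_finite[of "{i. f i \<omega> \<noteq> 0}"]) auto
  show "integrable M (\<lambda>\<omega>. \<Sum>i. f i \<omega>)"
    using sm[of 1] by (intro integrable_suminf int AE_I2) (use bnd in auto)
  assume A: "A \<in> sets M"
  have sm': "summable (\<lambda>i. f i \<omega>)" for \<omega>
    using fin[of \<omega>] by (intro summable_finite[of "{i. f i \<omega> \<noteq> 0}"]) auto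
  have intA: "integrable M (\<lambda>\<omega>. indicator A \<omega> * f i \<omega>)" for i
    using integrable_mult_indicator[OF A int[of i]] by simp
  have "(LINT \<omega>:A|M. (\<Sum>i. f i \<omega>)) = (\<integral>\<omega>. (\<Sum>i. indicator A \<omega> * f i \<omega>) \<partial>M)"
    unfolding set_lebesgue_integral_def by (simp add: suminf_mult[OF sm'])
  also have "\<dots> = (\<Sum>i. \<integral>\<omega>. indicator A \<omega> * f i \<omega> \<partial>M)"
  proof (rule integral_suminf[OF intA])
    show "AE \<omega> in M. summable (\<lambda>i. norm (indicator A \<omega> * f i \<omega>))" using sm by simp
    show "summable (\<lambda>i. \<integral>\<omega>. norm (indicator A \<omega> * f i \<omega>) \<partial>M)"
    proof (rule summable_comparison_test'[OF bnd])
      fix i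
      have "(\<integral>\<omega>. norm (indicator A \<omega> * f i \<omega>) \<partial>M) \<le> (\<integral>\<omega>. \<bar>f i \<omega>\<bar> \<partial>M)"
        using intA int by (intro integral_mono) (auto simp: indicator_def)
      then show "norm (\<integral>\<omega>. norm (indicator A \<omega> * f i \<omega>) \<partial>M) \<le> (\<integral>\<omega>. \<bar>f i \<omega>\<bar> \<partial>M)"
        by simp
    qed
  qed
  finally show "(LINT \<omega>:A|M. (\<Sum>i. f i \<omega>)) = (\<Sum>i. LINT \<omega>:A|M. f i \<omega>)"
    by (simp add: set_lebesgue_integral_def)
qed


section \<open>Point configurations and their Stieltjes measures\<close>

lemma counting_path_points:
  fixes x :: "'i \<Rightarrow> real"
  assumes "inj_on x I" "\<And>i. i \<in> I \<Longrightarrow> 0 < x i" "\<And>t. finite {i\<in>I. x i \<le> t}"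
  shows "counting_path (\<lambda>t. card {i\<in>I. x i \<le> t})"
  unfolding counting_path_def
proof (intro exI[of _ "x ` I"] conjI allI)
  fix t
  have "x ` I \<inter> {..t} = x ` {i\<in>I. x i \<le> t}" by auto
  \<comment> \<open>Indices and points are counted alike because \<open>x\<close> is injective, so
    the jumps have size one.\<close>
  moreover have "inj_on x {i\<in>I. x i \<le> t}" using assms(1) by (rule inj_on_subset) auto
  ultimately show "finite (x ` I \<inter> {..t})" "card {i\<in>I. x i \<le> t} = card (x ` I \<inter> {..t})"
    using assms(3)[of t] by (simp_all add: card_image)
qed (use assms(2) in auto)

text \<open>Only the finitely many indices with \<open>x i \<le> t + 1\<close> can matter near
  \<open>t\<close>, so finitely many eventual conditions combine. The filter is general enough to
  serve two-sided continuity and continuity from the right.\<close>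

lemma eventually_points_eq:
  fixes x :: "'i \<Rightarrow> real"
  assumes fin: "finite {i\<in>I. x i \<le> t + 1}" and F: "F \<le> nhds t"
    and ev: "\<And>i. i \<in> I \<Longrightarrow> eventually (\<lambda>u. x i \<le> u \<longleftrightarrow> x i \<le> t) F"
  shows "eventually (\<lambda>u. {i\<in>I. x i \<le> u} = {i\<in>I. x i \<le> t}) F"
proof -
  have "eventually (\<lambda>u. \<forall>i\<in>{i\<in>I. x i \<le> t + 1}. x i \<le> u \<longleftrightarrow> x i \<le> t) F"
    using ev by (intro eventually_ball_finite fin) auto
  moreover have "eventually (\<lambda>u. u < t + 1) F"
    by (rule filter_leD[OF F]) (rule eventually_nhds_in_open[of "{..<t+1}" t, simplified])
  ultimately show ?thesis
    by eventually_elim force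
qed

lemma isCont_points:
  fixes x :: "'i \<Rightarrow> real"
  assumes "\<And>t. finite {i\<in>I. x i \<le> t}" "t \<notin> x ` I"
  shows "isCont (\<lambda>u. card {i\<in>I. x i \<le> u}) t"
proof -
  have "eventually (\<lambda>u. {i\<in>I. x i \<le> u} = {i\<in>I. x i \<le> t}) (at t)"
  proof (rule eventually_points_eq)
    fix i assume "i \<in> I"
    then consider "x i < t" | "t < x i" using assms(2) by force
    then show "eventually (\<lambda>u. x i \<le> u \<longleftrightarrow> x i \<le> t) (at t)"
    proof cases
      case 1
      then have "eventually (\<lambda>u. x i < u) (at t)" by (rule order_tendstoD(1)[OF tendsto_ident_at])
      then show ?thesis by eventually_elim (use 1 in auto)
    next
      case 2
      then have "eventually (\<lambda>u. u < x i) (at t)" by (rule order_tendstoD(2)[OF tendsto_ident_at])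
      then show ?thesis by eventually_elim (use 2 in auto)
    qed
  qed (use assms(1) in \<open>auto simp: at_within_def\<close>)
  then have "eventually (\<lambda>u. card {i\<in>I. x i \<le> u} = card {i\<in>I. x i \<le> t}) (at t)"
    by eventually_elim (rule arg_cong[where f=card])
  then show ?thesis unfolding isCont_def by (rule tendsto_eventually)
qed

text \<open>Both measures give \<open>(a,b]\<close> the number of indices with \<open>x i\<close> in
  it, and these intervals are an intersection-stable generator on which the measures are finite. A
  Stieltjes integral against a path of points thus becomes a sum over the points.\<close>

lemma interval_measure_points:
  fixes x :: "'i \<Rightarrow> real"
  assumes fin: "\<And>t. finite {i\<in>I. x i \<le> t}"
  shows "interval_measure (\<lambda>u. real (card {i\<in>I. x i \<le> u})) = distr (count_space I) borel x"
    (is "interval_measure ?F = ?D")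
proof (rule measure_eqI_generator_eq[where E="range (\<lambda>(a, b). {a<..b})" and \<Omega>=UNIV
      and A="\<lambda>n. {- real n<..real n}"])
  have mono: "?F a \<le> ?F b" if "a \<le> b" for a b
    using that fin by (auto intro!: card_mono)
  have cont: "continuous (at_right a) ?F" for a
  proof -
    have "eventually (\<lambda>u. {i\<in>I. x i \<le> u} = {i\<in>I. x i \<le> a}) (at_right a)"
    proof (rule eventually_points_eq[OF fin])
      fix i assume "i \<in> I"
      show "eventually (\<lambda>u. x i \<le> u \<longleftrightarrow> x i \<le> a) (at_right a)"
      proof (cases "x i \<le> a")
        case True
        have "eventually (\<lambda>u. a < u) (at_right a)" by (rule eventually_at_right_less)
        then show ?thesis by eventually_elim (use True in auto)
      next
        case False
        then have "eventually (\<lambda>u. u < x i) (at_right a)"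
          by (intro order_tendstoD(2)[OF tendsto_ident_at]) auto
        then show ?thesis by eventually_elim (use False in auto)
      qed
    qed (auto simp: at_within_def)
    then have "eventually (\<lambda>u. ?F u = ?F a) (at_right a)"
      by eventually_elim simp
    then show ?thesis unfolding continuous_within by (rule tendsto_eventually)
  qed
  have Ioc: "emeasure (interval_measure ?F) {a<..b} = emeasure ?D {a<..b}" if "a \<le> b" for a b
  proof -
    have *: "{i\<in>I. x i \<le> b} = {i\<in>I. x i \<le> a} \<union> {i\<in>I. a < x i \<and> x i \<le> b}" using that by auto
    have fab: "finite {i\<in>I. a < x i \<and> x i \<le> b}" by (rule finite_subset[OF _ fin[of b]]) auto
    have "?F b = ?F a + real (card {i\<in>I. a < x i \<and> x i \<le> b})"
      unfolding * using fab fin by (subst card_Un_disjoint) auto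
    then have "emeasure (interval_measure ?F) {a<..b} = ennreal (real (card {i\<in>I. a < x i \<and> x i \<le> b}))"
      using emeasure_interval_measure_Ioc[OF that mono cont] by simp
    also have "\<dots> = emeasure (count_space I) (x -` {a<..b} \<inter> I)"
    proof -
      have "x -` {a<..b} \<inter> I = {i\<in>I. a < x i \<and> x i \<le> b}" by auto
      then show ?thesis using fab by (simp add: emeasure_count_space ennreal_of_nat_eq_real_of_nat)
    qed
    also have "\<dots> = emeasure ?D {a<..b}" by (subst emeasure_distr) auto
    finally show ?thesis .
  qed
  show "emeasure (interval_measure ?F) X = emeasure ?D X" if "X \<in> range (\<lambda>(a, b). {a<..b})" for X
  proof -
    from that obtain a b where X: "X = {a<..b}" by auto
    show ?thesis unfolding X using Ioc[of a b] by (cases "a \<le> b") auto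
  qed
  show "emeasure (interval_measure ?F) {- real n<..real n} \<noteq> \<infinity>" for n
    using emeasure_interval_measure_Ioc[OF _ mono cont, of "- real n" "real n"] by simp
  show "Int_stable (range (\<lambda>(a, b). {a<..b::real}))"
    by (auto simp: Int_stable_def)
  show "(\<Union>n. {- real n<..real n}) = UNIV"
  proof (rule UNIV_eq_I[THEN sym])
    fix y :: real
    obtain n where "\<bar>y\<bar> < real n" using reals_Archimedean2 by blast
    then show "y \<in> (\<Union>n. {- real n<..real n})" by (auto intro!: exI[of _ n])
  qed
qed (auto simp: borel_sigma_sets_Ioc)

text \<open>The range \<open>[0,t)\<close> excludes a point at \<open>t\<close> itself, whence the
  strict inequality in the sum; positivity of the points absorbs the lower end.\<close>

lemma set_integral_points:
  fixes x :: "'i \<Rightarrow> real" and g :: "real \<Rightarrow> real"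
  assumes fin: "\<And>t. finite {i\<in>I. x i \<le> t}" and pos: "\<And>i. i \<in> I \<Longrightarrow> 0 < x i"
    and [measurable]: "g \<in> borel_measurable borel"
  shows "(LINT s:{0..<t}|interval_measure (\<lambda>u. real (card {i\<in>I. x i \<le> u})). g s) = (\<Sum>i\<in>{i\<in>I. x i < t}. g (x i))"
proof -
  have fint: "finite {i\<in>I. x i < t}" by (rule finite_subset[OF _ fin[of t]]) auto
  have "(LINT s:{0..<t}|interval_measure (\<lambda>u. real (card {i\<in>I. x i \<le> u})). g s)
      = (\<integral>i. indicator {0..<t} (x i) * g (x i) \<partial>count_space I)"
    unfolding interval_measure_points[OF fin] set_lebesgue_integral_def
    by (subst integral_distr) auto
  also have "\<dots> = (\<Sum>i | i \<in> I \<and> indicator {0..<t} (x i) * g (x i) \<noteq> 0. indicator {0..<t} (x i) * g (x i))"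
    by (rule lebesgue_integral_count_space_finite_support)
       (rule finite_subset[OF _ fint], auto simp: indicator_def)
  also have "\<dots> = (\<Sum>i\<in>{i\<in>I. x i < t}. g (x i))"
    using pos by (intro sum.mono_neutral_cong_left fint) (auto simp: indicator_def less_imp_le)
  finally show ?thesis .
qed

section \<open>One source against all the others\<close>

definition rest :: "'a measure \<Rightarrow> ('k \<Rightarrow> 'a set set) \<Rightarrow> 'k \<Rightarrow> 'a measure" where
  "rest M \<S> k = sigma (space M) (\<Union>j\<in>- {k}. \<S> j)"

text \<open>Grouping the independent family into the blocks \<open>- {k}\<close> and
  \<open>{k}\<close> keeps it independent.\<close>

lemma (in prob_space) independent_pair_rest:
  assumes indep: "indep_sets \<S> UNIV" and sa: "\<And>k. sigma_algebra (space M) (\<S> k)"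
  shows "independent_pair M (rest M \<S> k) (sigma (space M) (\<S> k))"
proof -
  have ev: "\<S> j \<subseteq> events" for j using indep by (auto simp: indep_sets_def)
  have ev': "(\<Union>j\<in>- {k}. \<S> j) \<subseteq> events" using ev by blast
  have pow: "(\<Union>j\<in>- {k}. \<S> j) \<subseteq> Pow (space M)" using ev' sets.space_closed[of M] by blast
  have sets: "sets (sigma (space M) (\<S> k)) = \<S> k"
    using sa by (rule sigma_algebra.sets_measure_of_eq)
  have setsr: "sets (rest M \<S> k) = sigma_sets (space M) (\<Union>j\<in>- {k}. \<S> j)"
    unfolding rest_def using pow by (rule sets_measure_of)
  have "indep_sets (\<lambda>b. sigma_sets (space M) (\<Union>j\<in>(if b then - {k} else {k}). \<S> j)) UNIV"
  proof (rule indep_sets_collect_sigma)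
    show "indep_sets \<S> (\<Union>b\<in>UNIV. if b then - {k} else {k})"
      by (rule indep_sets_mono_index[OF _ indep]) auto
    show "Int_stable (\<S> i)" for i
    proof -
      interpret sigma_algebra "space M" "\<S> i" by (rule sa)
      show ?thesis by (auto simp: Int_stable_def)
    qed
    show "disjoint_family_on (\<lambda>b. if b then - {k} else {k}) UNIV"
      by (auto simp: disjoint_family_on_def)
  qed
  then have "indep_set (sigma_sets (space M) (\<Union>j\<in>- {k}. \<S> j)) (sigma_sets (space M) (\<S> k))"
    unfolding indep_set_def by (rule indep_sets_cong[THEN iffD1, rotated -1]) (auto split: bool.split)
  then have "indep_set (sets (rest M \<S> k)) (sets (sigma (space M) (\<S> k)))"
    unfolding setsr sets using sigma_algebra.sigma_sets_eq[OF sa[of k]] by simp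
  moreover have "subalgebra M (rest M \<S> k)"
    unfolding subalgebra_def setsr using ev'
    by (auto simp: rest_def space_measure_of_conv dest: subsetD[OF sets.sigma_sets_subset])
  moreover have "subalgebra M (sigma (space M) (\<S> k))"
    unfolding subalgebra_def sets using ev by (auto simp: space_measure_of_conv)
  ultimately show ?thesis by unfold_locales
qed

lemma sets_rest:
  assumes "\<And>k. sigma_algebra (space M) (\<S> k)" and "A \<in> \<S> j" "j \<noteq> k"
  shows "A \<in> sets (rest M \<S> k)"
proof -
  have pow: "(\<Union>j\<in>- {k}. \<S> j) \<subseteq> Pow (space M)"
    using assms(1) unfolding sigma_algebra_iff2 by blast
  show ?thesis
    unfolding rest_def sets_measure_of[OF pow] using assms(2,3) by (intro sigma_sets.Basic) auto
qed

lemma space_rest [simp]: "space (rest M \<S> k) = space M"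
  by (simp add: rest_def space_measure_of_conv)

lemma measurable_card_countable:
  fixes S :: "'a \<Rightarrow> 'i::countable set"
  assumes S: "\<And>i. {x\<in>space M. i \<in> S x} \<in> sets M"
  shows "(\<lambda>x. card (S x)) \<in> measurable M (count_space UNIV)"
proof -
  have "(\<lambda>x. card (to_nat ` S x)) \<in> measurable M (count_space UNIV)"
  proof (rule measurable_card)
    fix n
    have "{x\<in>space M. n \<in> to_nat ` S x} = (\<Union>i\<in>{i. to_nat i = n}. {x\<in>space M. i \<in> S x})" by auto
    also have "\<dots> \<in> sets M" by (rule sets.countable_UN') (auto intro: S)
    finally show "{x\<in>space M. n \<in> to_nat ` S x} \<in> sets M" .
  qed
  then show ?thesis by (simp add: card_image inj_on_subset[OF inj_to_nat])
qed

text \<open>Below level \<open>t\<close> the level sets of the truncated time are those of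
  \<open>\<sigma>\<close>; from \<open>t\<close> on they are the whole space. In this form a
  stopping time enters computations that may use information up to \<open>t\<close> only.\<close>

lemma measurable_min_stopping_time:
  fixes \<sigma> :: "'a \<Rightarrow> real"
  assumes F: "filtration_on M F" and \<sigma>: "stopping_time F \<sigma>"
  shows "(\<lambda>\<omega>. min (\<sigma> \<omega>) t) \<in> borel_measurable (F t)"
proof (rule borel_measurableI_le)
  fix a
  have "{\<omega>\<in>space (F t). \<sigma> \<omega> \<le> a} \<in> sets (F t)" if "a \<le> t"
    using stopping_timeD[OF \<sigma>, of a] filtration_onD(1)[OF F] filtration_onD(2)[OF F that]
    by (auto simp: pred_def)
  then show "{\<omega>\<in>space (F t). min (\<sigma> \<omega>) t \<le> a} \<in> sets (F t)"
    by (cases "t \<le> a") (auto simp: min_le_iff_disj)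
qed

text \<open>A point at \<open>x\<close> is a point in \<open>(y,x]\<close>, and the mean number of
  those is at most \<open>r * (x - y)\<close>, which is arbitrarily small.\<close>

lemma (in prob_space) poisson_points_diffuse:
  assumes T: "poisson_points M r T" and r: "0 < r"
  shows "prob {\<omega>\<in>space M. T i \<omega> = x} = 0"
proof -
  note D = poisson_pointsD[OF T]
  have [measurable]: "T i \<in> borel_measurable M" for i by (rule D)
  have "prob {\<omega>\<in>space M. T i \<omega> = x} \<le> 0 + e" if e: "0 < e" for e
  proof -
    \<comment> \<open>Chosen so that \<open>r * (x - y) = e\<close>.\<close>
    define y where "y = x - e / r"
    have y: "y < x" using e r by (simp add: y_def)
    let ?f = "\<lambda>\<omega>. real (card {i. T i \<omega> \<le> x}) - real (card {i. T i \<omega> \<le> y})"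
    have le: "indicator {\<omega>\<in>space M. T i \<omega> = x} \<omega> \<le> ?f \<omega>" for \<omega>
    proof -
      have sub: "{i. T i \<omega> \<le> y} \<subseteq> {i. T i \<omega> \<le> x}" using y by auto
      have "card {i. T i \<omega> \<le> y} < card {i. T i \<omega> \<le> x}" if "T i \<omega> = x"
      proof (rule psubset_card_mono[OF D(3)])
        have "i \<in> {i. T i \<omega> \<le> x}" "i \<notin> {i. T i \<omega> \<le> y}" using that y by auto
        then show "{i. T i \<omega> \<le> y} \<subset> {i. T i \<omega> \<le> x}" using sub by blast
      qed
      moreover have "card {i. T i \<omega> \<le> y} \<le> card {i. T i \<omega> \<le> x}"
        by (rule card_mono[OF D(3) sub])
      ultimately show ?thesis by (auto simp: indicator_def)
    qed
    have "prob {\<omega>\<in>space M. T i \<omega> = x} = (\<integral>\<omega>. indicator {\<omega>\<in>space M. T i \<omega> = x} \<omega> \<partial>M)" by simp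
    also have "\<dots> \<le> (\<integral>\<omega>. ?f \<omega> \<partial>M)"
      by (intro integral_mono le Bochner_Integration.integrable_diff D(5) integrable_real_indicator)
         (auto simp: emeasure_eq_measure)
    also have "\<dots> = (LINT \<omega>:space M|M. ?f \<omega>)"
      unfolding set_lebesgue_integral_def by (intro Bochner_Integration.integral_cong) auto
    also have "\<dots> = r * (max 0 x - max 0 y) * prob (space M)"
      using y by (intro D(6)) (auto intro: sets.top[of "points_history M T y", simplified])
    also have "\<dots> \<le> r * (x - y)" using r y by (auto simp: prob_space)
    also have "\<dots> = e" using r by (simp add: y_def)
    finally show ?thesis by simp
  qed
  then have "prob {\<omega>\<in>space M. T i \<omega> = x} \<le> 0" by (rule field_le_epsilon)
  then show ?thesis using measure_nonneg[of M "{\<omega>\<in>space M. T i \<omega> = x}"] by linarith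
qed

lemma (in prob_space) distributed_diffuse:
  fixes X :: "'a \<Rightarrow> real"
  assumes X: "distributed M lborel X f"
  shows "prob {\<omega>\<in>space M. X \<omega> = x} = 0"
proof -
  have "emeasure M (X -` {x} \<inter> space M) = (\<integral>\<^sup>+y. f y * indicator {x} y \<partial>lborel)"
    by (rule distributed_emeasure[OF X]) simp
  also have "\<dots> = 0" by (rule nn_integral_null_set) (simp add: null_sets_def)
  finally have "emeasure M (X -` {x} \<inter> space M) = 0" by simp
  moreover have "X -` {x} \<inter> space M = {\<omega>\<in>space M. X \<omega> = x}" by auto
  ultimately show ?thesis by (simp add: measure_def)
qed

text \<open>With the first copy fixed, \<open>V\<close> is a constant, which \<open>U\<close> hits
  with probability zero.\<close>

lemma (in independent_pair) AE_neq:
  fixes U V :: "'a \<Rightarrow> real"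
  assumes [measurable]: "U \<in> borel_measurable S" "V \<in> borel_measurable E"
    and diffuse: "\<And>x. prob {\<omega>\<in>space M. U \<omega> = x} = 0"
  shows "AE \<omega> in M. U \<omega> \<noteq> V \<omega>"
proof -
  have [measurable]: "U \<in> borel_measurable M" by (rule measurable_from_subalg[OF subS]) fact
  have "AE \<omega> in M. case (\<omega>, \<omega>) of (\<omega>\<^sub>1, \<omega>\<^sub>2) \<Rightarrow> U \<omega>\<^sub>2 \<noteq> V \<omega>\<^sub>1"
  proof (rule AE_diag)
    show "Measurable.pred (E \<Otimes>\<^sub>M S) (\<lambda>(\<omega>\<^sub>1, \<omega>\<^sub>2). U \<omega>\<^sub>2 \<noteq> V \<omega>\<^sub>1)" by measurable
    fix \<omega>\<^sub>1
    show "AE \<omega>\<^sub>2 in M. case (\<omega>\<^sub>1, \<omega>\<^sub>2) of (\<omega>\<^sub>1, \<omega>\<^sub>2) \<Rightarrow> U \<omega>\<^sub>2 \<noteq> V \<omega>\<^sub>1"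
      using diffuse[of "V \<omega>\<^sub>1"]
      by (subst AE_iff_measurable[OF _ refl]) (auto simp: emeasure_eq_measure)
  qed
  then show ?thesis by simp
qed

lemma (in independent_pair) nn_integral_indep_mult:
  fixes f g :: "'a \<Rightarrow> ennreal"
  assumes f [measurable]: "f \<in> borel_measurable E" and g [measurable]: "g \<in> borel_measurable S"
  shows "(\<integral>\<^sup>+\<omega>. f \<omega> * g \<omega> \<partial>M) = (\<integral>\<^sup>+\<omega>. f \<omega> \<partial>M) * (\<integral>\<^sup>+\<omega>. g \<omega> \<partial>M)"
proof -
  have [measurable]: "f \<in> borel_measurable M" "g \<in> borel_measurable M"
    by (rule measurable_from_subalg[OF subE f], rule measurable_from_subalg[OF subS g])
  have "(\<integral>\<^sup>+\<omega>. (case (\<omega>, \<omega>) of (\<omega>\<^sub>1, \<omega>\<^sub>2) \<Rightarrow> f \<omega>\<^sub>1 * g \<omega>\<^sub>2) \<partial>M) =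
      (\<integral>\<^sup>+\<omega>\<^sub>1. (\<integral>\<^sup>+\<omega>\<^sub>2. (case (\<omega>\<^sub>1, \<omega>\<^sub>2) of (\<omega>\<^sub>1, \<omega>\<^sub>2) \<Rightarrow> f \<omega>\<^sub>1 * g \<omega>\<^sub>2) \<partial>M) \<partial>M)"
    by (rule nn_integral_diag) measurable
  then show ?thesis by (simp add: nn_integral_cmult nn_integral_multc)
qed

text \<open>The series sums to the mean number of points up to \<open>t\<close>, which is
  finite.\<close>

lemma (in prob_space) summable_prob_points:
  assumes T: "poisson_points M r T"
  shows "summable (\<lambda>i. prob {\<omega>\<in>space M. T i \<omega> \<le> t})"
proof (rule summable_suminf_not_top)
  note D = poisson_pointsD[OF T]
  have [measurable]: "T i \<in> borel_measurable M" for i by (rule D)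
  have "(\<Sum>i. ennreal (prob {\<omega>\<in>space M. T i \<omega> \<le> t})) = (\<Sum>i. \<integral>\<^sup>+\<omega>. indicator {\<omega>\<in>space M. T i \<omega> \<le> t} \<omega> \<partial>M)"
    by (simp add: emeasure_eq_measure)
  also have "\<dots> = (\<integral>\<^sup>+\<omega>. (\<Sum>i. indicator {\<omega>\<in>space M. T i \<omega> \<le> t} \<omega>) \<partial>M)"
    by (rule nn_integral_suminf[symmetric]) measurable
  also have "\<dots> = (\<integral>\<^sup>+\<omega>. ennreal (real (card {i. T i \<omega> \<le> t})) \<partial>M)"
  proof (rule nn_integral_cong)
    fix \<omega> assume "\<omega> \<in> space M"
    have "(\<Sum>i. indicator {\<omega>\<in>space M. T i \<omega> \<le> t} \<omega>) = (\<Sum>i\<in>{i. T i \<omega> \<le> t}. indicator {\<omega>\<in>space M. T i \<omega> \<le> t} \<omega> :: ennreal)"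
      by (rule suminf_finite[OF D(3)]) auto
    also have "\<dots> = ennreal (real (card {i. T i \<omega> \<le> t}))"
      using \<open>\<omega> \<in> space M\<close> by (simp add: ennreal_of_nat_eq_real_of_nat)
    finally show "(\<Sum>i. indicator {\<omega>\<in>space M. T i \<omega> \<le> t} \<omega> :: ennreal) = ennreal (real (card {i. T i \<omega> \<le> t}))" .
  qed
  also have "\<dots> < \<infinity>"
    using integrableD(2)[OF D(5)[of t]] by (simp add: less_top)
  finally show "(\<Sum>i. ennreal (prob {\<omega>\<in>space M. T i \<omega> \<le> t})) \<noteq> top" by simp
qed auto

text \<open>\<open>g i\<close> bounds what the cluster of parent \<open>i\<close> contributes up to
  \<open>t\<close>, and its integral over \<open>{T i \<le> t}\<close> is at most \<open>c\<close>
  times the probability of that event. The resulting bounds are summable because the expected number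
  of parents is finite.\<close>

lemma (in prob_space)
  fixes h :: "nat \<Rightarrow> 'a \<Rightarrow> real"
  assumes T: "poisson_points M r T" and [measurable]: "\<And>i. h i \<in> borel_measurable M"
    and g: "\<And>i. (\<integral>\<^sup>+\<omega>. indicator {\<omega>\<in>space M. T i \<omega> \<le> t} \<omega> * g i \<omega> \<partial>M) \<le> ennreal c * ennreal (prob {\<omega>\<in>space M. T i \<omega> \<le> t})"
    and c: "0 \<le> c"
    and h: "\<And>i \<omega>. ennreal \<bar>h i \<omega>\<bar> \<le> indicator {\<omega>. T i \<omega> \<le> t} \<omega> * g i \<omega>"
  shows cluster_integrable: "integrable M (h i)"
    and cluster_summable: "summable (\<lambda>i. \<integral>\<omega>. \<bar>h i \<omega>\<bar> \<partial>M)"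
proof -
  have bnd: "(\<integral>\<^sup>+\<omega>. ennreal \<bar>h i \<omega>\<bar> \<partial>M) \<le> ennreal (c * prob {\<omega>\<in>space M. T i \<omega> \<le> t})" for i
  proof -
    have "(\<integral>\<^sup>+\<omega>. ennreal \<bar>h i \<omega>\<bar> \<partial>M) \<le> (\<integral>\<^sup>+\<omega>. indicator {\<omega>\<in>space M. T i \<omega> \<le> t} \<omega> * g i \<omega> \<partial>M)"
      using h[of i] by (intro nn_integral_mono) (auto simp: indicator_def split: if_splits)
    also have "\<dots> \<le> ennreal c * ennreal (prob {\<omega>\<in>space M. T i \<omega> \<le> t})" by (rule g)
    finally show ?thesis using c by (simp add: ennreal_mult')
  qed
  show int: "integrable M (h i)" for i
    by (rule integrableI_bounded) (use bnd[of i] in \<open>auto simp: less_top[symmetric] top_unique\<close>)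
  show "summable (\<lambda>i. \<integral>\<omega>. \<bar>h i \<omega>\<bar> \<partial>M)"
  proof (rule summable_comparison_test')
    show "summable (\<lambda>i. c * prob {\<omega>\<in>space M. T i \<omega> \<le> t})"
      by (intro summable_mult summable_prob_points[OF T])
    fix i
    have "ennreal (\<integral>\<omega>. \<bar>h i \<omega>\<bar> \<partial>M) = (\<integral>\<^sup>+\<omega>. ennreal \<bar>h i \<omega>\<bar> \<partial>M)"
      using int[of i] by (intro nn_integral_eq_integral[symmetric]) auto
    also note bnd[of i]
    finally show "norm (\<integral>\<omega>. \<bar>h i \<omega>\<bar> \<partial>M) \<le> c * prob {\<omega>\<in>space M. T i \<omega> \<le> t}"
      using c by (simp add: ennreal_le_iff)
  qed
qed

text \<open>The hazard rate is constant. On \<open>{L \<le> c}\<close> the integrand is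
  \<open>1 - \<gamma> * L\<close>, with integral \<open>\<gamma> * c * exp (- c * \<gamma>)\<close>;
  on \<open>{c < L}\<close> it is the constant \<open>- \<gamma> * c\<close>, whose integral cancels
  the former.\<close>

lemma (in prob_space) exponential_hazard:
  assumes L: "distributed M lborel L (exponential_density \<gamma>)" and \<gamma>: "0 < \<gamma>"
    and pos: "\<And>\<omega>. 0 < L \<omega>"
  shows "(\<integral>\<omega>. indicator {..c} (L \<omega>) - \<gamma> * max 0 (min (L \<omega>) c) \<partial>M) = 0"
proof (cases "0 < c")
  case False
  then have "indicator {..c} (L \<omega>) - \<gamma> * max 0 (min (L \<omega>) c) = 0" for \<omega>
    using pos[of \<omega>] by (auto simp: indicator_def)
  then show ?thesis by simp
next
  case True
  have [measurable]: "L \<in> borel_measurable M" using distributed_measurable[OF L] by simp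
  have fin: "emeasure M {x \<in> space M. P x} < \<infinity>" for P by (simp add: emeasure_eq_measure)
  have gt: "prob {\<omega>\<in>space M. c < L \<omega>} = exp (- c * \<gamma>)"
    using exponential_distributedD_gt[OF L, of c] True \<gamma> by simp
  have "(\<integral>\<omega>. indicator {..c} (L \<omega>) * (1 - \<gamma> * L \<omega>) \<partial>M)
      = (\<integral>x. exponential_density \<gamma> x * (indicator {..c} x * (1 - \<gamma> * x)) \<partial>lborel)"
    using \<gamma> by (intro distributed_integral[OF L, symmetric]) (auto simp: exponential_density_nonneg)
  also have "\<dots> = (\<integral>x. (\<gamma> * exp (- x * \<gamma>) * (1 - \<gamma> * x)) * indicator {0..c} x \<partial>lborel)"
    by (intro Bochner_Integration.integral_cong) (auto simp: exponential_density_def indicator_def)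
  \<comment> \<open>\<open>\<gamma> * x * exp (- x * \<gamma>)\<close> is an antiderivative of the
    exponential density times \<open>1 - \<gamma> * x\<close>.\<close>
  also have "\<dots> = \<gamma> * c * exp (- c * \<gamma>) - \<gamma> * 0 * exp (- 0 * \<gamma>)"
    using True
    by (intro integral_FTC_Icc_real[where F="\<lambda>x. \<gamma> * x * exp (- x * \<gamma>)"])
       (auto intro!: derivative_eq_intros continuous_intros simp: field_simps)
  finally have 1: "(\<integral>\<omega>. indicator {..c} (L \<omega>) * (1 - \<gamma> * L \<omega>) \<partial>M) = \<gamma> * c * exp (- c * \<gamma>)" by simp
  have int1: "integrable M (\<lambda>\<omega>. indicator {..c} (L \<omega>) * (1 - \<gamma> * L \<omega>))"
  proof (rule integrable_const_bound[where B="1 + \<gamma> * c"])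
    show "AE \<omega> in M. norm (indicator {..c} (L \<omega>) * (1 - \<gamma> * L \<omega>)) \<le> 1 + \<gamma> * c"
    proof (rule AE_I2)
      fix \<omega>
      have "\<bar>1 - \<gamma> * L \<omega>\<bar> \<le> 1 + \<gamma> * c" if "L \<omega> \<le> c"
      proof -
        have "\<gamma> * L \<omega> \<le> \<gamma> * c" "0 \<le> \<gamma> * L \<omega>" using that \<gamma> pos[of \<omega>] by auto
        then show ?thesis by linarith
      qed
      then show "norm (indicator {..c} (L \<omega>) * (1 - \<gamma> * L \<omega>)) \<le> 1 + \<gamma> * c"
        using \<gamma> True by (auto simp: indicator_def)
    qed
  qed measurable
  have "(\<integral>\<omega>. indicator {..c} (L \<omega>) - \<gamma> * max 0 (min (L \<omega>) c) \<partial>M)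
      = (\<integral>\<omega>. indicator {..c} (L \<omega>) * (1 - \<gamma> * L \<omega>) - \<gamma> * c * indicator {\<omega>\<in>space M. c < L \<omega>} \<omega> \<partial>M)"
    using pos True
    by (intro Bochner_Integration.integral_cong) (auto simp: indicator_def min_def max_def less_imp_le not_le intro: order.strict_trans)
  also have "\<dots> = \<gamma> * c * exp (- c * \<gamma>) - \<gamma> * c * prob {\<omega>\<in>space M. c < L \<omega>}"
    using int1 fin by (subst Bochner_Integration.integral_diff) (auto simp: 1)
  finally show ?thesis by (simp add: gt)
qed

text \<open>While the lifetime has not ended, the history knows nothing more than that:
  \<open>{a < L}\<close> is not split by any event of the history at age \<open>a\<close>. Off this
  set the increment vanishes. If \<open>A\<close> misses it there is nothing to show; if
  \<open>A\<close> contains it, the increment integrates as over the whole space, to a difference of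
  two hazard identities.\<close>

lemma (in prob_space) exponential_martingale:
  assumes L: "distributed M lborel L (exponential_density \<gamma>)" and \<gamma>: "0 < \<gamma>"
    and pos: "\<And>\<omega>. 0 < L \<omega>" and ac: "a \<le> c"
    and A: "A \<in> sets (points_history M (\<lambda>_::unit. L) a)"
  shows "(LINT \<omega>:A|M. indicator {..c} (L \<omega>) - \<gamma> * max 0 (min (L \<omega>) c)) =
    (LINT \<omega>:A|M. indicator {..a} (L \<omega>) - \<gamma> * max 0 (min (L \<omega>) a))"
proof -
  let ?m = "\<lambda>c \<omega>. indicator {..c} (L \<omega>) - \<gamma> * max 0 (min (L \<omega>) c)"
  have [measurable]: "L \<in> borel_measurable M" using distributed_measurable[OF L] by simp
  have int: "integrable M (?m c)" for c
  proof (rule integrable_const_bound[where B="1 + \<gamma> * \<bar>c\<bar>"])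
    have "\<bar>?m c \<omega>\<bar> \<le> 1 + \<gamma> * \<bar>c\<bar>" for \<omega>
    proof -
      have "\<gamma> * max 0 (min (L \<omega>) c) \<le> \<gamma> * \<bar>c\<bar>" "0 \<le> \<gamma> * max 0 (min (L \<omega>) c)"
        using \<gamma> by (auto intro!: mult_left_mono)
      then show ?thesis by (auto simp: indicator_def)
    qed
    then show "AE \<omega> in M. norm (?m c \<omega>) \<le> 1 + \<gamma> * \<bar>c\<bar>" by simp
  qed measurable
  \<comment> \<open>The dichotomy holds for the generators \<open>{L \<le> u}\<close> with
    \<open>u \<le> a\<close>, which miss the set, and it is stable under complements and countable
    unions.\<close>
  have ev: "A \<in> events" and split: "A \<inter> {\<omega>\<in>space M. a < L \<omega>} = {} \<or> {\<omega>\<in>space M. a < L \<omega>} \<subseteq> A"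
  proof -
    have "A \<in> events \<and> (A \<inter> {\<omega>\<in>space M. a < L \<omega>} = {} \<or> {\<omega>\<in>space M. a < L \<omega>} \<subseteq> A)"
      using A unfolding sets_points_history
    proof induction
      case (Basic B) then show ?case by auto
    next
      case (Union B)
      then have "\<Union>(range B) \<in> events" by auto
      moreover have "\<Union>(range B) \<inter> {\<omega>\<in>space M. a < L \<omega>} = {} \<or> {\<omega>\<in>space M. a < L \<omega>} \<subseteq> \<Union>(range B)"
        using Union.IH by blast
      ultimately show ?case by blast
    qed auto
    then show "A \<in> events" "A \<inter> {\<omega>\<in>space M. a < L \<omega>} = {} \<or> {\<omega>\<in>space M. a < L \<omega>} \<subseteq> A" by auto
  qed
  note [measurable] = ev
  have zero: "?m c \<omega> - ?m a \<omega> = 0" if "L \<omega> \<le> a" for \<omega>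
    using that ac by (auto simp: indicator_def min_def)
  have "(LINT \<omega>:A|M. ?m c \<omega> - ?m a \<omega>) = 0"
    using split
  proof
    assume "A \<inter> {\<omega>\<in>space M. a < L \<omega>} = {}"
    then have "indicator A \<omega> *\<^sub>R (?m c \<omega> - ?m a \<omega>) = 0" if "\<omega> \<in> space M" for \<omega>
    proof (cases "\<omega> \<in> A")
      case True
      then have "L \<omega> \<le> a" using \<open>A \<inter> _ = {}\<close> that by (auto simp: not_less[symmetric])
      then show ?thesis by (simp only: zero scaleR_zero_right)
    qed simp
    then show ?thesis unfolding set_lebesgue_integral_def
      by (intro integral_eq_zero_AE AE_I2)
  next
    assume "{\<omega>\<in>space M. a < L \<omega>} \<subseteq> A"
    then have "indicator A \<omega> *\<^sub>R (?m c \<omega> - ?m a \<omega>) = ?m c \<omega> - ?m a \<omega>" if "\<omega> \<in> space M" for \<omega>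
    proof (cases "\<omega> \<in> A")
      case False
      then have "L \<omega> \<le> a" using \<open>_ \<subseteq> A\<close> that by (auto simp: not_less[symmetric])
      then show ?thesis by (simp only: zero scaleR_zero_right)
    qed simp
    then have "(LINT \<omega>:A|M. ?m c \<omega> - ?m a \<omega>) = (\<integral>\<omega>. ?m c \<omega> - ?m a \<omega> \<partial>M)"
      unfolding set_lebesgue_integral_def by (intro Bochner_Integration.integral_cong refl)
    also have "\<dots> = (\<integral>\<omega>. ?m c \<omega> \<partial>M) - (\<integral>\<omega>. ?m a \<omega> \<partial>M)"
      by (intro Bochner_Integration.integral_diff int)
    finally show ?thesis by (simp only: exponential_hazard[OF L \<gamma> pos] diff_self)
  qed
  moreover have "(LINT \<omega>:A|M. ?m c \<omega> - ?m a \<omega>) = (LINT \<omega>:A|M. ?m c \<omega>) - (LINT \<omega>:A|M. ?m a \<omega>)"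
    by (rule set_integral_diff) (use ev in \<open>auto simp only: set_integrable_def intro!: integrable_mult_indicator int\<close>)
  ultimately show ?thesis by simp
qed

section \<open>Clusters\<close>

text \<open>\<open>a i\<close> counts the points contributed by parent \<open>i\<close> and
  \<open>b i\<close> compensates them, so the martingale identity is asked for one parent at a time.
  At each sample point finitely many parents contribute, and the bound on the means lets the
  identities be summed.\<close>

lemma (in prob_space) has_intensity_cluster:
  fixes a b :: "nat \<Rightarrow> real \<Rightarrow> 'a \<Rightarrow> real"
  assumes F: "filtration_on M F"
    and int: "\<And>\<omega> t. 0 \<le> t \<Longrightarrow> set_integrable lborel {0..t} (\<lambda>s. rate s \<omega>)"
    and comp: "\<And>t \<omega>. 0 \<le> t \<Longrightarrow> compensator rate t \<omega> = (\<Sum>i. b i t \<omega>)"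
    and count: "\<And>t \<omega>. 0 \<le> t \<Longrightarrow> real (N t \<omega>) = (\<Sum>i. a i t \<omega>)"
    and fin: "\<And>t \<omega>. 0 \<le> t \<Longrightarrow> finite {i. a i t \<omega> \<noteq> 0}" "\<And>t \<omega>. 0 \<le> t \<Longrightarrow> finite {i. b i t \<omega> \<noteq> 0}"
    and b: "\<And>i t. 0 \<le> t \<Longrightarrow> b i t \<in> borel_measurable (F t)"
    and N: "adapted F N" and N0: "\<And>\<omega>. N 0 \<omega> = 0"
    and intX: "\<And>i t. 0 \<le> t \<Longrightarrow> integrable M (\<lambda>\<omega>. a i t \<omega> - b i t \<omega>)"
    and bnd: "\<And>t. 0 \<le> t \<Longrightarrow> summable (\<lambda>i. \<integral>\<omega>. \<bar>a i t \<omega> - b i t \<omega>\<bar> \<partial>M)"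
    and eq: "\<And>i s t A. 0 \<le> s \<Longrightarrow> s \<le> t \<Longrightarrow> A \<in> sets (F s) \<Longrightarrow>
      (LINT \<omega>:A|M. a i t \<omega> - b i t \<omega>) = (LINT \<omega>:A|M. a i s \<omega> - b i s \<omega>)"
  shows "has_intensity M F N rate"
proof -
  have fin': "finite {i. a i t \<omega> - b i t \<omega> \<noteq> 0}" if "0 \<le> t" for t \<omega>
    by (rule finite_subset[OF _ finite_UnI[OF fin(1)[OF that, of \<omega>] fin(2)[OF that, of \<omega>]]]) auto
  have X: "(\<lambda>\<omega>. real (N t \<omega>) - compensator rate t \<omega>) = (\<lambda>\<omega>. \<Sum>i. a i t \<omega> - b i t \<omega>)" if "0 \<le> t" for t
  proof
    fix \<omega>
    have "summable (\<lambda>i. a i t \<omega>)" "summable (\<lambda>i. b i t \<omega>)"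
      by (rule summable_finite[OF fin(1)[OF that, of \<omega>]], simp)
         (rule summable_finite[OF fin(2)[OF that, of \<omega>]], simp)
    then show "real (N t \<omega>) - compensator rate t \<omega> = (\<Sum>i. a i t \<omega> - b i t \<omega>)"
      using that by (simp add: comp count suminf_diff)
  qed
  show ?thesis
  proof (rule has_intensityI[OF F int _ N N0])
    show "adapted F (compensator rate)"
      unfolding adapted_def
    proof (intro allI impI)
      fix t :: real assume t: "0 \<le> t"
      then have "compensator rate t = (\<lambda>\<omega>. \<Sum>i. b i t \<omega>)" by (intro ext comp)
      then show "compensator rate t \<in> borel_measurable (F t)"
        using b[OF t] by (simp add: borel_measurable_suminf)
    qed
    show "integrable M (\<lambda>\<omega>. real (N t \<omega>) - compensator rate t \<omega>)" if "0 \<le> t" for t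
      unfolding X[OF that] by (intro integrable_suminf_finite intX fin' bnd that)
    show "(LINT \<omega>:A|M. real (N t \<omega>) - compensator rate t \<omega>) = (LINT \<omega>:A|M. real (N s \<omega>) - compensator rate s \<omega>)"
      if st: "0 \<le> s" "s \<le> t" and A: "A \<in> sets (F s)" for s t A
    proof -
      have t: "0 \<le> t" using st by simp
      have "A \<in> events" using A filtration_onD(3)[OF F] by blast
      then show ?thesis
        unfolding X[OF t] X[OF st(1)]
        using set_integral_suminf_finite[OF intX[OF t] fin'[OF t] bnd[OF t]]
          set_integral_suminf_finite[OF intX[OF st(1)] fin'[OF st(1)] bnd[OF st(1)]]
        by (simp add: eq[OF st A])
    qed
  qed
qed

lemma (in prob_space) poisson_points_mean:
  assumes T: "poisson_points M r T" and t: "0 \<le> t"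
  shows "(\<integral>\<omega>. real (card {i. T i \<omega> \<le> t}) \<partial>M) = r * t"
proof -
  note D = poisson_pointsD[OF T]
  have "{i. T i \<omega> \<le> 0} = {}" for \<omega> using D(2)[of _ \<omega>] by (auto simp: not_le)
  then have "(\<integral>\<omega>. real (card {i. T i \<omega> \<le> t}) \<partial>M) =
      (LINT \<omega>:space M|M. real (card {i. T i \<omega> \<le> t}) - real (card {i. T i \<omega> \<le> 0}))"
    unfolding set_lebesgue_integral_def by (intro Bochner_Integration.integral_cong) auto
  also have "\<dots> = r * (max 0 t - max 0 0) * prob (space M)"
    using t by (intro D(6)) (auto intro: sets.top[of "points_history M T 0", simplified])
  finally show ?thesis using t by (simp add: prob_space)
qed

text \<open>\<open>G k a\<close> is what source \<open>k\<close> has shown up to its own age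
  \<open>a\<close>, and \<open>\<tau> k\<close> is the time at which that age starts to run.\<close>

locale sources = prob_space M for M :: "'a measure" +
  fixes \<S> :: "'k \<Rightarrow> 'a set set" and G :: "'k \<Rightarrow> real \<Rightarrow> 'a measure" and \<tau> :: "'k \<Rightarrow> 'a \<Rightarrow> real"
  assumes indep: "indep_sets \<S> UNIV" and sa: "\<And>k. sigma_algebra (space M) (\<S> k)"
    and space_G [simp]: "\<And>k a. space (G k a) = space M"
    and mono_G: "\<And>k a b. a \<le> b \<Longrightarrow> sets (G k a) \<subseteq> sets (G k b)"
begin

abbreviation E where "E \<equiv> rest M \<S>"
abbreviation S where "S k \<equiv> sigma (space M) (\<S> k)"
abbreviation R where "R k \<equiv> revealed (E k) (S k) (G k) (\<tau> k)"
definition F where "F = common_filtration M R"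

lemma delayed: "delayed_pair M (E k) (S k) (G k)"
proof -
  interpret independent_pair M "E k" "S k" by (rule independent_pair_rest[OF indep sa])
  show ?thesis by unfold_locales (use mono_G in auto)
qed

lemma pair: "independent_pair M (E k) (S k)"
  by (rule independent_pair_rest[OF indep sa])

lemma sets_S [simp]: "sets (S k) = \<S> k" and space_S [simp]: "space (S k) = space M"
  using sa by (simp_all add: sigma_algebra.sets_measure_of_eq space_measure_of_conv)

lemma measurable_S: "(\<And>u. {\<omega>\<in>space M. f \<omega> \<le> u} \<in> \<S> k) \<Longrightarrow> f \<in> borel_measurable (S k)" for f :: "'a \<Rightarrow> real"
  by (intro borel_measurableI_le) simp

lemma measurable_E:
  "(\<And>u. {\<omega>\<in>space M. f \<omega> \<le> u} \<in> \<S> j) \<Longrightarrow> j \<noteq> k \<Longrightarrow> f \<in> borel_measurable (E k)" for f :: "'a \<Rightarrow> real"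
  by (intro borel_measurableI_le) (auto intro!: sets_rest sa)

lemma filtration_F: "filtration_on M F"
  unfolding F_def
  by (intro filtration_on_common_filtration delayed_pair.sigma_algebra_revealed[OF delayed]
      delayed_pair.revealed_sets[OF delayed] delayed_pair.revealed_mono[OF delayed])

lemma sets_F: "sets (F t) = (\<Inter>k. R k t)"
  unfolding F_def by (intro sets_common_filtration delayed_pair.sigma_algebra_revealed[OF delayed])

lemma space_F [simp]: "space (F t) = space M"
  by (rule filtration_onD[OF filtration_F])

lemma pred_F: "(\<And>k. {\<omega>\<in>space M. Q \<omega>} \<in> R k t) \<Longrightarrow> Measurable.pred (F t) Q"
  unfolding pred_def sets_F by auto

lemma R_of_E: "Measurable.pred (E k) Q \<Longrightarrow> {\<omega>\<in>space M. Q \<omega>} \<in> R k t"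
  using delayed_pair.sets_E_revealed[OF delayed, where \<tau>="\<tau> k" and s=t] by (auto simp: pred_def)

text \<open>The outside time \<open>g\<close> is fixed by the first copy; what remains is a question
  about \<open>f\<close> which source \<open>k\<close> must be able to answer at its age at time
  \<open>t\<close>.\<close>

lemma R_of_shift:
  fixes f g :: "'a \<Rightarrow> real"
  assumes [measurable]: "f \<in> borel_measurable (S k)" "g \<in> borel_measurable (E k)"
    and "\<And>\<omega>. \<omega> \<in> space M \<Longrightarrow> Measurable.pred (G k (t - \<tau> k \<omega>)) (\<lambda>\<omega>'. f \<omega>' \<le> t - g \<omega>)"
  shows "{\<omega>\<in>space M. g \<omega> + f \<omega> \<le> t} \<in> R k t"
proof -
  have "{\<omega>\<in>space M. f \<omega> \<le> t - g \<omega>} \<in> R k t"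
    by (rule delayed_pair.revealedI[OF delayed, where Q="\<lambda>\<omega>\<^sub>1 \<omega>\<^sub>2. f \<omega>\<^sub>2 \<le> t - g \<omega>\<^sub>1"])
       (use assms(3) in \<open>auto simp: case_prod_beta\<close>)
  then show ?thesis by (simp add: algebra_simps)
qed

text \<open>\<open>F s\<close> lies inside the \<sigma>-algebra of each single source, so
  \<open>k\<close> may be chosen as the source that carries the randomness of interest.\<close>

lemma F_martingale:
  fixes \<Phi> \<Psi> :: "'a \<Rightarrow> 'a \<Rightarrow> real"
  assumes "(\<lambda>(\<omega>\<^sub>1, \<omega>\<^sub>2). \<Phi> \<omega>\<^sub>1 \<omega>\<^sub>2) \<in> borel_measurable (E k \<Otimes>\<^sub>M S k)"
      "(\<lambda>(\<omega>\<^sub>1, \<omega>\<^sub>2). \<Psi> \<omega>\<^sub>1 \<omega>\<^sub>2) \<in> borel_measurable (E k \<Otimes>\<^sub>M S k)"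
    and "integrable M (\<lambda>\<omega>. \<Phi> \<omega> \<omega>)" "integrable M (\<lambda>\<omega>. \<Psi> \<omega> \<omega>)"
    and "A \<in> sets (F s)"
    and "\<And>\<omega>\<^sub>1 A'. \<omega>\<^sub>1 \<in> space M \<Longrightarrow> A' \<in> sets (G k (s - \<tau> k \<omega>\<^sub>1)) \<Longrightarrow>
      (LINT \<omega>\<^sub>2:A'|M. \<Phi> \<omega>\<^sub>1 \<omega>\<^sub>2) = (LINT \<omega>\<^sub>2:A'|M. \<Psi> \<omega>\<^sub>1 \<omega>\<^sub>2)"
  shows "(LINT \<omega>:A|M. \<Phi> \<omega> \<omega>) = (LINT \<omega>:A|M. \<Psi> \<omega> \<omega>)"
proof (rule delayed_pair.revealed_martingale[OF delayed assms(1-4), where \<tau>="\<tau> k" and s=s])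
  show "A \<in> R k s" using assms(5) by (auto simp: sets_F)
qed (rule assms(6))

end

section \<open>The Poisson parents\<close>

locale clusters = sources M \<S> G \<tau> for M :: "'a measure" and \<S> :: "'k \<Rightarrow> 'a set set" and G \<tau> +
  fixes p :: 'k and \<mu> :: real and T :: "nat \<Rightarrow> 'a \<Rightarrow> real"
  assumes G_parents: "G p = points_history M T" and \<tau>_parents: "\<And>\<omega>. \<tau> p \<omega> = 0"
    and \<mu>: "0 < \<mu>" and T: "poisson_points M \<mu> T"
    and T_source: "\<And>i u. {\<omega>\<in>space M. T i \<omega> \<le> u} \<in> \<S> p"
begin

lemmas T_strict_mono = poisson_pointsD(1)[OF T]
  and T_pos [simp] = poisson_pointsD(2)[OF T]
  and T_finite [simp] = poisson_pointsD(3)[OF T]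
  and T_measurable [measurable] = poisson_pointsD(4)[OF T]
  and T_integrable = poisson_pointsD(5)[OF T]
  and T_increment = poisson_pointsD(6)[OF T]

lemma T_nonpos [simp]: "t \<le> 0 \<Longrightarrow> \<not> T i \<omega> \<le> t"
  using T_pos[of i \<omega>] by linarith

lemma T_S [measurable]: "T i \<in> borel_measurable (S p)"
  by (rule measurable_S[OF T_source])

lemma T_E: "k \<noteq> p \<Longrightarrow> T i \<in> borel_measurable (E k)"
  using T_source by (rule measurable_E) auto

lemma T_finite_less [simp]: "finite {i. T i \<omega> < t}"
  by (rule finite_subset[OF _ T_finite[of \<omega> t]]) auto

text \<open>The parents source sees its own history, with delay zero, and for every other source all
  of \<open>T\<close> is outside information.\<close>

lemma stopping_time_T: "stopping_time F (T i)"
proof (rule stopping_timeI, rule pred_F)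
  fix t k
  show "{\<omega>\<in>space M. T i \<omega> \<le> t} \<in> R k t"
  proof (cases "k = p")
    case True
    have "{\<omega>\<in>space M. 0 + T i \<omega> \<le> t} \<in> R k t"
      unfolding True by (rule R_of_shift) (auto simp: G_parents \<tau>_parents intro!: points_history_pred)
    then show ?thesis by simp
  next
    case False
    note T_E[OF False, measurable]
    show ?thesis by (rule R_of_E) measurable
  qed
qed

lemma adapted_parents: "adapted F (\<lambda>t \<omega>. card {i. T i \<omega> \<le> t})"
  unfolding adapted_def borel_measurable_nat_iff
  using stopping_timeD[OF stopping_time_T] by (auto intro!: measurable_card simp: pred_def)

lemma has_intensity_parents: "has_intensity M F (\<lambda>t \<omega>. card {i. T i \<omega> \<le> t}) (\<lambda>_ _. \<mu>)"
proof -
  have comp: "compensator (\<lambda>_ _. \<mu>) t \<omega> = \<mu> * t" if "0 \<le> t" for t and \<omega> :: 'a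
    using that by (simp add: compensator_def set_lebesgue_integral_def)
  have int: "integrable M (\<lambda>\<omega>. real (card {i. T i \<omega> \<le> t}) - \<mu> * t)" for t
    by (intro Bochner_Integration.integrable_diff T_integrable) simp
  show ?thesis
  proof (rule has_intensityI[OF filtration_F _ _ adapted_parents])
    fix t :: real assume t: "0 \<le> t"
    show "set_integrable lborel {0..t} (\<lambda>s. \<mu>)" for \<omega> :: 'a
      using borel_integrable_atLeastAtMost'[of 0 t "\<lambda>_. \<mu>"] by simp
    show "integrable M (\<lambda>\<omega>. real (card {i. T i \<omega> \<le> t}) - compensator (\<lambda>_ _. \<mu>) t \<omega>)"
      using int by (simp add: comp[OF t])
  next
    fix s t :: real and A assume s: "0 \<le> s" "s \<le> t" and A: "A \<in> sets (F s)"
    then have t: "0 \<le> t" by simp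
    show "(LINT \<omega>:A|M. real (card {i. T i \<omega> \<le> t}) - compensator (\<lambda>_ _. \<mu>) t \<omega>) =
        (LINT \<omega>:A|M. real (card {i. T i \<omega> \<le> s}) - compensator (\<lambda>_ _. \<mu>) s \<omega>)"
      unfolding comp[OF t] comp[OF s(1)]
    \<comment> \<open>The integrands ignore the first copy: the compensator of the parents depends
      on nothing outside their source.\<close>
    proof (rule F_martingale[where k=p and s=s and \<Phi>="\<lambda>_ \<omega>. real (card {i. T i \<omega> \<le> t}) - \<mu> * t"
          and \<Psi>="\<lambda>_ \<omega>. real (card {i. T i \<omega> \<le> s}) - \<mu> * s", OF _ _ int int A])
      have [measurable]: "(\<lambda>\<omega>. card {i. T i \<omega> \<le> t}) \<in> measurable (S p) (count_space UNIV)" for t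
        by (rule measurable_card) (use T_source in auto)
      show "(\<lambda>(\<omega>\<^sub>1, \<omega>\<^sub>2). real (card {i. T i \<omega>\<^sub>2 \<le> t}) - \<mu> * t) \<in> borel_measurable (E p \<Otimes>\<^sub>M S p)"
        "(\<lambda>(\<omega>\<^sub>1, \<omega>\<^sub>2). real (card {i. T i \<omega>\<^sub>2 \<le> s}) - \<mu> * s) \<in> borel_measurable (E p \<Otimes>\<^sub>M S p)"
        by measurable
      fix \<omega>\<^sub>1 A' assume "A' \<in> sets (G p (s - \<tau> p \<omega>\<^sub>1))"
      then have A': "A' \<in> sets (points_history M T s)" by (simp add: G_parents \<tau>_parents)
      have "sets (points_history M T s) \<subseteq> events"
        unfolding sets_points_history by (intro sets.sigma_sets_subset) auto
      then have [measurable]: "A' \<in> events" using A' by auto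
      have si: "set_integrable M A' (\<lambda>\<omega>. real (card {i. T i \<omega> \<le> t}) - \<mu> * t)" for t
        unfolding set_integrable_def by (intro integrable_mult_indicator int) simp
      have "(LINT \<omega>:A'|M. real (card {i. T i \<omega> \<le> t}) - \<mu> * t) - (LINT \<omega>:A'|M. real (card {i. T i \<omega> \<le> s}) - \<mu> * s)
        = (LINT \<omega>:A'|M. (real (card {i. T i \<omega> \<le> t}) - real (card {i. T i \<omega> \<le> s})) - \<mu> * (t - s))"
        by (subst set_integral_diff(2)[OF si si, symmetric]) (simp add: algebra_simps)
      also have "\<dots> = (LINT \<omega>:A'|M. real (card {i. T i \<omega> \<le> t}) - real (card {i. T i \<omega> \<le> s})) - (LINT \<omega>:A'|M. \<mu> * (t - s))"
        by (intro set_integral_diff(2)) (auto simp only: set_integrable_def intro!: integrable_mult_indicator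
            Bochner_Integration.integrable_diff T_integrable integrable_const \<open>A' \<in> events\<close>)
      also have "\<dots> = 0"
        using s t T_increment[OF s(2) A'] by (simp add: set_lebesgue_integral_def)
      finally show "(LINT \<omega>:A'|M. real (card {i. T i \<omega> \<le> t}) - \<mu> * t) = (LINT \<omega>:A'|M. real (card {i. T i \<omega> \<le> s}) - \<mu> * s)"
        by simp
    qed
  next
    show "adapted F (compensator (\<lambda>_ _. \<mu>))"
      unfolding adapted_def
    proof (intro allI impI)
      fix t :: real assume "0 \<le> t"
      then have "compensator (\<lambda>_ _. \<mu>) t = (\<lambda>\<omega>::'a. \<mu> * t)" by (intro ext comp)
      then show "compensator (\<lambda>_ _. \<mu>) t \<in> borel_measurable (F t)" by simp
    qed
  qed simp
qed

end

section \<open>The Bartlett--Lewis process\<close>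

lemma card_pairs_eq_suminf:
  fixes P :: "nat \<Rightarrow> 'j \<Rightarrow> bool"
  assumes "finite I" "\<And>i j. P i j \<Longrightarrow> i \<in> I" "\<And>i. finite {j. P i j}"
  shows "real (card {q. P (fst q) (snd q)}) = (\<Sum>i. real (card {j. P i j}))"
    and "finite {q. P (fst q) (snd q)}"
proof -
  have eq: "{q. P (fst q) (snd q)} = (SIGMA i:I. {j. P i j})" using assms(2) by auto
  show "finite {q. P (fst q) (snd q)}" unfolding eq using assms by auto
  have "card {q. P (fst q) (snd q)} = (\<Sum>i\<in>I. card {j. P i j})"
    unfolding eq using assms by (intro card_SigmaI) auto
  then have "real (card {q. P (fst q) (snd q)}) = (\<Sum>i\<in>I. real (card {j. P i j}))" by simp
  also have "\<dots> = (\<Sum>i. real (card {j. P i j}))"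
  proof (rule suminf_finite[symmetric, OF assms(1)])
    fix i assume "i \<notin> I"
    then have "{j. P i j} = {}" using assms(2) by auto
    then show "real (card {j. P i j}) = 0" by simp
  qed
  finally show "real (card {q. P (fst q) (snd q)}) = (\<Sum>i. real (card {j. P i j}))" .
qed

text \<open>Lifetime and offspring of parent \<open>i\<close> are two sources whose clocks both
  start at the arrival of that parent. A lifetime is a sequence with a single point, whence the
  index type \<open>unit\<close>.\<close>

locale bartlett_lewis_clusters =
  clusters M \<S>
    "\<lambda>k. case k of BL_Parents \<Rightarrow> points_history M T | BL_Lifetime i \<Rightarrow> points_history M (\<lambda>_::unit. L i)
       | BL_Offspring i \<Rightarrow> points_history M (\<kappa> i)"
    "\<lambda>k. case k of BL_Parents \<Rightarrow> (\<lambda>_. 0) | BL_Lifetime i \<Rightarrow> T i | BL_Offspring i \<Rightarrow> T i"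
    BL_Parents \<mu> T
  for M :: "'a measure" and \<S> T \<mu> and L :: "nat \<Rightarrow> 'a \<Rightarrow> real" and \<kappa> :: "nat \<Rightarrow> nat \<Rightarrow> 'a \<Rightarrow> real" +
  fixes \<gamma> \<nu> :: real
  assumes \<gamma>: "0 < \<gamma>" and \<nu>: "0 < \<nu>"
    and L_exp: "\<And>i. distributed M lborel (L i) (exponential_density \<gamma>)"
    and L_pos [simp]: "\<And>i \<omega>. 0 < L i \<omega>"
    and L_source: "\<And>i u. {\<omega>\<in>space M. L i \<omega> \<le> u} \<in> \<S> (BL_Lifetime i)"
    and \<kappa>: "\<And>i. poisson_points M \<nu> (\<kappa> i)"
    and \<kappa>_source: "\<And>i l u. {\<omega>\<in>space M. \<kappa> i l \<omega> \<le> u} \<in> \<S> (BL_Offspring i)"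
begin

lemmas \<kappa>_pos [simp] = poisson_pointsD(2)[OF \<kappa>]
  and \<kappa>_finite [simp] = poisson_pointsD(3)[OF \<kappa>]
  and \<kappa>_measurable [measurable] = poisson_pointsD(4)[OF \<kappa>]

lemma L_measurable [measurable]: "L i \<in> borel_measurable M"
  using distributed_measurable[OF L_exp] by simp

lemma L_S: "L i \<in> borel_measurable (S (BL_Lifetime i))"
  by (rule measurable_S[OF L_source])

lemma \<kappa>_S: "\<kappa> i l \<in> borel_measurable (S (BL_Offspring i))"
  by (rule measurable_S[OF \<kappa>_source])

lemma L_E: "k \<noteq> BL_Lifetime i \<Longrightarrow> L i \<in> borel_measurable (E k)"
  using L_source by (rule measurable_E) auto

lemma \<kappa>_E: "k \<noteq> BL_Offspring i \<Longrightarrow> \<kappa> i l \<in> borel_measurable (E k)"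
  using \<kappa>_source by (rule measurable_E) auto

text \<open>The sum is seen in three ways. For the parents source the lifetime is known and
  \<open>T i\<close> is compared with \<open>t - L i\<close>, which is at most \<open>t\<close>; for
  the lifetime source \<open>T i\<close> is known and \<open>L i\<close> is compared with the age
  \<open>t - T i\<close>; any other source knows both summands.\<close>

lemma stopping_time_death: "stopping_time F (\<lambda>\<omega>. T i \<omega> + L i \<omega>)"
proof (rule stopping_timeI, rule pred_F)
  fix t k
  consider "k = BL_Parents" | "k = BL_Lifetime i" | "k \<noteq> BL_Parents" "k \<noteq> BL_Lifetime i" by blast
  then show "{\<omega>\<in>space M. T i \<omega> + L i \<omega> \<le> t} \<in> R k t"
  proof cases
    case 1
    have "{\<omega>\<in>space M. L i \<omega> + T i \<omega> \<le> t} \<in> R k t" unfolding 1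
      by (rule R_of_shift) (auto intro!: L_E T_S points_history_pred less_imp_le)
    then show ?thesis by (simp add: add.commute)
  next
    case 2
    show ?thesis unfolding 2
      by (rule R_of_shift) (auto intro!: L_S T_E points_history_pred[where T="\<lambda>_. L i"])
  next
    case 3
    note [measurable] = T_E[OF 3(1)] L_E[OF 3(2)]
    show ?thesis by (rule R_of_E) measurable
  qed
qed

lemma stopping_time_birth: "stopping_time F (\<lambda>\<omega>. T i \<omega> + \<kappa> i l \<omega>)"
proof (rule stopping_timeI, rule pred_F)
  fix t k
  consider "k = BL_Parents" | "k = BL_Offspring i" | "k \<noteq> BL_Parents" "k \<noteq> BL_Offspring i" by blast
  then show "{\<omega>\<in>space M. T i \<omega> + \<kappa> i l \<omega> \<le> t} \<in> R k t"
  proof cases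
    case 1
    have "{\<omega>\<in>space M. \<kappa> i l \<omega> + T i \<omega> \<le> t} \<in> R k t" unfolding 1
      by (rule R_of_shift) (auto intro!: \<kappa>_E T_S points_history_pred less_imp_le)
    then show ?thesis by (simp add: add.commute)
  next
    case 2
    show ?thesis unfolding 2
      by (rule R_of_shift) (auto intro!: \<kappa>_S T_E points_history_pred)
  next
    case 3
    note [measurable] = T_E[OF 3(1)] \<kappa>_E[OF 3(2)]
    show ?thesis by (rule R_of_E) measurable
  qed
qed

text \<open>The lifespan \<open>(T i, T i + L i]\<close> is open on the left, so this is the number
  of parents alive just before \<open>s\<close>, in accordance with the drive, which integrates over
  \<open>[0,s)\<close> only.\<close>

definition alive :: "real \<Rightarrow> 'a \<Rightarrow> real" where
  "alive s \<omega> = real (card {i. T i \<omega> < s \<and> s \<le> T i \<omega> + L i \<omega>})"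

text \<open>Written as a difference of two truncated stopping times, so that measurability at time
  \<open>t\<close> is immediate; \<open>lived_eq\<close> gives the form in terms of the age.\<close>

definition lived :: "nat \<Rightarrow> real \<Rightarrow> 'a \<Rightarrow> real" where
  "lived i t \<omega> = min (T i \<omega> + L i \<omega>) t - min (T i \<omega>) t"

definition births :: "nat \<Rightarrow> real \<Rightarrow> 'a \<Rightarrow> nat set" where
  "births i t \<omega> = {l. \<kappa> i l \<omega> \<le> L i \<omega> \<and> T i \<omega> + \<kappa> i l \<omega> \<le> t}"

lemma lived_eq: "lived i t \<omega> = max 0 (min (L i \<omega>) (t - T i \<omega>))"
  using less_imp_le[OF L_pos[of i \<omega>]] L_pos[of i \<omega>] unfolding lived_def min_def max_def
  by (simp split: if_split del: L_pos)

lemma lived_zero: "t < T i \<omega> \<Longrightarrow> lived i t \<omega> = 0"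
  by (simp add: lived_eq)

lemma lived_F: "lived i t \<in> borel_measurable (F t)"
  unfolding lived_def[abs_def]
  by (intro borel_measurable_diff measurable_min_stopping_time[OF filtration_F] stopping_time_death stopping_time_T)

lemma finite_lived: "finite {i. c * lived i t \<omega> \<noteq> 0}"
  by (rule finite_subset[OF _ T_finite[of \<omega> t]]) (use lived_zero in \<open>force simp: not_le[symmetric]\<close>)

lemma births_eq: "births i t \<omega> = {l. \<kappa> i l \<omega> \<le> min (L i \<omega>) (t - T i \<omega>)}"
  unfolding births_def by auto

lemma births_empty: "t < T i \<omega> \<Longrightarrow> births i t \<omega> = {}"
proof -
  assume t: "t < T i \<omega>"
  have "\<not> (\<kappa> i l \<omega> \<le> L i \<omega> \<and> T i \<omega> + \<kappa> i l \<omega> \<le> t)" for l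
    using \<kappa>_pos[of i l \<omega>] t by linarith
  then show ?thesis unfolding births_def by simp
qed

lemma finite_births [simp]: "finite (births i t \<omega>)"
  unfolding births_eq by simp

text \<open>On \<open>[0,t]\<close> the number alive is a sum of indicators of lifespans over the
  parents born by \<open>t\<close>, and the indicator of a lifespan integrates to the time
  lived.\<close>

lemma compensator_alive:
  assumes t: "0 \<le> t"
  shows "set_integrable lborel {0..t} (\<lambda>s. c * alive s \<omega>)"
    and "compensator (\<lambda>s \<omega>. c * alive s \<omega>) t \<omega> = (\<Sum>i. c * lived i t \<omega>)"
proof -
  let ?J = "{i. T i \<omega> \<le> t}"
  let ?I = "\<lambda>i. {T i \<omega><..min (T i \<omega> + L i \<omega>) t}"
  have eq: "indicator {0..t} s *\<^sub>R (c * alive s \<omega>) = (\<Sum>i\<in>?J. c * indicator (?I i) s)" for s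
  proof (cases "s \<in> {0..t}")
    case True
    have "{i. T i \<omega> < s \<and> s \<le> T i \<omega> + L i \<omega>} = ?J \<inter> {i. s \<in> ?I i}" using True by auto
    then have "alive s \<omega> = (\<Sum>i\<in>?J. if s \<in> ?I i then 1 else 0)"
      unfolding alive_def by (simp add: sum.If_cases)
    then have "c * alive s \<omega> = (\<Sum>i\<in>?J. c * indicator (?I i) s)"
      by (simp only: sum_distrib_left indicator_def of_bool_def)
    then show ?thesis using True by simp
  next
    case False
    have "s \<notin> ?I i" for i using False less_trans[OF T_pos[of i \<omega>], of s] by auto
    then show ?thesis using False by simp
  qed
  have int: "integrable lborel (\<lambda>s. c * indicator (?I i) s :: real)" for i
  proof (intro integrable_mult_right integrable_real_indicator)
    show "emeasure lborel (?I i) < \<infinity>"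
      by (rule emeasure_bounded_finite, rule bounded_subset[OF bounded_closed_interval[of "T i \<omega>" t]]) auto
  qed simp
  have "integrable lborel (\<lambda>s. \<Sum>i\<in>?J. c * indicator (?I i) s)"
    using int by (intro Bochner_Integration.integrable_sum) auto
  then show "set_integrable lborel {0..t} (\<lambda>s. c * alive s \<omega>)"
    unfolding set_integrable_def eq .
  have "compensator (\<lambda>s \<omega>. c * alive s \<omega>) t \<omega> = (\<Sum>i\<in>?J. \<integral>s. c * indicator (?I i) s \<partial>lborel)"
    unfolding compensator_def set_lebesgue_integral_def eq using int by (intro Bochner_Integration.integral_sum) auto
  also have "\<dots> = (\<Sum>i\<in>?J. c * lived i t \<omega>)"
  proof (intro sum.cong refl)
    fix i assume "i \<in> ?J"
    then have "T i \<omega> \<le> min (T i \<omega> + L i \<omega>) t"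
      using less_imp_le[OF L_pos[of i \<omega>]] by simp
    from measure_lborel_Ioc[OF this] show "(\<integral>s. c * indicator (?I i) s \<partial>lborel) = c * lived i t \<omega>"
      using \<open>i \<in> ?J\<close> by (simp add: lived_def)
  qed
  also have "\<dots> = (\<Sum>i. c * lived i t \<omega>)"
    by (rule suminf_finite[symmetric]) (auto simp: lived_zero)
  finally show "compensator (\<lambda>s \<omega>. c * alive s \<omega>) t \<omega> = (\<Sum>i. c * lived i t \<omega>)" .
qed

text \<open>The nested comprehension has the shape \<open>{i\<in>I. x i \<le> t}\<close> of the
  lemmas on point configurations, with pairs of parent and child as indices and the births not after
  death as \<open>I\<close>.\<close>

definition children :: "real \<Rightarrow> 'a \<Rightarrow> nat" where
  "children t \<omega> = card {q\<in>{q. \<kappa> (fst q) (snd q) \<omega> \<le> L (fst q) \<omega>}. T (fst q) \<omega> + \<kappa> (fst q) (snd q) \<omega> \<le> t}"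

lemma
  shows children_suminf: "real (children t \<omega>) = (\<Sum>i. real (card (births i t \<omega>)))"
    and finite_children: "finite {q\<in>{q. \<kappa> (fst q) (snd q) \<omega> \<le> L (fst q) \<omega>}. T (fst q) \<omega> + \<kappa> (fst q) (snd q) \<omega> \<le> t}"
proof -
  let ?P = "\<lambda>i l. \<kappa> i l \<omega> \<le> L i \<omega> \<and> T i \<omega> + \<kappa> i l \<omega> \<le> t"
  have P: "?P i l \<Longrightarrow> i \<in> {i. T i \<omega> \<le> t}" for i l
    using \<kappa>_pos[of i l \<omega>] unfolding mem_Collect_eq by linarith
  have fin: "finite {l. ?P i l}" for i using finite_births by (simp add: births_def)
  have eq: "{q\<in>{q. \<kappa> (fst q) (snd q) \<omega> \<le> L (fst q) \<omega>}. T (fst q) \<omega> + \<kappa> (fst q) (snd q) \<omega> \<le> t}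
      = {q. ?P (fst q) (snd q)}" by auto
  show "real (children t \<omega>) = (\<Sum>i. real (card (births i t \<omega>)))"
    unfolding children_def eq births_def by (rule card_pairs_eq_suminf(1)[OF T_finite P fin])
  show "finite {q\<in>{q. \<kappa> (fst q) (snd q) \<omega> \<le> L (fst q) \<omega>}. T (fst q) \<omega> + \<kappa> (fst q) (snd q) \<omega> \<le> t}"
    unfolding eq by (rule card_pairs_eq_suminf(2)[OF T_finite P fin])
qed

lemma adapted_children: "adapted F children"
  unfolding adapted_def borel_measurable_nat_iff
proof (intro allI impI)
  fix t :: real
  show "children t \<in> measurable (F t) (count_space UNIV)"
    unfolding children_def[abs_def]
  proof (rule measurable_card_countable)
    fix q :: "nat \<times> nat"
    let ?b = "\<lambda>\<omega>. T (fst q) \<omega> + \<kappa> (fst q) (snd q) \<omega>" and ?d = "\<lambda>\<omega>. T (fst q) \<omega> + L (fst q) \<omega>"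
    have [measurable]: "Measurable.pred (F t) (\<lambda>\<omega>. ?b \<omega> \<le> t)"
      "(\<lambda>\<omega>. min (?b \<omega>) t) \<in> borel_measurable (F t)" "(\<lambda>\<omega>. min (?d \<omega>) t) \<in> borel_measurable (F t)"
      by (rule stopping_timeD[OF stopping_time_birth], rule measurable_min_stopping_time[OF filtration_F stopping_time_birth],
          rule measurable_min_stopping_time[OF filtration_F stopping_time_death])
    \<comment> \<open>Comparing birth with death may involve the future; on
      \<open>{?b \<le> t}\<close> the comparison can be made between the two times truncated at
      \<open>t\<close>.\<close>
    have "{\<omega>\<in>space (F t). ?b \<omega> \<le> t \<and> min (?b \<omega>) t \<le> min (?d \<omega>) t} \<in> sets (F t)" by measurable
    also have "{\<omega>\<in>space (F t). ?b \<omega> \<le> t \<and> min (?b \<omega>) t \<le> min (?d \<omega>) t} =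
      {\<omega>\<in>space (F t). q \<in> {q\<in>{q. \<kappa> (fst q) (snd q) \<omega> \<le> L (fst q) \<omega>}. T (fst q) \<omega> + \<kappa> (fst q) (snd q) \<omega> \<le> t}}"
      by (auto simp: min_def)
    finally show "{\<omega>\<in>space (F t). q \<in> {q\<in>{q. \<kappa> (fst q) (snd q) \<omega> \<le> L (fst q) \<omega>}. T (fst q) \<omega> + \<kappa> (fst q) (snd q) \<omega> \<le> t}}
      \<in> sets (F t)" .
  qed
qed

text \<open>In the application \<open>c\<close> and \<open>b\<close> are the ages up to which births
  count at times \<open>t\<close> and \<open>s\<close>, cut off at death, and \<open>a\<close> is
  the age at time \<open>s\<close>. After death the cut-off makes \<open>b = c\<close> and nothing
  happens in between; before it \<open>b = a\<close>, and the Poisson increment after age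
  \<open>a\<close> is compensated.\<close>

lemma birth_compensation:
  assumes ac: "b \<le> c" and A: "A \<in> sets (points_history M (\<kappa> i) a)" and b: "b = c \<or> b = a"
  shows "(LINT \<omega>:A|M. real (card {l. \<kappa> i l \<omega> \<le> c}) - \<nu> * max 0 c) = (LINT \<omega>:A|M. real (card {l. \<kappa> i l \<omega> \<le> b}) - \<nu> * max 0 b)"
proof (cases "b = c")
  case False
  then have "b = a" using b by simp
  note D = poisson_pointsD[OF \<kappa>[of i]]
  have "sets (points_history M (\<kappa> i) a) \<subseteq> events"
    unfolding sets_points_history by (intro sets.sigma_sets_subset) auto
  then have ev: "A \<in> events" using A by auto
  have int: "integrable M (\<lambda>\<omega>. real (card {l. \<kappa> i l \<omega> \<le> t}) - \<nu> * max 0 t)" for t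
    by (intro Bochner_Integration.integrable_diff D(5)) simp
  have si: "set_integrable M A (\<lambda>\<omega>. real (card {l. \<kappa> i l \<omega> \<le> t}) - \<nu> * max 0 t)" for t
    unfolding set_integrable_def by (intro integrable_mult_indicator int ev)
  have "(LINT \<omega>:A|M. real (card {l. \<kappa> i l \<omega> \<le> c}) - \<nu> * max 0 c) - (LINT \<omega>:A|M. real (card {l. \<kappa> i l \<omega> \<le> b}) - \<nu> * max 0 b)
    = (LINT \<omega>:A|M. (real (card {l. \<kappa> i l \<omega> \<le> c}) - real (card {l. \<kappa> i l \<omega> \<le> b})) - \<nu> * (max 0 c - max 0 b))"
    by (subst set_integral_diff(2)[OF si si, symmetric]) (simp add: algebra_simps)
  also have "\<dots> = (LINT \<omega>:A|M. real (card {l. \<kappa> i l \<omega> \<le> c}) - real (card {l. \<kappa> i l \<omega> \<le> b})) - (LINT \<omega>:A|M. \<nu> * (max 0 c - max 0 b))"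
    by (intro set_integral_diff(2)) (auto simp only: set_integrable_def intro!: integrable_mult_indicator
        Bochner_Integration.integrable_diff D(5) integrable_const ev)
  also have "\<dots> = 0"
    using D(6)[OF ac, of A] A ev \<open>b = a\<close> by (simp add: set_lebesgue_integral_def)
  finally show ?thesis by simp
qed simp

lemma has_intensity_children: "has_intensity M F children (\<lambda>s \<omega>. \<nu> * alive s \<omega>)"
proof -
  let ?X = "\<lambda>i t \<omega>. real (card (births i t \<omega>)) - \<nu> * lived i t \<omega>"
  have card_meas: "(\<lambda>\<omega>. card (births i t \<omega>)) \<in> measurable M (count_space UNIV)" for i t
    unfolding births_def by (rule measurable_card) simp
  have X_meas: "?X i t \<in> borel_measurable M" for i t
  proof -
    note card_meas[measurable]
    show ?thesis unfolding lived_def by measurable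
  qed
  have bound: "integrable M (?X i t)" "summable (\<lambda>i. \<integral>\<omega>. \<bar>?X i t \<omega>\<bar> \<partial>M)" if t: "0 \<le> t" for i t
  proof -
    \<comment> \<open>The majorant ignores death and the delay of the parent: all points of
      \<open>\<kappa> i\<close> up to age \<open>t\<close>, plus the largest possible compensator
      \<open>\<nu> * t\<close>. It depends on the offspring source only, hence is independent of
      \<open>{T i \<le> t}\<close>, and its mean is \<open>2 * \<nu> * t\<close>.\<close>
    let ?g = "\<lambda>i \<omega>. ennreal (real (card {l. \<kappa> i l \<omega> \<le> t}) + \<nu> * t)"
    have g: "(\<integral>\<^sup>+\<omega>. indicator {\<omega>\<in>space M. T i \<omega> \<le> t} \<omega> * ?g i \<omega> \<partial>M)
        \<le> ennreal (2 * \<nu> * t) * ennreal (prob {\<omega>\<in>space M. T i \<omega> \<le> t})" for i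
    proof -
      interpret P: independent_pair M "E (BL_Offspring i)" "S (BL_Offspring i)" by (rule pair)
      have [measurable]: "(\<lambda>\<omega>. card {l. \<kappa> i l \<omega> \<le> t}) \<in> measurable (S (BL_Offspring i)) (count_space UNIV)"
        by (rule measurable_card) (use \<kappa>_source in auto)
      have [measurable]: "{\<omega>\<in>space M. T i \<omega> \<le> t} \<in> sets (E (BL_Offspring i))"
        using T_E[of "BL_Offspring i" i] by (auto simp: borel_measurable_iff_le)
      have "(\<integral>\<^sup>+\<omega>. indicator {\<omega>\<in>space M. T i \<omega> \<le> t} \<omega> * ?g i \<omega> \<partial>M)
          = (\<integral>\<^sup>+\<omega>. indicator {\<omega>\<in>space M. T i \<omega> \<le> t} \<omega> \<partial>M) * (\<integral>\<^sup>+\<omega>. ?g i \<omega> \<partial>M)"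
        by (rule P.nn_integral_indep_mult) measurable
      also have "(\<integral>\<^sup>+\<omega>. ?g i \<omega> \<partial>M) = ennreal (\<integral>\<omega>. real (card {l. \<kappa> i l \<omega> \<le> t}) + \<nu> * t \<partial>M)"
        using t \<nu> poisson_pointsD(5)[OF \<kappa>] by (intro nn_integral_eq_integral) auto
      also have "(\<integral>\<omega>. real (card {l. \<kappa> i l \<omega> \<le> t}) + \<nu> * t \<partial>M) = 2 * \<nu> * t"
        using poisson_points_mean[OF \<kappa>[of i] t] poisson_pointsD(5)[OF \<kappa>] by (simp add: prob_space)
      finally show ?thesis by (simp add: emeasure_eq_measure mult.commute)
    qed
    have h: "ennreal \<bar>?X i t \<omega>\<bar> \<le> indicator {\<omega>. T i \<omega> \<le> t} \<omega> * ?g i \<omega>" for i \<omega>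
    proof (cases "T i \<omega> \<le> t")
      case True
      have "births i t \<omega> \<subseteq> {l. \<kappa> i l \<omega> \<le> t}"
      proof
        fix l assume "l \<in> births i t \<omega>"
        then show "l \<in> {l. \<kappa> i l \<omega> \<le> t}" using T_pos[of i \<omega>] unfolding births_def mem_Collect_eq by linarith
      qed
      then have "card (births i t \<omega>) \<le> card {l. \<kappa> i l \<omega> \<le> t}" by (intro card_mono) auto
      moreover have "0 \<le> \<nu> * lived i t \<omega>" "\<nu> * lived i t \<omega> \<le> \<nu> * t"
        using \<nu> t less_imp_le[OF T_pos[of i \<omega>]] by (auto simp: lived_eq min_le_iff_disj intro!: mult_left_mono)
      ultimately have "\<bar>?X i t \<omega>\<bar> \<le> real (card {l. \<kappa> i l \<omega> \<le> t}) + \<nu> * t" by linarith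
      then show ?thesis using True by (simp add: ennreal_leI)
    qed (simp add: births_empty lived_zero)
    have c: "0 \<le> 2 * \<nu> * t" using \<nu> t by simp
    show "integrable M (?X i t)" by (rule cluster_integrable[OF T X_meas g c h])
    show "summable (\<lambda>i. \<integral>\<omega>. \<bar>?X i t \<omega>\<bar> \<partial>M)" by (rule cluster_summable[OF T X_meas g c h])
  qed
  show ?thesis
  proof (rule has_intensity_cluster[OF filtration_F, where a="\<lambda>i t \<omega>. real (card (births i t \<omega>))" and b="\<lambda>i t \<omega>. \<nu> * lived i t \<omega>"])
    fix i s t A assume st: "0 \<le> s" "s \<le> t" and A: "A \<in> sets (F s)"
    then have t: "0 \<le> t" by simp
    \<comment> \<open>Known from outside the offspring source: the age at which counting of births
      stops, by death or because time \<open>t\<close> is reached.\<close>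
    define c where "c t \<omega>\<^sub>1 = min (L i \<omega>\<^sub>1) (t - T i \<omega>\<^sub>1)" for t \<omega>\<^sub>1
    define \<Phi> where "\<Phi> t \<omega>\<^sub>1 \<omega>\<^sub>2 = real (card {l. \<kappa> i l \<omega>\<^sub>2 \<le> c t \<omega>\<^sub>1}) - \<nu> * max 0 (c t \<omega>\<^sub>1)" for t \<omega>\<^sub>1 \<omega>\<^sub>2
    have X: "?X i t = (\<lambda>\<omega>. \<Phi> t \<omega> \<omega>)" for t
      by (simp add: \<Phi>_def c_def births_eq lived_eq)
    let ?k = "BL_Offspring i"
    have [measurable]: "c t \<in> borel_measurable (E ?k)" for t
      unfolding c_def by (intro borel_measurable_min borel_measurable_diff L_E T_E) auto
    note \<kappa>_S[measurable]
    have [measurable]: "(\<lambda>(\<omega>\<^sub>1, \<omega>\<^sub>2). card {l. \<kappa> i l \<omega>\<^sub>2 \<le> c t \<omega>\<^sub>1}) \<in> measurable (E ?k \<Otimes>\<^sub>M S ?k) (count_space UNIV)" for t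
      unfolding case_prod_beta by (rule measurable_card) measurable
    have \<Phi>: "(\<lambda>(\<omega>\<^sub>1, \<omega>\<^sub>2). \<Phi> t \<omega>\<^sub>1 \<omega>\<^sub>2) \<in> borel_measurable (E ?k \<Otimes>\<^sub>M S ?k)" for t
      unfolding \<Phi>_def by (simp add: case_prod_beta) measurable
    show "(LINT \<omega>:A|M. ?X i t \<omega>) = (LINT \<omega>:A|M. ?X i s \<omega>)"
      unfolding X
    proof (rule F_martingale[OF \<Phi> \<Phi> _ _ A])
      show "integrable M (\<lambda>\<omega>. \<Phi> t \<omega> \<omega>)" "integrable M (\<lambda>\<omega>. \<Phi> s \<omega> \<omega>)"
        using bound(1)[OF t, of i] bound(1)[OF st(1), of i] unfolding X by auto
      fix \<omega>\<^sub>1 A' assume "A' \<in> sets ((case ?k of BL_Parents \<Rightarrow> points_history M T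
         | BL_Lifetime i \<Rightarrow> points_history M (\<lambda>_::unit. L i) | BL_Offspring i \<Rightarrow> points_history M (\<kappa> i))
           (s - (case ?k of BL_Parents \<Rightarrow> (\<lambda>_. 0) | BL_Lifetime i \<Rightarrow> T i | BL_Offspring i \<Rightarrow> T i) \<omega>\<^sub>1))"
      then have A': "A' \<in> sets (points_history M (\<kappa> i) (s - T i \<omega>\<^sub>1))" by simp
      show "(LINT \<omega>:A'|M. \<Phi> t \<omega>\<^sub>1 \<omega>) = (LINT \<omega>:A'|M. \<Phi> s \<omega>\<^sub>1 \<omega>)"
        unfolding \<Phi>_def by (rule birth_compensation[OF _ A']) (use st in \<open>auto simp: c_def min_def\<close>)
    qed
  next
    show "children 0 \<omega> = 0" for \<omega>
    proof -
      have "real (children 0 \<omega>) = 0"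
        unfolding children_suminf by (simp add: births_empty)
      then show ?thesis by simp
    qed
    show "finite {i. real (card (births i t \<omega>)) \<noteq> 0}" for t \<omega>
      by (rule finite_subset[OF _ T_finite[of \<omega> t]]) (use births_empty in \<open>force simp: not_le[symmetric]\<close>)
  next
    show "finite {i. \<nu> * lived i t \<omega> \<noteq> 0}" for t \<omega> by (rule finite_lived)
  qed (use compensator_alive bound in \<open>auto intro: children_suminf finite_lived lived_F adapted_children borel_measurable_times\<close>)
qed

definition deaths :: "real \<Rightarrow> 'a \<Rightarrow> nat" where
  "deaths t \<omega> = card {i. T i \<omega> + L i \<omega> \<le> t}"

lemma finite_deaths [simp]: "finite {i. T i \<omega> + L i \<omega> \<le> t}"
  by (rule finite_subset[OF _ T_finite[of \<omega> t]]) (use less_imp_le[OF L_pos] in \<open>auto intro: order_trans[rotated]\<close>)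

lemma adapted_deaths: "adapted F deaths"
  unfolding adapted_def borel_measurable_nat_iff deaths_def[abs_def]
  using stopping_timeD[OF stopping_time_death] by (auto intro!: measurable_card simp: pred_def)

lemma has_intensity_deaths: "has_intensity M F deaths (\<lambda>s \<omega>. \<gamma> * alive s \<omega>)"
proof -
  let ?a = "\<lambda>i t \<omega>. indicator {..t} (T i \<omega> + L i \<omega>) :: real"
  let ?X = "\<lambda>i t \<omega>. ?a i t \<omega> - \<gamma> * lived i t \<omega>"
  have a_zero: "?a i t \<omega> = 0" if "t < T i \<omega>" for i t \<omega>
    using that L_pos[of i \<omega>] by (auto simp: indicator_def simp del: L_pos)
  have X_meas: "?X i t \<in> borel_measurable M" for i t
    unfolding lived_def by measurable
  have bound: "integrable M (?X i t)" "summable (\<lambda>i. \<integral>\<omega>. \<bar>?X i t \<omega>\<bar> \<partial>M)" if t: "0 \<le> t" for i t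
  proof -
    \<comment> \<open>A parent dies at most once, and its compensator is at most
      \<open>\<gamma> * t\<close>.\<close>
    let ?g = "\<lambda>(i::nat) (\<omega>::'a). ennreal (1 + \<gamma> * t)"
    have g: "(\<integral>\<^sup>+\<omega>. indicator {\<omega>\<in>space M. T i \<omega> \<le> t} \<omega> * ?g i \<omega> \<partial>M)
        \<le> ennreal (1 + \<gamma> * t) * ennreal (prob {\<omega>\<in>space M. T i \<omega> \<le> t})" for i
      by (subst nn_integral_multc) (simp_all add: emeasure_eq_measure mult.commute)
    have h: "ennreal \<bar>?X i t \<omega>\<bar> \<le> indicator {\<omega>. T i \<omega> \<le> t} \<omega> * ?g i \<omega>" for i \<omega>
    proof (cases "T i \<omega> \<le> t")
      case True
      have "0 \<le> ?a i t \<omega>" "?a i t \<omega> \<le> 1" by (auto simp: indicator_def)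
      moreover have "0 \<le> \<gamma> * lived i t \<omega>" "\<gamma> * lived i t \<omega> \<le> \<gamma> * t"
        using \<gamma> t less_imp_le[OF T_pos[of i \<omega>]] by (auto simp: lived_eq min_le_iff_disj intro!: mult_left_mono)
      ultimately have "\<bar>?X i t \<omega>\<bar> \<le> 1 + \<gamma> * t" by linarith
      then show ?thesis using True by (simp add: ennreal_leI)
    qed (simp add: a_zero lived_zero)
    have c: "0 \<le> 1 + \<gamma> * t" using \<gamma> t by simp
    show "integrable M (?X i t)" by (rule cluster_integrable[OF T X_meas g c h])
    show "summable (\<lambda>i. \<integral>\<omega>. \<bar>?X i t \<omega>\<bar> \<partial>M)" by (rule cluster_summable[OF T X_meas g c h])
  qed
  have fin: "finite {i. ?a i t \<omega> \<noteq> 0}" for t \<omega>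
    by (rule finite_subset[OF _ T_finite[of \<omega> t]]) (use a_zero in \<open>force simp: not_le[symmetric]\<close>)
  have count: "real (deaths t \<omega>) = (\<Sum>i. ?a i t \<omega>)" for t \<omega>
  proof -
    have "(\<Sum>i. ?a i t \<omega>) = (\<Sum>i\<in>{i. T i \<omega> + L i \<omega> \<le> t}. ?a i t \<omega>)"
      by (rule suminf_finite) auto
    then show ?thesis by (simp add: deaths_def)
  qed
  show ?thesis
  proof (rule has_intensity_cluster[OF filtration_F, where a="?a" and b="\<lambda>i t \<omega>. \<gamma> * lived i t \<omega>"])
    fix i s t A assume st: "0 \<le> s" "s \<le> t" and A: "A \<in> sets (F s)"
    then have t: "0 \<le> t" by simp
    \<comment> \<open>With the birth time taken from the first copy, this is the martingale of a
      single exponential time, run up to the age \<open>t - T i\<close>.\<close>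
    define \<Phi> where "\<Phi> t \<omega>\<^sub>1 \<omega>\<^sub>2 = indicator {..t - T i \<omega>\<^sub>1} (L i \<omega>\<^sub>2) - \<gamma> * max 0 (min (L i \<omega>\<^sub>2) (t - T i \<omega>\<^sub>1))"
      for t \<omega>\<^sub>1 \<omega>\<^sub>2
    have X: "?X i t = (\<lambda>\<omega>. \<Phi> t \<omega> \<omega>)" for t
      by (auto simp: \<Phi>_def lived_eq indicator_def)
    let ?k = "BL_Lifetime i"
    have [measurable]: "T i \<in> borel_measurable (E ?k)" by (rule T_E) simp
    note L_S[measurable]
    have \<Phi>: "(\<lambda>(\<omega>\<^sub>1, \<omega>\<^sub>2). \<Phi> t \<omega>\<^sub>1 \<omega>\<^sub>2) \<in> borel_measurable (E ?k \<Otimes>\<^sub>M S ?k)" for t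
      unfolding \<Phi>_def indicator_def atMost_iff by measurable
    show "(LINT \<omega>:A|M. ?X i t \<omega>) = (LINT \<omega>:A|M. ?X i s \<omega>)"
      unfolding X
    proof (rule F_martingale[OF \<Phi> \<Phi> _ _ A])
      show "integrable M (\<lambda>\<omega>. \<Phi> t \<omega> \<omega>)" "integrable M (\<lambda>\<omega>. \<Phi> s \<omega> \<omega>)"
        using bound(1)[OF t, of i] bound(1)[OF st(1), of i] unfolding X by auto
      fix \<omega>\<^sub>1 A' assume "A' \<in> sets ((case ?k of BL_Parents \<Rightarrow> points_history M T
         | BL_Lifetime i \<Rightarrow> points_history M (\<lambda>_::unit. L i) | BL_Offspring i \<Rightarrow> points_history M (\<kappa> i))
           (s - (case ?k of BL_Parents \<Rightarrow> (\<lambda>_. 0) | BL_Lifetime i \<Rightarrow> T i | BL_Offspring i \<Rightarrow> T i) \<omega>\<^sub>1))"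
      then have A': "A' \<in> sets (points_history M (\<lambda>_::unit. L i) (s - T i \<omega>\<^sub>1))" by simp
      show "(LINT \<omega>:A'|M. \<Phi> t \<omega>\<^sub>1 \<omega>) = (LINT \<omega>:A'|M. \<Phi> s \<omega>\<^sub>1 \<omega>)"
        unfolding \<Phi>_def by (rule exponential_martingale[OF L_exp \<gamma> L_pos _ A']) (use st in simp)
    qed
  next
    show "deaths 0 \<omega> = 0" for \<omega>
    proof -
      have "{i. T i \<omega> + L i \<omega> \<le> 0} = {}"
        using add_pos_pos[OF T_pos L_pos, of _ \<omega>] by (auto simp: not_le)
      then show ?thesis by (simp add: deaths_def)
    qed
    show "finite {i. \<gamma> * lived i t \<omega> \<noteq> 0}" for t \<omega> by (rule finite_lived)
    show "finite {i. ?a i t \<omega> \<noteq> 0}" for t \<omega> by (rule fin)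
  qed (use compensator_alive bound count in \<open>auto intro: lived_F adapted_deaths borel_measurable_times\<close>)
qed

end

lemma multivariate_counting_processI:
  fixes N :: "real \<Rightarrow> 'a \<Rightarrow> nat ^ 'd"
  assumes "filtration_on M F" "\<And>i. adapted F (\<lambda>t \<omega>. N t \<omega> $ i)"
    and "AE \<omega> in M. (\<forall>i. counting_path (\<lambda>t. N t \<omega> $ i)) \<and>
      (\<forall>i j t. i \<noteq> j \<longrightarrow> isCont (\<lambda>u. N u \<omega> $ i) t \<or> isCont (\<lambda>u. N u \<omega> $ j) t)"
  shows "multivariate_counting_process M F N"
  using assms unfolding multivariate_counting_process_def counting_process_def
  by (auto elim: eventually_mono)

lemma admissible_link_positive_parts: "admissible_link (positive_parts :: real ^ 'd \<Rightarrow> real ^ 'd)"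
  and lipschitz_positive_parts: "1-lipschitz_on UNIV (positive_parts :: real ^ 'd \<Rightarrow> real ^ 'd)"
proof -
  show lip: "1-lipschitz_on UNIV (positive_parts :: real ^ 'd \<Rightarrow> real ^ 'd)"
  proof (rule lipschitz_onI)
    fix x y :: "real ^ 'd"
    have "norm (positive_parts x - positive_parts y) \<le> norm (x - y)"
      by (rule norm_le_componentwise_cart) (auto simp: positive_parts_def)
    then show "dist (positive_parts x) (positive_parts y) \<le> 1 * dist x y" by (simp add: dist_norm)
  qed simp
  show "admissible_link (positive_parts :: real ^ 'd \<Rightarrow> real ^ 'd)"
    unfolding admissible_link_def using lip by (auto simp: positive_parts_def)
qed

section \<open>Assembling the three-dimensional process\<close>

context bartlett_lewis_clusters
begin

abbreviation parents :: "real \<Rightarrow> 'a \<Rightarrow> nat" where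
  "parents t \<omega> \<equiv> card {i. T i \<omega> \<le> t}"

definition process :: "real \<Rightarrow> 'a \<Rightarrow> nat ^ 3" where
  "process t \<omega> = vector [parents t \<omega>, children t \<omega>, deaths t \<omega>]"

abbreviation baseline :: "real ^ 3" where "baseline \<equiv> vector [\<mu>, 0, 0]"
abbreviation kernel :: "real \<Rightarrow> real ^ 3 ^ 3" where
  "kernel \<equiv> \<lambda>_. vector [vector [0, 0, 0], vector [\<nu>, 0, - \<nu>], vector [\<gamma>, 0, - \<gamma>]]"

lemma process_nth [simp]:
  "process t \<omega> $ 1 = parents t \<omega>" "process t \<omega> $ 2 = children t \<omega>" "process t \<omega> $ 3 = deaths t \<omega>"
  by (simp_all add: process_def)

text \<open>Each coincidence is solved for a time with diffuse law, equated with a quantity from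
  outside its source. Birth against death is solved for the lifetime, which also covers a birth and
  a death in the same cluster. Births of one parent do not appear: strict monotonicity of
  \<open>\<kappa> i\<close> separates them.\<close>

lemma AE_distinct:
  "AE \<omega> in M. (\<forall>i j l. T j \<omega> \<noteq> T i \<omega> + \<kappa> i l \<omega>) \<and> (\<forall>i j. T j \<omega> \<noteq> T i \<omega> + L i \<omega>) \<and>
     (\<forall>i j l. T i \<omega> + \<kappa> i l \<omega> \<noteq> T j \<omega> + L j \<omega>) \<and>
     (\<forall>i j l m. i \<noteq> j \<longrightarrow> T i \<omega> + \<kappa> i l \<omega> \<noteq> T j \<omega> + \<kappa> j m \<omega>) \<and>
     (\<forall>i j. i \<noteq> j \<longrightarrow> T i \<omega> + L i \<omega> \<noteq> T j \<omega> + L j \<omega>)"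
proof -
  have K: "AE \<omega> in M. \<kappa> i l \<omega> \<noteq> V \<omega>" if "V \<in> borel_measurable (E (BL_Offspring i))" for i l V
    by (rule independent_pair.AE_neq[OF pair \<kappa>_S that poisson_points_diffuse[OF \<kappa> \<nu>]])
  have D: "AE \<omega> in M. L i \<omega> \<noteq> V \<omega>" if "V \<in> borel_measurable (E (BL_Lifetime i))" for i V
    by (rule independent_pair.AE_neq[OF pair L_S that distributed_diffuse[OF L_exp]])
  have "AE \<omega> in M. \<kappa> i l \<omega> \<noteq> T j \<omega> - T i \<omega>" for i j l
    by (intro K borel_measurable_diff T_E) auto
  moreover have "AE \<omega> in M. L i \<omega> \<noteq> T j \<omega> - T i \<omega>" for i j
    by (intro D borel_measurable_diff T_E) auto
  moreover have "AE \<omega> in M. L j \<omega> \<noteq> T i \<omega> + \<kappa> i l \<omega> - T j \<omega>" for i j l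
    by (intro D borel_measurable_diff borel_measurable_add T_E \<kappa>_E) auto
  moreover have "AE \<omega> in M. i \<noteq> j \<longrightarrow> \<kappa> i l \<omega> \<noteq> T j \<omega> + \<kappa> j m \<omega> - T i \<omega>" for i j l m
  proof (cases "i = j")
    case False
    then have "AE \<omega> in M. \<kappa> i l \<omega> \<noteq> T j \<omega> + \<kappa> j m \<omega> - T i \<omega>"
      by (intro K borel_measurable_diff borel_measurable_add T_E \<kappa>_E) auto
    then show ?thesis by eventually_elim simp
  qed simp
  moreover have "AE \<omega> in M. i \<noteq> j \<longrightarrow> L i \<omega> \<noteq> T j \<omega> + L j \<omega> - T i \<omega>" for i j
  proof (cases "i = j")
    case False
    then have "AE \<omega> in M. L i \<omega> \<noteq> T j \<omega> + L j \<omega> - T i \<omega>"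
      by (intro D borel_measurable_diff borel_measurable_add T_E L_E) auto
    then show ?thesis by eventually_elim simp
  qed simp
  ultimately have "AE \<omega> in M. (\<forall>i j l. \<kappa> i l \<omega> \<noteq> T j \<omega> - T i \<omega>) \<and> (\<forall>i j. L i \<omega> \<noteq> T j \<omega> - T i \<omega>) \<and>
     (\<forall>i j l. L j \<omega> \<noteq> T i \<omega> + \<kappa> i l \<omega> - T j \<omega>) \<and>
     (\<forall>i j l m. i \<noteq> j \<longrightarrow> \<kappa> i l \<omega> \<noteq> T j \<omega> + \<kappa> j m \<omega> - T i \<omega>) \<and>
     (\<forall>i j. i \<noteq> j \<longrightarrow> L i \<omega> \<noteq> T j \<omega> + L j \<omega> - T i \<omega>)"
    by (simp add: AE_all_countable)
  then show ?thesis
    by eventually_elim (simp add: eq_diff_eq add.commute, metis add.commute)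
qed

lemma multivariate_counting_process: "multivariate_counting_process M F process"
proof (rule multivariate_counting_processI[OF filtration_F])
  show "adapted F (\<lambda>t \<omega>. process t \<omega> $ i)" for i
    using exhaust_3[of i] adapted_parents adapted_children adapted_deaths by auto
  show "AE \<omega> in M. (\<forall>i. counting_path (\<lambda>t. process t \<omega> $ i)) \<and>
      (\<forall>i j t. i \<noteq> j \<longrightarrow> isCont (\<lambda>u. process u \<omega> $ i) t \<or> isCont (\<lambda>u. process u \<omega> $ j) t)"
    using AE_distinct
  proof eventually_elim
    case (elim \<omega>)
    let ?x1 = "\<lambda>i. T i \<omega>" and ?x2 = "\<lambda>q. T (fst q) \<omega> + \<kappa> (fst q) (snd q) \<omega>" and ?x3 = "\<lambda>i. T i \<omega> + L i \<omega>"
    let ?I2 = "{q. \<kappa> (fst q) (snd q) \<omega> \<le> L (fst q) \<omega>}"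
    have inj2: "inj_on ?x2 ?I2"
    proof (rule inj_onI)
      fix q q' assume eq: "?x2 q = ?x2 q'"
      then have "fst q = fst q'" using elim by metis
      moreover from this eq have "\<kappa> (fst q) (snd q) \<omega> = \<kappa> (fst q) (snd q') \<omega>" by simp
      then have "snd q = snd q'"
        using strict_mono_eq[OF poisson_pointsD(1)[OF \<kappa>, of "fst q" \<omega>], of "snd q" "snd q'"] by simp
      ultimately show "q = q'" by (rule prod_eqI)
    qed
    have inj3: "inj_on ?x3 UNIV"
    proof (rule inj_onI, rule ccontr)
      fix i j assume "?x3 i = ?x3 j" "i \<noteq> j"
      then show False using elim by blast
    qed
    have inj1: "inj_on ?x1 UNIV" using strict_mono_imp_inj_on[OF T_strict_mono] .
    have c1: "counting_path (\<lambda>t. parents t \<omega>)"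
      using counting_path_points[OF inj1] by simp
    have c2: "counting_path (\<lambda>t. children t \<omega>)"
      unfolding children_def by (rule counting_path_points[OF inj2]) (auto intro: finite_children[unfolded mem_Collect_eq] add_pos_pos)
    have c3: "counting_path (\<lambda>t. deaths t \<omega>)"
      using counting_path_points[OF inj3] by (simp add: deaths_def add_pos_pos)
    have i1: "isCont (\<lambda>t. parents t \<omega>) t" if "t \<notin> range ?x1" for t
      using isCont_points[of UNIV ?x1 t] that by simp
    have i2: "isCont (\<lambda>t. children t \<omega>) t" if "t \<notin> ?x2 ` ?I2" for t
      unfolding children_def by (rule isCont_points[OF finite_children that])
    have i3: "isCont (\<lambda>t. deaths t \<omega>) t" if "t \<notin> range ?x3" for t
      unfolding deaths_def using isCont_points[of UNIV ?x3 t] that by simp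
    have d12: "t \<notin> range ?x1 \<or> t \<notin> ?x2 ` ?I2" and d13: "t \<notin> range ?x1 \<or> t \<notin> range ?x3"
      and d23: "t \<notin> ?x2 ` ?I2 \<or> t \<notin> range ?x3" for t
    proof -
      have "?x1 j \<noteq> ?x2 q" "?x1 j \<noteq> ?x3 i" "?x2 q \<noteq> ?x3 j" for i j q
        by (simp_all only: elim not_False_eq_True)
      then show "t \<notin> range ?x1 \<or> t \<notin> ?x2 ` ?I2" "t \<notin> range ?x1 \<or> t \<notin> range ?x3"
        "t \<notin> ?x2 ` ?I2 \<or> t \<notin> range ?x3"
        unfolding image_iff by metis+
    qed
    define f where "f i = (\<lambda>u. process u \<omega> $ i)" for i
    have f: "isCont (f 1) t \<or> isCont (f 2) t" "isCont (f 1) t \<or> isCont (f 3) t" "isCont (f 2) t \<or> isCont (f 3) t" for t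
      using i1[of t] i2[of t] i3[of t] d12[of t] d13[of t] d23[of t] unfolding f_def process_nth by blast+
    have "isCont (f i) t \<or> isCont (f j) t" if "i \<noteq> j" for i j t
      using f[of t] exhaust_3[of i] exhaust_3[of j] that by metis
    moreover have "counting_path (\<lambda>t. process t \<omega> $ i)" for i
      using exhaust_3[of i] c1 c2 c3 by auto
    ultimately show ?case unfolding f_def by blast
  qed
qed

text \<open>Parents born before \<open>t\<close> minus parents dead before \<open>t\<close> are the
  parents alive. The negative kernel entries thus combine with the positive ones to a multiple of
  \<open>alive\<close>, at every sample point.\<close>

lemma drive: "hawkes_drive baseline kernel process t \<omega> = vector [\<mu>, \<nu> * alive t \<omega>, \<gamma> * alive t \<omega>]"
proof -
  have zero: "(LINT s:{0..<t}|N. 0) = (0::real)" for N :: "real measure"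
    by (simp add: set_lebesgue_integral_def)
  have fin: "finite {i. T i \<omega> + L i \<omega> < t}" by (rule finite_subset[OF _ finite_deaths[of \<omega> t]]) auto
  have p: "(LINT s:{0..<t}|interval_measure (\<lambda>u. real (parents u \<omega>)). c) = c * real (card {i. T i \<omega> < t})" for c :: real
    using set_integral_points[of UNIV "\<lambda>i. T i \<omega>" "\<lambda>_. c" t] by simp
  have d: "(LINT s:{0..<t}|interval_measure (\<lambda>u. real (deaths u \<omega>)). c) = c * real (card {i. T i \<omega> + L i \<omega> < t})" for c :: real
    using set_integral_points[of UNIV "\<lambda>i. T i \<omega> + L i \<omega>" "\<lambda>_. c" t] by (simp add: deaths_def add_pos_pos)
  \<comment> \<open>Lifetimes are positive, so whoever has died before \<open>t\<close> was born
    before \<open>t\<close>.\<close>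
  have "{i. T i \<omega> < t} = {i. T i \<omega> < t \<and> t \<le> T i \<omega> + L i \<omega>} \<union> {i. T i \<omega> + L i \<omega> < t}"
    using less_imp_le[OF L_pos, of _ \<omega>] by (auto simp: not_le) (smt (verit) L_pos)
  moreover have "finite {i. T i \<omega> < t \<and> t \<le> T i \<omega> + L i \<omega>}"
    by (rule finite_subset[OF _ T_finite_less[of \<omega> t]]) auto
  ultimately have "card {i. T i \<omega> < t} = card {i. T i \<omega> < t \<and> t \<le> T i \<omega> + L i \<omega>} + card {i. T i \<omega> + L i \<omega> < t}"
    using fin by (subst card_Un_disjoint[symmetric]) auto
  then have alive: "alive t \<omega> = real (card {i. T i \<omega> < t}) - real (card {i. T i \<omega> + L i \<omega> < t})"
    by (simp add: alive_def)
  show ?thesis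
    unfolding vec_eq_iff forall_3
    by (simp add: hawkes_drive_def sum_3 zero p d alive right_diff_distrib)
qed

text \<open>All components are nonnegative because \<open>alive\<close> is a cardinality, so the
  linear and the nonlinear representation share the same intensity.\<close>

lemma drive_nonneg: "positive_parts (hawkes_drive baseline kernel process t \<omega>) = hawkes_drive baseline kernel process t \<omega>"
  unfolding drive vec_eq_iff forall_3 using \<mu> \<nu> \<gamma> by (simp add: positive_parts_def alive_def)

lemma has_intensity: "has_intensity M F (\<lambda>t \<omega>. process t \<omega> $ i) (\<lambda>t \<omega>. hawkes_drive baseline kernel process t \<omega> $ i)"
  unfolding drive
  using exhaust_3[of i] has_intensity_parents has_intensity_children has_intensity_deaths by auto

lemma linear_hawkes: "linear_hawkes M F baseline kernel process"
  unfolding linear_hawkes_def using multivariate_counting_process has_intensity by blast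

lemma nonlinear_hawkes: "nonlinear_hawkes M F positive_parts baseline kernel process"
  unfolding nonlinear_hawkes_def drive_nonneg
  using multivariate_counting_process has_intensity admissible_link_positive_parts by blast

end

section \<open>Realising a given Bartlett--Lewis process by clusters\<close>

lemma (in prob_space) distributed_modify:
  fixes X :: "'a \<Rightarrow> real"
  assumes X: "distributed M lborel X f" and pos: "AE \<omega> in M. 0 < X \<omega>"
  shows "distributed M lborel (\<lambda>\<omega>. if X \<omega> \<le> 0 then 1 else X \<omega>) f"
proof -
  have [measurable]: "X \<in> borel_measurable M" using distributed_measurable[OF X] by simp
  have "distr M lborel (\<lambda>\<omega>. if X \<omega> \<le> 0 then 1 else X \<omega>) = distr M lborel X"
    by (rule distr_cong_AE) (use pos in \<open>auto elim!: eventually_mono\<close>)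
  then show ?thesis using X by (simp add: distributed_def)
qed

lemma sigma_algebra_generated_events: "sigma_algebra (space M) (generated_events M X)"
  unfolding generated_events_def by (rule sigma_algebra_sigma_sets) auto

lemma (in prob_space) null_completion_modify:
  fixes X :: "'a \<Rightarrow> real"
  assumes [measurable]: "X \<in> borel_measurable M" and X: "{\<omega>\<in>space M. X \<omega> \<le> u} \<in> G" and pos: "AE \<omega> in M. 0 < X \<omega>"
  shows "{\<omega>\<in>space M. (if X \<omega> \<le> 0 then 1 else X \<omega>) \<le> u} \<in> null_completion M G"
  by (rule null_completionI[OF _ X]) (use pos in \<open>auto elim!: eventually_mono\<close>)

theorem (in prob_space) bartlett_lewis_hawkes:
  assumes pos: "0 < \<mu>" "0 < \<gamma>" "0 < \<nu>" and X: "bartlett_lewis M \<mu> \<gamma> \<nu> X"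
  defines "m \<equiv> vector [\<mu>, 0, 0] :: real ^ 3"
    and "\<phi> \<equiv> (\<lambda>_. vector [vector [0, 0, 0], vector [\<nu>, 0, - \<nu>], vector [\<gamma>, 0, - \<gamma>]]) :: real \<Rightarrow> real ^ 3 ^ 3"
  shows "\<exists>F N. linear_hawkes M F m \<phi> N \<and> (AE \<omega> in M. \<forall>t\<ge>0. X t \<omega> = N t \<omega> $ 1 + N t \<omega> $ 2) \<and>
    nonlinear_hawkes M F positive_parts m \<phi> N \<and>
    (AE \<omega> in M. \<forall>t\<ge>0. hawkes_drive m \<phi> N t \<omega> = positive_parts (hawkes_drive m \<phi> N t \<omega>)) \<and>
    (\<forall>x i. 0 \<le> (positive_parts x :: real ^ 3) $ i) \<and>
    (\<exists>C. C-lipschitz_on UNIV (positive_parts :: real ^ 3 \<Rightarrow> real ^ 3))"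
proof -
  obtain P L0 K where P: "poisson_process M \<mu> P"
    and L0: "\<And>i. distributed M lborel (L0 i) (exponential_density \<gamma>)"
    and K: "\<And>i. poisson_process M \<nu> (K i)"
    and ind: "indep_sets (\<lambda>k. case k of BL_Parents \<Rightarrow> generated_events M P
         | BL_Lifetime i \<Rightarrow> generated_events M (\<lambda>_ :: unit. L0 i)
         | BL_Offspring i \<Rightarrow> generated_events M (K i)) UNIV"
    and X: "\<And>\<omega> t. \<omega> \<in> space M \<Longrightarrow> 0 \<le> t \<Longrightarrow> X t \<omega> = P t \<omega> +
       (\<Sum>i<P t \<omega>. K i (min (t - arrival_time (\<lambda>u. P u \<omega>) i) (L0 i \<omega>)) \<omega>)"
    using X unfolding bartlett_lewis_def by blast
  obtain T where T: "poisson_points M \<mu> T"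
    "\<And>i u. {\<omega>\<in>space M. T i \<omega> \<le> u} \<in> null_completion M (generated_events M P)"
    and TP: "AE \<omega> in M. (\<forall>t i. T i \<omega> \<le> t \<longleftrightarrow> i < P t \<omega>) \<and> (\<forall>i. T i \<omega> = arrival_time (\<lambda>t. P t \<omega>) i)"
    using poisson_process_points[OF P pos(1)] by blast
  obtain \<kappa> where \<kappa>: "\<And>i. poisson_points M \<nu> (\<kappa> i)"
    "\<And>i l u. {\<omega>\<in>space M. \<kappa> i l \<omega> \<le> u} \<in> null_completion M (generated_events M (K i))"
    and \<kappa>K: "\<And>i. AE \<omega> in M. (\<forall>t l. \<kappa> i l \<omega> \<le> t \<longleftrightarrow> l < K i t \<omega>)"
  proof -
    from choice[OF allI[OF poisson_process_points[OF K pos(3)]]] obtain \<kappa> where \<kappa>: "\<forall>i. poisson_points M \<nu> (\<kappa> i) \<and>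
      (\<forall>l u. {\<omega>\<in>space M. \<kappa> i l \<omega> \<le> u} \<in> null_completion M (generated_events M (K i))) \<and>
      (AE \<omega> in M. (\<forall>t l. \<kappa> i l \<omega> \<le> t \<longleftrightarrow> l < K i t \<omega>) \<and> (\<forall>l. \<kappa> i l \<omega> = arrival_time (\<lambda>t. K i t \<omega>) l))" ..
    show thesis
    proof (rule that)
      fix i
      show "poisson_points M \<nu> (\<kappa> i)" using \<kappa> by blast
      show "{\<omega>\<in>space M. \<kappa> i l \<omega> \<le> u} \<in> null_completion M (generated_events M (K i))" for l u using \<kappa> by blast
      have "AE \<omega> in M. (\<forall>t l. \<kappa> i l \<omega> \<le> t \<longleftrightarrow> l < K i t \<omega>) \<and> (\<forall>l. \<kappa> i l \<omega> = arrival_time (\<lambda>t. K i t \<omega>) l)"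
        using \<kappa> by blast
      then show "AE \<omega> in M. (\<forall>t l. \<kappa> i l \<omega> \<le> t \<longleftrightarrow> l < K i t \<omega>)" by eventually_elim blast
    qed
  qed
  \<comment> \<open>Exponential variables are positive almost surely; any positive value, here
    \<open>1\<close>, repairs the remaining sample points.\<close>
  define L where "L i \<omega> = (if L0 i \<omega> \<le> 0 then 1 else L0 i \<omega>)" for i \<omega>
  have L0_meas [measurable]: "L0 i \<in> borel_measurable M" for i
    using distributed_measurable[OF L0] by simp
  have L0_pos: "AE \<omega> in M. 0 < L0 i \<omega>" for i
  proof -
    have "prob {\<omega>\<in>space M. 0 < L0 i \<omega>} = 1"
      using exponential_distributedD_gt[OF L0[of i], of 0] pos by simp
    then show ?thesis by (simp add: prob_Collect_eq_1)
  qed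
  \<comment> \<open>Completion makes room for the repaired \<open>T\<close>, \<open>\<kappa>\<close>
    and \<open>L\<close>, whose events agree almost surely with events of the original
    sources.\<close>
  define \<S> where "\<S> k = null_completion M (case k of BL_Parents \<Rightarrow> generated_events M P
         | BL_Lifetime i \<Rightarrow> generated_events M (\<lambda>_ :: unit. L0 i)
         | BL_Offspring i \<Rightarrow> generated_events M (K i))" for k
  interpret bartlett_lewis_clusters M \<S> T \<mu> L \<kappa> \<gamma> \<nu>
  proof (intro bartlett_lewis_clusters.intro clusters.intro sources.intro sources_axioms.intro
      clusters_axioms.intro bartlett_lewis_clusters_axioms.intro prob_space_axioms)
    show "indep_sets \<S> UNIV" unfolding \<S>_def by (rule indep_sets_null_completion[OF ind])
    show "sigma_algebra (space M) (\<S> k)" for k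
      unfolding \<S>_def
      by (intro sigma_algebra_null_completion) (auto split: bl_source.split intro: sigma_algebra_generated_events)
    show "{\<omega>\<in>space M. T i \<omega> \<le> u} \<in> \<S> BL_Parents" for i u using T(2) by (simp add: \<S>_def)
    show "{\<omega>\<in>space M. \<kappa> i l \<omega> \<le> u} \<in> \<S> (BL_Offspring i)" for i l u using \<kappa>(2) by (simp add: \<S>_def)
    show "distributed M lborel (L i) (exponential_density \<gamma>)" for i
      unfolding L_def[abs_def] by (rule distributed_modify[OF L0 L0_pos])
    show "{\<omega>\<in>space M. L i \<omega> \<le> u} \<in> \<S> (BL_Lifetime i)" for i u
    proof -
      have "L0 i -` {..u} \<inter> space M \<in> generated_events M (\<lambda>_::unit. L0 i)"
        unfolding generated_events_def by (intro sigma_sets.Basic CollectI exI[of _ "()"] exI[of _ "{..u}"]) auto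
      then have "{\<omega>\<in>space M. L0 i \<omega> \<le> u} \<in> generated_events M (\<lambda>_::unit. L0 i)"
        by (rule back_subst[of "\<lambda>A. A \<in> _"]) auto
      from null_completion_modify[OF L0_meas this L0_pos] show ?thesis by (simp add: \<S>_def L_def)
    qed
    show "sets ((case k of BL_Parents \<Rightarrow> points_history M T | BL_Lifetime i \<Rightarrow> points_history M (\<lambda>_::unit. L i)
       | BL_Offspring i \<Rightarrow> points_history M (\<kappa> i)) a) \<subseteq> sets ((case k of BL_Parents \<Rightarrow> points_history M T | BL_Lifetime i \<Rightarrow> points_history M (\<lambda>_::unit. L i)
       | BL_Offspring i \<Rightarrow> points_history M (\<kappa> i)) b)" if "a \<le> b" for k a b
      by (cases k) (simp_all add: points_history_mono[OF that])
  qed (use T \<kappa> pos in \<open>auto simp: L_def split: bl_source.split\<close>)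
  have "AE \<omega> in M. (\<forall>i t l. \<kappa> i l \<omega> \<le> t \<longleftrightarrow> l < K i t \<omega>) \<and> (\<forall>i. 0 < L0 i \<omega>)"
    using \<kappa>K L0_pos by (simp add: AE_all_countable)
  with TP AE_space have "AE \<omega> in M. \<forall>t\<ge>0. X t \<omega> = process t \<omega> $ 1 + process t \<omega> $ 2"
  proof eventually_elim
    case (elim \<omega>)
    show ?case
    proof (intro allI impI)
      fix t :: real assume t: "0 \<le> t"
      have LL: "L i \<omega> = L0 i \<omega>" for i using elim by (simp add: L_def not_le[symmetric])
      have TT: "{i. T i \<omega> \<le> t} = {..<P t \<omega>}" using elim by auto
      \<comment> \<open>The points of \<open>\<kappa> i\<close> up to a given age form an initial
        segment of the indices, whose length is the value of \<open>K i\<close> at that age.\<close>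
      have births: "card (births i t \<omega>) = K i (min (t - arrival_time (\<lambda>u. P u \<omega>) i) (L0 i \<omega>)) \<omega>" for i
      proof -
        have "births i t \<omega> = {..<K i (min (t - arrival_time (\<lambda>u. P u \<omega>) i) (L0 i \<omega>)) \<omega>}"
        proof (rule set_eqI)
          fix l
          have arr: "arrival_time (\<lambda>u. P u \<omega>) i = T i \<omega>" using elim by simp
          have "l \<in> births i t \<omega> \<longleftrightarrow> \<kappa> i l \<omega> \<le> min (t - T i \<omega>) (L0 i \<omega>)"
            by (simp add: births_eq LL min.commute)
          also have "\<dots> \<longleftrightarrow> l < K i (min (t - T i \<omega>) (L0 i \<omega>)) \<omega>" using elim by blast
          finally show "l \<in> births i t \<omega> \<longleftrightarrow> l \<in> {..<K i (min (t - arrival_time (\<lambda>u. P u \<omega>) i) (L0 i \<omega>)) \<omega>}"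
            by (simp only: arr lessThan_iff)
        qed
        then show ?thesis by simp
      qed
      have "real (children t \<omega>) = (\<Sum>i\<in>{i. T i \<omega> \<le> t}. real (card (births i t \<omega>)))"
        unfolding children_suminf by (rule suminf_finite) (auto simp: births_empty)
      also have "\<dots> = real (\<Sum>i<P t \<omega>. K i (min (t - arrival_time (\<lambda>u. P u \<omega>) i) (L0 i \<omega>)) \<omega>)"
        unfolding TT births by simp
      finally have "children t \<omega> = (\<Sum>i<P t \<omega>. K i (min (t - arrival_time (\<lambda>u. P u \<omega>) i) (L0 i \<omega>)) \<omega>)"
        by (simp only: of_nat_eq_iff)
      then show "X t \<omega> = process t \<omega> $ 1 + process t \<omega> $ 2"
        by (simp add: X[OF elim(2) t] TT)
    qed
  qed
  note X_eq = this
  show ?thesis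
    unfolding m_def \<phi>_def
  proof (intro exI[of _ F] exI[of _ process] conjI)
    show "\<exists>C. C-lipschitz_on UNIV (positive_parts :: real ^ 3 \<Rightarrow> real ^ 3)"
      using lipschitz_positive_parts by blast
    show "AE \<omega> in M. \<forall>t\<ge>0. hawkes_drive baseline kernel process t \<omega> =
        positive_parts (hawkes_drive baseline kernel process t \<omega>)"
      by (simp only: drive_nonneg) simp
    show "\<forall>x i. 0 \<le> (positive_parts x :: real ^ 3) $ i"
      by (simp add: positive_parts_def)
  qed (rule linear_hawkes X_eq nonlinear_hawkes)+
qed

section \<open>Poisson numbers of marks\<close>

text \<open>The increasing enumeration of the naturals other than \<open>j\<close>; composing a
  sequence with it deletes the entry at \<open>j\<close>.\<close>

definition skip :: "nat \<Rightarrow> nat \<Rightarrow> nat" where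
  "skip j k = (if k < j then k else Suc k)"

lemma skip_neq: "skip j k \<noteq> j"
  by (auto simp: skip_def)

lemma inj_skip: "inj (skip j)"
  by (auto simp: skip_def inj_on_def split: if_splits)

abbreviation marks_space :: "(nat \<times> (nat \<Rightarrow> real)) measure" where
  "marks_space \<equiv> count_space UNIV \<Otimes>\<^sub>M PiM UNIV (\<lambda>_. borel)"

text \<open>A family of \<open>C\<close> points \<open>D 0, \<dots>, D (C - 1)\<close> is seen up to time \<open>a\<close>: an event depends only on
  the points before \<open>a\<close> if deleting a point after \<open>a\<close> does not change it.\<close>

definition marks_history :: "'a measure \<Rightarrow> ('a \<Rightarrow> nat) \<Rightarrow> (nat \<Rightarrow> 'a \<Rightarrow> real) \<Rightarrow> real \<Rightarrow> 'a set set" where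
  "marks_history M C D a = {A. \<exists>B\<in>sets marks_space. A = {\<omega>\<in>space M. (C \<omega>, \<lambda>j. D j \<omega>) \<in> B} \<and>
     (\<forall>n d j. j \<le> n \<longrightarrow> a < d j \<longrightarrow> ((Suc n, d) \<in> B \<longleftrightarrow> (n, \<lambda>k. d (skip j k)) \<in> B))}"

lemma marks_historyI:
  "B \<in> sets marks_space \<Longrightarrow>
   (\<And>n d j. j \<le> n \<Longrightarrow> a < d j \<Longrightarrow> (Suc n, d) \<in> B \<longleftrightarrow> (n, \<lambda>k. d (skip j k)) \<in> B) \<Longrightarrow>
   {\<omega>\<in>space M. (C \<omega>, \<lambda>j. D j \<omega>) \<in> B} \<in> marks_history M C D a"
  unfolding marks_history_def by blast

lemma marks_historyE:
  assumes "A \<in> marks_history M C D a"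
  obtains B where "B \<in> sets marks_space" "A = {\<omega>\<in>space M. (C \<omega>, \<lambda>j. D j \<omega>) \<in> B}"
    "\<And>n d j. j \<le> n \<Longrightarrow> a < d j \<Longrightarrow> (Suc n, d) \<in> B \<longleftrightarrow> (n, \<lambda>k. d (skip j k)) \<in> B"
  using assms unfolding marks_history_def by blast

lemma space_marks [simp]: "space marks_space = UNIV"
  by (simp add: space_pair_measure space_PiM)

text \<open>Invariance under deletion is an equivalence, so it passes to complements and unions of
  the witnesses \<open>B\<close>.\<close>

lemma sigma_algebra_marks_history: "sigma_algebra (space M) (marks_history M C D a)"
  unfolding sigma_algebra_iff2
proof (intro conjI ballI allI impI)
  show "marks_history M C D a \<subseteq> Pow (space M)" by (auto simp: marks_history_def)
  show "{} \<in> marks_history M C D a" using marks_historyI[of "{}"] by simp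
next
  fix A assume "A \<in> marks_history M C D a"
  then obtain B where B: "B \<in> sets marks_space" "A = {\<omega>\<in>space M. (C \<omega>, \<lambda>j. D j \<omega>) \<in> B}"
    "\<And>n d j. j \<le> n \<Longrightarrow> a < d j \<Longrightarrow> (Suc n, d) \<in> B \<longleftrightarrow> (n, \<lambda>k. d (skip j k)) \<in> B"
    by (rule marks_historyE) blast
  have "{\<omega>\<in>space M. (C \<omega>, \<lambda>j. D j \<omega>) \<in> space marks_space - B} \<in> marks_history M C D a"
    by (rule marks_historyI) (use B in \<open>auto intro: sets.compl_sets simp del: space_marks, simp_all\<close>)
  then show "space M - A \<in> marks_history M C D a"
    by (rule back_subst[of "\<lambda>A. A \<in> _"]) (auto simp: B(2))
next
  fix A :: "nat \<Rightarrow> 'a set" assume "range A \<subseteq> marks_history M C D a"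
  then have A: "A i \<in> marks_history M C D a" for i by auto
  define Q where "Q i B \<longleftrightarrow> B \<in> sets marks_space \<and> A i = {\<omega>\<in>space M. (C \<omega>, \<lambda>j. D j \<omega>) \<in> B} \<and>
    (\<forall>n d j. j \<le> n \<longrightarrow> a < d j \<longrightarrow> ((Suc n, d) \<in> B \<longleftrightarrow> (n, \<lambda>k. d (skip j k)) \<in> B))" for i B
  have "\<exists>B. Q i B" for i
    by (rule marks_historyE[OF A[of i]]) (auto simp: Q_def)
  then obtain B where Q: "\<And>i. Q i (B i)" by metis
  have "{\<omega>\<in>space M. (C \<omega>, \<lambda>j. D j \<omega>) \<in> (\<Union>i. B i)} \<in> marks_history M C D a"
    by (rule marks_historyI) (use Q in \<open>auto simp: Q_def\<close>)
  then show "\<Union>(range A) \<in> marks_history M C D a"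
    by (rule back_subst[of "\<lambda>A. A \<in> _"]) (use Q in \<open>auto simp: Q_def\<close>)
qed

text \<open>A mark after \<open>b\<close> is also after \<open>a\<close>, so fewer deletions are
  tested at the later age.\<close>

lemma marks_history_mono: "a \<le> b \<Longrightarrow> marks_history M C D a \<subseteq> marks_history M C D b"
proof
  fix A assume "a \<le> b" and A: "A \<in> marks_history M C D a"
  from A obtain B where B: "B \<in> sets marks_space" "A = {\<omega>\<in>space M. (C \<omega>, \<lambda>j. D j \<omega>) \<in> B}"
    "\<And>n d j. j \<le> n \<Longrightarrow> a < d j \<Longrightarrow> (Suc n, d) \<in> B \<longleftrightarrow> (n, \<lambda>k. d (skip j k)) \<in> B"
    by (rule marks_historyE) blast
  show "A \<in> marks_history M C D b"
    unfolding B(2) by (rule marks_historyI[OF B(1)]) (use \<open>a \<le> b\<close> in \<open>auto intro!: B(3)\<close>)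
qed

section \<open>Independence among the marks of one cluster\<close>

locale poisson_marks = prob_space M for M :: "'a measure" +
  fixes C :: "'a \<Rightarrow> nat" and D :: "nat \<Rightarrow> 'a \<Rightarrow> real" and \<nu> :: real and f :: "real \<Rightarrow> real"
  assumes \<nu>: "0 < \<nu>" and C [measurable]: "C \<in> measurable M (count_space UNIV)"
    and C_distr: "distr M (count_space UNIV) C = measure_pmf (poisson_pmf \<nu>)"
    and D_distr: "\<And>j. distributed M lborel (D j) f"
    and D_pos: "\<And>j \<omega>. 0 < D j \<omega>"
    and marks_indep: "indep_sets (\<lambda>k. case k of None \<Rightarrow> {C -` A \<inter> space M |A. A \<in> UNIV}
       | Some j \<Rightarrow> {D j -` A \<inter> space M |A. A \<in> sets borel}) (UNIV :: nat option set)"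
begin

abbreviation gen :: "nat option \<Rightarrow> 'a set set" where
  "gen k \<equiv> (case k of None \<Rightarrow> {C -` A \<inter> space M |A. A \<in> UNIV}
       | Some j \<Rightarrow> {D j -` A \<inter> space M |A. A \<in> sets borel})"

definition cdf_marks :: "real \<Rightarrow> real" where
  "cdf_marks a = prob {\<omega>\<in>space M. D 0 \<omega> \<le> a}"

definition arrived :: "real \<Rightarrow> 'a \<Rightarrow> nat" where
  "arrived a \<omega> = card {j. j < C \<omega> \<and> D j \<omega> \<le> a}"

lemma D_measurable [measurable]: "D j \<in> borel_measurable M"
  using distributed_measurable[OF D_distr] by simp

lemma gen_events: "gen k \<subseteq> events"
  by (auto split: option.splits)

lemma Int_stable_gen: "Int_stable (gen k)"
proof (rule Int_stableI)
  fix a b assume ab: "a \<in> gen k" "b \<in> gen k"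
  show "a \<inter> b \<in> gen k"
  proof (cases k)
    case None
    with ab obtain A A' where "a = C -` A \<inter> space M" "b = C -` A' \<inter> space M" by auto
    then have "a \<inter> b = C -` (A \<inter> A') \<inter> space M" by auto
    then show ?thesis unfolding None option.case mem_Collect_eq by blast
  next
    case (Some j)
    with ab obtain A A' where A: "a = D j -` A \<inter> space M" "b = D j -` A' \<inter> space M" "A \<in> sets borel" "A' \<in> sets borel"
      by auto
    then have "a \<inter> b = D j -` (A \<inter> A') \<inter> space M" by auto
    moreover have "A \<inter> A' \<in> sets borel" using A by auto
    ultimately show ?thesis unfolding Some option.case mem_Collect_eq by blast
  qed
qed

lemma distr_D: "distr M borel (D j) = density lborel f"
proof -
  have "distr M borel (D j) = distr M lborel (D j)" by (rule distr_cong) auto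
  then show ?thesis using D_distr[of j] by (simp add: distributed_def)
qed

text \<open>The marks are independent with a common law, so any injective selection of them is
  distributed like the whole family. In particular deleting a mark does not change the distribution,
  on which Mecke's formula relies.\<close>

lemma distr_D_family:
  fixes h :: "nat \<Rightarrow> nat"
  assumes "inj h"
  shows "distr M (PiM UNIV (\<lambda>_. borel)) (\<lambda>\<omega> k. D (h k) \<omega>) = PiM UNIV (\<lambda>_. density lborel f)"
proof -
  have "indep_sets (\<lambda>k. sigma_sets (space M) (\<Union>i\<in>{Some (h k)}. gen i)) UNIV"
  proof (rule indep_sets_collect_sigma)
    show "indep_sets gen (\<Union>k\<in>UNIV. {Some (h k)})"
      by (rule indep_sets_mono_index[OF _ marks_indep]) auto
    show "disjoint_family_on (\<lambda>k. {Some (h k)}) UNIV"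
      using assms by (auto simp: disjoint_family_on_def inj_on_def)
  qed (rule Int_stable_gen)
  then have "indep_vars (\<lambda>_. borel) (\<lambda>k. D (h k)) UNIV"
    unfolding indep_vars_def by simp
  then have "distr M (PiM UNIV (\<lambda>_. borel)) (\<lambda>\<omega>. \<lambda>k\<in>UNIV. D (h k) \<omega>) = PiM UNIV (\<lambda>k. distr M borel (D (h k)))"
    by (subst (asm) indep_vars_iff_distr_eq_PiM) auto
  then show ?thesis by (simp add: restrict_UNIV distr_D)
qed

lemma prob_D_family:
  assumes "inj h" and B: "B \<in> sets (PiM UNIV (\<lambda>_. borel))"
  shows "prob {\<omega>\<in>space M. (\<lambda>k. D (h k) \<omega>) \<in> B} = prob {\<omega>\<in>space M. (\<lambda>k. D k \<omega>) \<in> B}"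
proof -
  have *: "prob {\<omega>\<in>space M. (\<lambda>k. D (h k) \<omega>) \<in> B} = measure (PiM UNIV (\<lambda>_. density lborel f)) B"
    if "inj h" for h :: "nat \<Rightarrow> nat"
  proof -
    have [measurable]: "(\<lambda>\<omega> k. D (h k) \<omega>) \<in> measurable M (PiM UNIV (\<lambda>_. borel))"
      by (rule measurable_PiM_single') auto
    have "measure (PiM UNIV (\<lambda>_. density lborel f)) B = prob ((\<lambda>\<omega> k. D (h k) \<omega>) -` B \<inter> space M)"
      unfolding distr_D_family[OF that, symmetric] using B by (subst measure_distr) auto
    also have "(\<lambda>\<omega> k. D (h k) \<omega>) -` B \<inter> space M = {\<omega>\<in>space M. (\<lambda>k. D (h k) \<omega>) \<in> B}" by auto
    finally show ?thesis by simp
  qed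
  show ?thesis unfolding *[OF assms(1)] using *[of "\<lambda>k. k"] by simp
qed

lemma prob_C: "prob {\<omega>\<in>space M. C \<omega> = n} = pmf (poisson_pmf \<nu>) n"
proof -
  have "pmf (poisson_pmf \<nu>) n = measure (distr M (count_space UNIV) C) {n}"
    unfolding C_distr by (simp add: pmf.rep_eq)
  also have "\<dots> = prob (C -` {n} \<inter> space M)" by (subst measure_distr) auto
  also have "C -` {n} \<inter> space M = {\<omega>\<in>space M. C \<omega> = n}" by auto
  finally show ?thesis by simp
qed

lemma family_in_sigma:
  assumes B: "B \<in> sets (PiM UNIV (\<lambda>_. borel))" and h: "\<And>k. Some (h k) \<in> I"
  shows "{\<omega>\<in>space M. (\<lambda>k. D (h k) \<omega>) \<in> B} \<in> sigma_sets (space M) (\<Union>i\<in>I. gen i)"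
proof -
  let ?N = "sigma (space M) (\<Union>i\<in>I. gen i)"
  have pow: "(\<Union>i\<in>I. gen i) \<subseteq> Pow (space M)" using gen_events sets.space_closed[of M] by blast
  have sp: "space ?N = space M" by (simp add: space_measure_of_conv)
  have D: "D (h k) \<in> borel_measurable ?N" for k
  proof (rule measurableI)
    fix A :: "real set" assume A: "A \<in> sets borel"
    have "D (h k) -` A \<inter> space M \<in> gen (Some (h k))" using A by auto
    then have "D (h k) -` A \<inter> space M \<in> (\<Union>i\<in>I. gen i)" using h by blast
    then show "D (h k) -` A \<inter> space ?N \<in> sets ?N"
      unfolding sp sets_measure_of[OF pow] by (rule sigma_sets.Basic)
  qed auto
  have "(\<lambda>\<omega> k. D (h k) \<omega>) \<in> measurable ?N (PiM UNIV (\<lambda>_. borel))"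
    by (rule measurable_PiM_single') (auto intro: D)
  from measurable_sets[OF this B] have "(\<lambda>\<omega> k. D (h k) \<omega>) -` B \<inter> space M \<in> sigma_sets (space M) (\<Union>i\<in>I. gen i)"
    unfolding sp sets_measure_of[OF pow] .
  then show ?thesis by (rule back_subst[of "\<lambda>A. A \<in> _"]) auto
qed

lemma prob_C_family:
  assumes B: "B \<in> sets (PiM UNIV (\<lambda>_. borel))"
  shows "prob {\<omega>\<in>space M. C \<omega> = n \<and> (\<lambda>k. D k \<omega>) \<in> B} =
    pmf (poisson_pmf \<nu>) n * prob {\<omega>\<in>space M. (\<lambda>k. D k \<omega>) \<in> B}"
proof -
  let ?I = "\<lambda>b. if b then {None} else range Some"
  have ind: "indep_sets (\<lambda>b. sigma_sets (space M) (\<Union>i\<in>?I b. gen i)) UNIV"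
  proof (rule indep_sets_collect_sigma)
    show "indep_sets gen (\<Union>b\<in>UNIV. ?I b)" by (rule indep_sets_mono_index[OF _ marks_indep]) auto
    show "disjoint_family_on ?I UNIV" by (auto simp: disjoint_family_on_def)
  qed (rule Int_stable_gen)
  let ?A = "\<lambda>b. if b then {\<omega>\<in>space M. C \<omega> = n} else {\<omega>\<in>space M. (\<lambda>k. D k \<omega>) \<in> B}"
  have "{\<omega>\<in>space M. C \<omega> = n} = C -` {n} \<inter> space M" by auto
  then have "{\<omega>\<in>space M. C \<omega> = n} \<in> gen None" by (simp, blast)
  then have "prob (\<Inter>b\<in>UNIV. ?A b) = (\<Prod>b\<in>UNIV. prob (?A b))"
    using family_in_sigma[OF B, of "\<lambda>k. k" "range Some"]
    by (intro indep_setsD[OF ind]) (auto intro!: sigma_sets.Basic simp: all_bool_eq)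
  moreover have "(\<Inter>b\<in>UNIV. ?A b) = {\<omega>\<in>space M. C \<omega> = n \<and> (\<lambda>k. D k \<omega>) \<in> B}"
    by (auto simp: UNIV_bool)
  ultimately show ?thesis by (simp add: UNIV_bool prob_C mult.commute)
qed

text \<open>The number, the mark \<open>j\<close> and all remaining marks are three independent
  blocks, and the remaining marks are distributed like the full family.\<close>

lemma prob_C_D_family:
  assumes B: "B \<in> sets (PiM UNIV (\<lambda>_. borel))"
  shows "prob {\<omega>\<in>space M. C \<omega> = n \<and> D j \<omega> \<in> {a<..b} \<and> (\<lambda>k. D (skip j k) \<omega>) \<in> B} =
    pmf (poisson_pmf \<nu>) n * prob {\<omega>\<in>space M. D j \<omega> \<in> {a<..b}} * prob {\<omega>\<in>space M. (\<lambda>k. D k \<omega>) \<in> B}"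
proof -
  let ?I = "\<lambda>i::nat. if i = 0 then {None} else if i = 1 then {Some j} else Some ` (- {j})"
  have ind: "indep_sets (\<lambda>i. sigma_sets (space M) (\<Union>i\<in>?I i. gen i)) {0,1,2}"
  proof (rule indep_sets_collect_sigma)
    show "indep_sets gen (\<Union>i\<in>{0,1,2}. ?I i)" by (rule indep_sets_mono_index[OF _ marks_indep]) auto
    show "disjoint_family_on ?I {0,1,2}" by (auto simp: disjoint_family_on_def)
  qed (rule Int_stable_gen)
  define A where "A i = (if i = 0 then {\<omega>\<in>space M. C \<omega> = n} else if i = 1 then {\<omega>\<in>space M. D j \<omega> \<in> {a<..b}}
    else {\<omega>\<in>space M. (\<lambda>k. D (skip j k) \<omega>) \<in> B})" for i :: nat
  have A0: "A 0 \<in> sigma_sets (space M) (\<Union>i\<in>?I 0. gen i)"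
  proof -
    have "{\<omega>\<in>space M. C \<omega> = n} = C -` {n} \<inter> space M" by auto
    then have "A 0 \<in> gen None" by (simp add: A_def, blast)
    then show ?thesis by (intro sigma_sets.Basic) simp
  qed
  have A1: "A 1 \<in> sigma_sets (space M) (\<Union>i\<in>?I 1. gen i)"
  proof -
    have "{\<omega>\<in>space M. D j \<omega> \<in> {a<..b}} = D j -` {a<..b} \<inter> space M" by auto
    moreover have "{a<..b} \<in> sets borel" by simp
    ultimately have "A 1 \<in> gen (Some j)" unfolding A_def by (simp, blast)
    then show ?thesis by (intro sigma_sets.Basic) simp
  qed
  have A2: "A 2 \<in> sigma_sets (space M) (\<Union>i\<in>?I 2. gen i)"
    using family_in_sigma[OF B, of "skip j" "Some ` (- {j})"] by (simp add: A_def skip_neq)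
  have "prob (\<Inter>i\<in>{0,1,2}. A i) = (\<Prod>i\<in>{0,1,2}. prob (A i))"
    by (rule indep_setsD[OF ind]) (use A0 A1 A2 in auto)
  moreover have "(\<Inter>i\<in>{0,1,2}. A i) = {\<omega>\<in>space M. C \<omega> = n \<and> D j \<omega> \<in> {a<..b} \<and> (\<lambda>k. D (skip j k) \<omega>) \<in> B}"
    by (auto simp: A_def)
  ultimately show ?thesis
    by (simp add: A_def prob_C prob_D_family[OF inj_skip B])
qed

lemma cdf_marks: "prob {\<omega>\<in>space M. D j \<omega> \<le> a} = cdf_marks a"
proof -
  have *: "prob {\<omega>\<in>space M. D j \<omega> \<le> a} = measure (density lborel f) {..a}" for j
  proof -
    have "measure (density lborel f) {..a} = prob (D j -` {..a} \<inter> space M)"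
      unfolding distr_D[of j, symmetric] by (subst measure_distr) auto
    also have "D j -` {..a} \<inter> space M = {\<omega>\<in>space M. D j \<omega> \<le> a}" by auto
    finally show ?thesis by simp
  qed
  show ?thesis by (simp add: * cdf_marks_def)
qed

lemma cdf_marks_diff:
  assumes "a \<le> b" shows "prob {\<omega>\<in>space M. D j \<omega> \<in> {a<..b}} = cdf_marks b - cdf_marks a"
proof -
  have "{\<omega>\<in>space M. D j \<omega> \<in> {a<..b}} = {\<omega>\<in>space M. D j \<omega> \<le> b} - {\<omega>\<in>space M. D j \<omega> \<le> a}"
    using assms by auto
  also have "prob \<dots> = prob {\<omega>\<in>space M. D j \<omega> \<le> b} - prob {\<omega>\<in>space M. D j \<omega> \<le> a}"
    using assms by (intro finite_measure_Diff) auto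
  finally show ?thesis by (simp add: cdf_marks)
qed

lemma cdf_marks_mono: "a \<le> b \<Longrightarrow> cdf_marks a \<le> cdf_marks b"
  unfolding cdf_marks_def by (intro finite_measure_mono) auto

lemma cdf_marks_bounds: "0 \<le> cdf_marks a" "cdf_marks a \<le> 1"
  unfolding cdf_marks_def by auto

lemma cdf_marks_nonpos: "a \<le> 0 \<Longrightarrow> cdf_marks a = 0"
proof -
  assume "a \<le> 0"
  then have "{\<omega>\<in>space M. D 0 \<omega> \<le> a} = {}" using D_pos[of 0] by (auto simp: not_le intro: le_less_trans)
  then show ?thesis unfolding cdf_marks_def by (simp only: measure_empty)
qed

lemma arrived_nonpos: "a \<le> 0 \<Longrightarrow> arrived a \<omega> = 0"
proof -
  assume "a \<le> 0"
  then have "{j. j < C \<omega> \<and> D j \<omega> \<le> a} = {}" using D_pos[of _ \<omega>] by (auto simp: not_le intro: le_less_trans)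
  then show ?thesis by (simp add: arrived_def)
qed

text \<open>The Mecke formula for a Poisson number of points: removing a point after \<open>a\<close> does not affect
  \<open>A\<close>, and \<open>(n + 1) P(C = n + 1) = \<nu> P(C = n)\<close>.\<close>

lemma mecke:
  assumes A: "A \<in> marks_history M C D a" and ab: "a \<le> b"
  shows "(\<integral>\<^sup>+\<omega>. indicator A \<omega> * ennreal (real (card {j. j < C \<omega> \<and> D j \<omega> \<in> {a<..b}})) \<partial>M)
    = ennreal (\<nu> * (cdf_marks b - cdf_marks a)) * emeasure M A"
proof -
  let ?p = "cdf_marks b - cdf_marks a" and ?q = "\<lambda>m. pmf (poisson_pmf \<nu>) m"
  from A obtain B where B: "B \<in> sets marks_space" and AB: "A = {\<omega>\<in>space M. (C \<omega>, \<lambda>j. D j \<omega>) \<in> B}"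
    and del: "\<And>n d j. j \<le> n \<Longrightarrow> a < d j \<Longrightarrow> (Suc n, d) \<in> B \<longleftrightarrow> (n, \<lambda>k. d (skip j k)) \<in> B"
    by (rule marks_historyE) blast
  have Bm: "Pair m -` B \<in> sets (PiM UNIV (\<lambda>_. borel))" for m
    by (rule sets_Pair1[OF B])
  have [measurable]: "(\<lambda>\<omega> k. D (h k) \<omega>) \<in> measurable M (PiM UNIV (\<lambda>_. borel))" for h :: "nat \<Rightarrow> nat"
    by (rule measurable_PiM_single') auto
  have Bmeas: "{\<omega>\<in>space M. (\<lambda>k. D (h k) \<omega>) \<in> Pair m -` B} \<in> events" for m and h :: "nat \<Rightarrow> nat"
  proof -
    have "(\<lambda>\<omega> k. D (h k) \<omega>) -` (Pair m -` B) \<inter> space M \<in> events"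
      by (rule measurable_sets[OF _ Bm]) measurable
    then show ?thesis by (rule back_subst[of "\<lambda>A. A \<in> events"]) auto
  qed
  \<comment> \<open>Probability that the sequence of marks, combined with the number
    \<open>m\<close> whatever the actual number is, lies in \<open>B\<close>.\<close>
  define r where "r m = prob {\<omega>\<in>space M. (\<lambda>k. D k \<omega>) \<in> Pair m -` B}" for m
  \<comment> \<open>A mark \<open>j\<close> in \<open>(a,b]\<close> is singled out among
    \<open>m + 1\<close>, and \<open>B\<close> is tested on the configuration without it.\<close>
  let ?E = "\<lambda>m j. {\<omega>\<in>space M. C \<omega> = Suc m \<and> D j \<omega> \<in> {a<..b} \<and> (\<lambda>k. D (skip j k) \<omega>) \<in> Pair m -` B}"
  have E: "?E m j \<in> events" for m j
  proof -
    have "?E m j = {\<omega>\<in>space M. C \<omega> = Suc m \<and> D j \<omega> \<in> {a<..b}} \<inter> {\<omega>\<in>space M. (\<lambda>k. D (skip j k) \<omega>) \<in> Pair m -` B}"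
      by auto
    then show ?thesis using Bmeas[of "skip j" m] by simp
  qed
  \<comment> \<open>A mark in \<open>(a,b]\<close> lies after \<open>a\<close>, so by
    \<open>del\<close> it may be deleted before \<open>A\<close> is tested. At most one term of the
    outer sum is nonzero, the one with \<open>Suc m\<close> equal to the actual number.\<close>
  have pw: "indicator A \<omega> * ennreal (real (card {j. j < C \<omega> \<and> D j \<omega> \<in> {a<..b}})) =
      (\<Sum>m. \<Sum>j\<le>m. indicator (?E m j) \<omega> :: ennreal)" if \<omega>: "\<omega> \<in> space M" for \<omega>
  proof (cases "C \<omega>")
    case 0
    then show ?thesis by simp
  next
    case (Suc n)
    have "(\<Sum>m. \<Sum>j\<le>m. indicator (?E m j) \<omega> :: ennreal) = (\<Sum>m\<in>{n}. \<Sum>j\<le>m. indicator (?E m j) \<omega>)"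
      by (rule suminf_finite) (auto simp: Suc)
    also have "\<dots> = (\<Sum>j\<le>n. indicator A \<omega> * (if D j \<omega> \<in> {a<..b} then 1 else 0))"
    proof (simp only: sum.insert sum.empty finite.emptyI empty_iff not_False_eq_True add_0_right, rule sum.cong[OF refl])
      fix j assume "j \<in> {..n}"
      then show "indicator (?E n j) \<omega> = (indicator A \<omega> * (if D j \<omega> \<in> {a<..b} then 1 else 0) :: ennreal)"
        using del[of j n "\<lambda>k. D k \<omega>"] \<omega> by (auto simp: indicator_def AB Suc)
    qed
    also have "\<dots> = indicator A \<omega> * (\<Sum>j\<le>n. if D j \<omega> \<in> {a<..b} then 1 else 0)"
      by (simp add: sum_distrib_left)
    also have "(\<Sum>j\<le>n. if D j \<omega> \<in> {a<..b} then 1 else 0 :: ennreal) = of_nat (card ({..n} \<inter> {j. D j \<omega> \<in> {a<..b}}))"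
      by (simp add: sum.If_cases)
    also have "{..n} \<inter> {j. D j \<omega> \<in> {a<..b}} = {j. j < C \<omega> \<and> D j \<omega> \<in> {a<..b}}" by (auto simp: Suc)
    finally show ?thesis by (simp add: ennreal_of_nat_eq_real_of_nat)
  qed
  have "(\<integral>\<^sup>+\<omega>. indicator A \<omega> * ennreal (real (card {j. j < C \<omega> \<and> D j \<omega> \<in> {a<..b}})) \<partial>M)
      = (\<integral>\<^sup>+\<omega>. (\<Sum>m. \<Sum>j\<le>m. indicator (?E m j) \<omega>) \<partial>M)"
    by (rule nn_integral_cong) (rule pw)
  also have "\<dots> = (\<Sum>m. \<integral>\<^sup>+\<omega>. (\<Sum>j\<le>m. indicator (?E m j) \<omega>) \<partial>M)"
    by (rule nn_integral_suminf) (intro borel_measurable_sum borel_measurable_indicator E)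
  also have "\<dots> = (\<Sum>m. \<Sum>j\<le>m. ennreal (prob (?E m j)))"
  proof (rule suminf_cong)
    fix m
    have "(\<integral>\<^sup>+\<omega>. (\<Sum>j\<le>m. indicator (?E m j) \<omega>) \<partial>M) = (\<Sum>j\<le>m. \<integral>\<^sup>+\<omega>. indicator (?E m j) \<omega> \<partial>M)"
      by (intro nn_integral_sum borel_measurable_indicator E)
    also have "\<dots> = (\<Sum>j\<le>m. ennreal (prob (?E m j)))"
      by (simp only: nn_integral_indicator[OF E] emeasure_eq_measure)
    finally show "(\<integral>\<^sup>+\<omega>. (\<Sum>j\<le>m. indicator (?E m j) \<omega>) \<partial>M) = (\<Sum>j\<le>m. ennreal (prob (?E m j)))" .
  qed
  also have "\<dots> = (\<Sum>m. ennreal (\<nu> * ?p) * ennreal (?q m * r m))"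
  proof (rule suminf_cong)
    fix m
    have p: "0 \<le> ?p" using cdf_marks_mono[OF ab] by simp
    \<comment> \<open>The Poisson recursion: the \<open>m + 1\<close> choices of the deleted mark
      and the weight of \<open>m + 1\<close> combine to \<open>\<nu>\<close> times the weight of
      \<open>m\<close>.\<close>
    have "real (Suc m) * ?q (Suc m) = \<nu> * ?q m"
      using \<nu> by (simp add: field_simps del: of_nat_Suc)
    then have eq: "real (Suc m) * (?q (Suc m) * ?p * r m) = (\<nu> * ?p) * (?q m * r m)" by algebra
    have "(\<Sum>j\<le>m. ennreal (prob (?E m j))) = (\<Sum>j\<le>m. ennreal (?q (Suc m) * ?p * r m))"
      unfolding prob_C_D_family[OF Bm] cdf_marks_diff[OF ab] r_def ..
    also have "\<dots> = ennreal (real (Suc m) * (?q (Suc m) * ?p * r m))"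
      by (simp add: ennreal_of_nat_eq_real_of_nat[symmetric] ennreal_mult' del: of_nat_Suc)
    also have "\<dots> = ennreal (\<nu> * ?p) * ennreal (?q m * r m)"
      unfolding eq using \<nu> p by (intro ennreal_mult) (auto simp: r_def)
    finally show "(\<Sum>j\<le>m. ennreal (prob (?E m j))) = ennreal (\<nu> * ?p) * ennreal (?q m * r m)" .
  qed
  also have "\<dots> = ennreal (\<nu> * ?p) * (\<Sum>m. ennreal (?q m * r m))" by simp
  \<comment> \<open>The index \<open>m\<close> now plays the role of the number of marks itself, and
    summing over it reassembles \<open>A\<close>.\<close>
  also have "(\<Sum>m. ennreal (?q m * r m)) = emeasure M A"
  proof -
    let ?A = "\<lambda>m. {\<omega>\<in>space M. C \<omega> = m \<and> (\<lambda>k. D k \<omega>) \<in> Pair m -` B}"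
    have ev: "?A m \<in> events" for m
    proof -
      have "?A m = {\<omega>\<in>space M. C \<omega> = m} \<inter> {\<omega>\<in>space M. (\<lambda>k. D k \<omega>) \<in> Pair m -` B}" by auto
      then show ?thesis using Bmeas[of "\<lambda>k. k" m] by simp
    qed
    have "(\<Sum>m. ennreal (?q m * r m)) = (\<Sum>m. emeasure M (?A m))"
      by (simp only: prob_C_family[OF Bm] r_def emeasure_eq_measure)
    also have "\<dots> = emeasure M (\<Union>m. ?A m)"
      by (rule suminf_emeasure) (use ev in \<open>auto simp: disjoint_family_on_def\<close>)
    also have "(\<Union>m. ?A m) = A" by (auto simp: AB)
    finally show ?thesis .
  qed
  finally show ?thesis .
qed

end

section \<open>The compensator of a Poisson number of marks\<close>

context poisson_marks
begin

text \<open>A mark deleted after \<open>a\<close> is not among those counted up to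
  \<open>u \<le> a\<close>, and the others are only renumbered.\<close>

lemma arrived_history:
  assumes "u \<le> a"
  shows "{\<omega>\<in>space M. arrived u \<omega> = n} \<in> marks_history M C D a"
proof -
  define c where "c z = card {j. j < fst z \<and> snd z j \<le> u}" for z :: "nat \<times> (nat \<Rightarrow> real)"
  have "c \<in> measurable marks_space (count_space UNIV)"
    unfolding c_def
  proof (rule measurable_card)
    fix i
    have "Measurable.pred marks_space (\<lambda>z. i < fst z \<and> snd z i \<le> u)" by measurable
    then show "{z\<in>space marks_space. i \<in> {j. j < fst z \<and> snd z j \<le> u}} \<in> sets marks_space"
      by (simp only: pred_def mem_Collect_eq)
  qed
  from measurable_sets[OF this, of "{n}"] have B: "c -` {n} \<in> sets marks_space" by simp
  have "c (Suc m, d) = c (m, \<lambda>k. d (skip j k))" if j: "j \<le> m" and "a < d j" for m d j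
  proof -
    have "{k. k < Suc m \<and> d k \<le> u} = skip j ` {k. k < m \<and> d (skip j k) \<le> u}"
    proof (intro set_eqI iffI)
      fix k assume k: "k \<in> {k. k < Suc m \<and> d k \<le> u}"
      then have "k \<noteq> j" using \<open>a < d j\<close> \<open>u \<le> a\<close> by auto
      then have "k = skip j (if k < j then k else k - 1)" "(if k < j then k else k - 1) < m"
        using k j by (auto simp: skip_def)
      then show "k \<in> skip j ` {k. k < m \<and> d (skip j k) \<le> u}" using k by (metis (no_types, lifting) image_eqI mem_Collect_eq)
    qed (auto simp: skip_def)
    then show ?thesis by (simp add: c_def card_image inj_on_subset[OF inj_skip])
  qed
  then have "{\<omega>\<in>space M. (C \<omega>, \<lambda>j. D j \<omega>) \<in> c -` {n}} \<in> marks_history M C D a"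
    by (intro marks_historyI[OF B]) auto
  then show ?thesis by (simp add: c_def arrived_def)
qed

lemma arrived_measurable [measurable]: "arrived a \<in> measurable M (count_space UNIV)"
  unfolding arrived_def[abs_def] by (rule measurable_card) simp

lemma arrived_diff:
  assumes "a \<le> b"
  shows "real (arrived b \<omega>) - real (arrived a \<omega>) = real (card {j. j < C \<omega> \<and> D j \<omega> \<in> {a<..b}})"
proof -
  have "{j. j < C \<omega> \<and> D j \<omega> \<le> b} = {j. j < C \<omega> \<and> D j \<omega> \<le> a} \<union> {j. j < C \<omega> \<and> D j \<omega> \<in> {a<..b}}"
    using assms by auto
  moreover have "card ({j. j < C \<omega> \<and> D j \<omega> \<le> a} \<union> {j. j < C \<omega> \<and> D j \<omega> \<in> {a<..b}}) =
      card {j. j < C \<omega> \<and> D j \<omega> \<le> a} + card {j. j < C \<omega> \<and> D j \<omega> \<in> {a<..b}}"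
    by (rule card_Un_disjoint) auto
  ultimately have "arrived b \<omega> = arrived a \<omega> + card {j. j < C \<omega> \<and> D j \<omega> \<in> {a<..b}}"
    unfolding arrived_def by metis
  then show ?thesis by (simp only: of_nat_add add_diff_cancel_left')
qed

lemma marks_history_events: "marks_history M C D a \<subseteq> events"
proof
  fix A assume "A \<in> marks_history M C D a"
  then obtain B where B: "B \<in> sets marks_space" "A = {\<omega>\<in>space M. (C \<omega>, \<lambda>j. D j \<omega>) \<in> B}"
    by (rule marks_historyE) blast
  have "(\<lambda>\<omega>. (C \<omega>, \<lambda>j. D j \<omega>)) \<in> measurable M marks_space"
    by (intro measurable_Pair C measurable_PiM_single') auto
  from measurable_sets[OF this B(1)] show "A \<in> events"
    unfolding B(2) by (rule back_subst[of "\<lambda>A. A \<in> events"]) auto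
qed

lemma space_marks_history: "space M \<in> marks_history M C D a"
  using marks_historyI[of UNIV a M C D] sets.top[of marks_space] unfolding space_marks by simp

text \<open>Mecke's formula for the sure event on \<open>(0,a]\<close>; all marks are
  positive.\<close>

lemma nn_integral_arrived: "(\<integral>\<^sup>+\<omega>. ennreal (real (arrived a \<omega>)) \<partial>M) = ennreal (\<nu> * cdf_marks a)"
proof (cases "0 \<le> a")
  case True
  have "(\<integral>\<^sup>+\<omega>. ennreal (real (arrived a \<omega>)) \<partial>M)
      = (\<integral>\<^sup>+\<omega>. indicator (space M) \<omega> * ennreal (real (card {j. j < C \<omega> \<and> D j \<omega> \<in> {0<..a}})) \<partial>M)"
    by (intro nn_integral_cong) (simp add: arrived_def D_pos)
  also have "\<dots> = ennreal (\<nu> * cdf_marks a)"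
    unfolding mecke[OF space_marks_history True] by (simp add: cdf_marks_nonpos emeasure_space_1)
  finally show ?thesis .
qed (simp add: arrived_nonpos cdf_marks_nonpos)

lemma integrable_arrived: "integrable M (\<lambda>\<omega>. real (arrived a \<omega>))"
  by (rule integrableI_nonneg) (auto simp: nn_integral_arrived)

text \<open>On \<open>A\<close>, Mecke's formula gives the number of marks in \<open>(a,b]\<close>
  the integral \<open>\<nu> * (cdf_marks b - cdf_marks a) * prob A\<close>, which is the increment
  of the deterministic compensator times the mass of \<open>A\<close>.\<close>

lemma arrived_martingale:
  assumes A: "A \<in> marks_history M C D a" and ab: "a \<le> b"
  shows "(LINT \<omega>:A|M. real (arrived b \<omega>) - \<nu> * cdf_marks b) = (LINT \<omega>:A|M. real (arrived a \<omega>) - \<nu> * cdf_marks a)"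
proof -
  have ev: "A \<in> events" using A marks_history_events by blast
  have p: "0 \<le> \<nu> * (cdf_marks b - cdf_marks a)" using \<nu> cdf_marks_mono[OF ab] by simp
  have int: "integrable M (\<lambda>\<omega>. real (arrived b \<omega>) - real (arrived a \<omega>))"
    by (intro Bochner_Integration.integrable_diff integrable_arrived)
  have "ennreal (LINT \<omega>:A|M. real (arrived b \<omega>) - real (arrived a \<omega>))
      = (\<integral>\<^sup>+\<omega>. ennreal (indicator A \<omega> *\<^sub>R (real (arrived b \<omega>) - real (arrived a \<omega>))) \<partial>M)"
    unfolding set_lebesgue_integral_def
    by (rule nn_integral_eq_integral[symmetric])
       (use integrable_mult_indicator[OF ev int] in \<open>auto simp: arrived_diff[OF ab] simp del: integrable_diff\<close>)
  also have "\<dots> = (\<integral>\<^sup>+\<omega>. indicator A \<omega> * ennreal (real (card {j. j < C \<omega> \<and> D j \<omega> \<in> {a<..b}})) \<partial>M)"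
    by (intro nn_integral_cong) (auto simp: arrived_diff[OF ab] indicator_def)
  also have "\<dots> = ennreal (\<nu> * (cdf_marks b - cdf_marks a) * prob A)"
    unfolding mecke[OF A ab] using p by (simp add: emeasure_eq_measure ennreal_mult')
  finally have eq: "(LINT \<omega>:A|M. real (arrived b \<omega>) - real (arrived a \<omega>)) = \<nu> * (cdf_marks b - cdf_marks a) * prob A"
    by (subst (asm) ennreal_inj)
       (use p in \<open>auto simp: set_lebesgue_integral_def arrived_diff[OF ab] intro!: Bochner_Integration.integral_nonneg\<close>)
  have si: "set_integrable M A (\<lambda>\<omega>. real (arrived t \<omega>) - \<nu> * cdf_marks t)" for t
    unfolding set_integrable_def
    by (intro integrable_mult_indicator ev Bochner_Integration.integrable_diff integrable_arrived integrable_const)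
  have "(LINT \<omega>:A|M. real (arrived b \<omega>) - \<nu> * cdf_marks b) - (LINT \<omega>:A|M. real (arrived a \<omega>) - \<nu> * cdf_marks a)
    = (LINT \<omega>:A|M. (real (arrived b \<omega>) - real (arrived a \<omega>)) - \<nu> * (cdf_marks b - cdf_marks a))"
    by (subst set_integral_diff(2)[OF si si, symmetric]) (simp add: algebra_simps)
  also have "\<dots> = (LINT \<omega>:A|M. real (arrived b \<omega>) - real (arrived a \<omega>)) - (LINT \<omega>:A|M. \<nu> * (cdf_marks b - cdf_marks a))"
    by (intro set_integral_diff(2)) (auto simp only: set_integrable_def intro!: integrable_mult_indicator
        int integrable_const ev)
  also have "\<dots> = 0"
    unfolding eq using ev by (simp add: set_lebesgue_integral_def)
  finally show ?thesis by simp
qed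

text \<open>The marks are themselves independent sources with diffuse laws, and each is compared
  with another one from outside its source.\<close>

lemma AE_marks_distinct: "j \<noteq> k \<Longrightarrow> AE \<omega> in M. D j \<omega> \<noteq> D k \<omega>"
proof -
  assume jk: "j \<noteq> k"
  define \<S> where "\<S> k = sigma_sets (space M) (gen k)" for k
  have ind: "indep_sets \<S> UNIV"
    unfolding \<S>_def by (rule indep_sets_sigma[OF marks_indep Int_stable_gen])
  have sa: "sigma_algebra (space M) (\<S> k)" for k
    using gen_events[of k] sets.space_closed[of M] unfolding \<S>_def by (blast intro!: sigma_algebra_sigma_sets)
  have src: "{\<omega>\<in>space M. D j \<omega> \<le> u} \<in> \<S> (Some j)" for j u
  proof -
    have "{\<omega>\<in>space M. D j \<omega> \<le> u} = D j -` {..u} \<inter> space M" by auto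
    moreover have "{..u} \<in> sets borel" by simp
    ultimately have "{\<omega>\<in>space M. D j \<omega> \<le> u} \<in> gen (Some j)" unfolding option.case by blast
    then show ?thesis unfolding \<S>_def by (rule sigma_sets.Basic)
  qed
  have "D j \<in> borel_measurable (sigma (space M) (\<S> (Some j)))"
    by (rule borel_measurableI_le)
       (simp add: src sigma_algebra.sets_measure_of_eq[OF sa] space_measure_of_conv)
  moreover have "D k \<in> borel_measurable (rest M \<S> (Some j))"
    by (rule borel_measurableI_le) (use jk in \<open>auto intro!: sets_rest[where \<S>=\<S> and j="Some k", OF sa src]\<close>)
  ultimately show ?thesis
    by (rule independent_pair.AE_neq[OF independent_pair_rest[OF ind sa]]) (rule distributed_diffuse[OF D_distr])
qed

end

section \<open>The Neyman--Scott process\<close>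

text \<open>Source \<open>None\<close> holds the parents, source \<open>Some i\<close> the number
  and the displacements of the children of parent \<open>i\<close>. The histories of marks are
  \<sigma>-algebras already; \<open>sigma\<close> only turns them into measures.\<close>

locale neyman_scott_clusters =
  clusters M \<S>
    "\<lambda>k. case k of None \<Rightarrow> points_history M T | Some i \<Rightarrow> (\<lambda>a. sigma (space M) (marks_history M (C i) (D i) a))"
    "\<lambda>k. case k of None \<Rightarrow> (\<lambda>_. 0) | Some i \<Rightarrow> T i"
    None \<mu> T
  for M :: "'a measure" and \<S> :: "nat option \<Rightarrow> 'a set set" and T \<mu> and C :: "nat \<Rightarrow> 'a \<Rightarrow> nat"
    and D :: "nat \<Rightarrow> nat \<Rightarrow> 'a \<Rightarrow> real" +
  fixes \<nu> :: real and f :: "real \<Rightarrow> real"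
  assumes marks: "\<And>i. poisson_marks M (C i) (D i) \<nu> f"
    and C_source: "\<And>i n. {\<omega>\<in>space M. C i \<omega> = n} \<in> \<S> (Some i)"
    and D_source: "\<And>i j u. {\<omega>\<in>space M. D i j \<omega> \<le> u} \<in> \<S> (Some i)"
    and f: "probability_density_nonneg f"
begin

lemma \<nu>: "0 < \<nu>" by (rule poisson_marks.\<nu>[OF marks])

lemma f_measurable [measurable]: "f \<in> borel_measurable borel"
  and f_nonneg: "0 \<le> f x" and f_neg: "x < 0 \<Longrightarrow> f x = 0"
  using f by (auto simp: probability_density_nonneg_def)

lemma f_integrable: "integrable lborel f"
  by (rule integrableI_nonneg) (use f in \<open>auto simp: probability_density_nonneg_def\<close>)

lemma D_pos [simp]: "0 < D i j \<omega>" by (rule poisson_marks.D_pos[OF marks])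

lemma D_measurable [measurable]: "D i j \<in> borel_measurable M"
  by (rule poisson_marks.D_measurable[OF marks])

lemma D_S: "D i j \<in> borel_measurable (S (Some i))"
  by (rule measurable_S[OF D_source])

lemma D_E: "k \<noteq> Some i \<Longrightarrow> D i j \<in> borel_measurable (E k)"
  using D_source by (rule measurable_E) auto

lemma C_S: "C i \<in> measurable (S (Some i)) (count_space UNIV)"
proof (rule measurable_count_space_eq2_countable[THEN iffD2], intro conjI ballI)
  fix n
  have "C i -` {n} \<inter> space (S (Some i)) = {\<omega>\<in>space M. C i \<omega> = n}" by auto
  then show "C i -` {n} \<inter> space (S (Some i)) \<in> sets (S (Some i))" using C_source by simp
qed auto

lemma C_E: "k \<noteq> Some i \<Longrightarrow> C i \<in> measurable (E k) (count_space UNIV)"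
proof (rule measurable_count_space_eq2_countable[THEN iffD2], intro conjI ballI)
  fix n assume "k \<noteq> Some i"
  have "C i -` {n} \<inter> space (E k) = {\<omega>\<in>space M. C i \<omega> = n}" by auto
  then show "C i -` {n} \<inter> space (E k) \<in> sets (E k)"
    using sets_rest[where \<S>=\<S> and j="Some i" and k=k, OF sa C_source] \<open>k \<noteq> Some i\<close> by simp
qed auto

definition displacement_cdf :: "real \<Rightarrow> real" where
  "displacement_cdf a = (\<integral>x. indicator {0<..a} x * f x \<partial>lborel)"

text \<open>Displacements are positive, so \<open>(0,a]\<close> captures all of those up to
  \<open>a\<close>; the open left end matches a drive that sums over \<open>T i < s\<close>.\<close>

lemma cdf_marks_eq: "poisson_marks.cdf_marks M (D i) a = displacement_cdf a"
proof -
  have int: "integrable lborel (\<lambda>x. indicator {0<..a} x * f x)"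
    using integrable_mult_indicator[OF _ f_integrable, of "{0<..a}"] by simp
  have "{\<omega>\<in>space M. D i 0 \<omega> \<le> a} = D i 0 -` {0<..a} \<inter> space M" by auto
  then have "ennreal (poisson_marks.cdf_marks M (D i) a) = emeasure M (D i 0 -` {0<..a} \<inter> space M)"
    by (simp add: poisson_marks.cdf_marks_def[OF marks] emeasure_eq_measure)
  also have "\<dots> = (\<integral>\<^sup>+x. ennreal (f x) * indicator {0<..a} x \<partial>lborel)"
    by (rule distributed_emeasure[OF poisson_marks.D_distr[OF marks]]) simp
  also have "\<dots> = (\<integral>\<^sup>+x. ennreal (indicator {0<..a} x * f x) \<partial>lborel)"
    by (intro nn_integral_cong) (auto simp: indicator_def)
  also have "\<dots> = ennreal (displacement_cdf a)"
    unfolding displacement_cdf_def using int f_nonneg by (intro nn_integral_eq_integral) auto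
  finally show ?thesis
    by (subst (asm) ennreal_inj)
       (auto simp: poisson_marks.cdf_marks_bounds[OF marks] displacement_cdf_def f_nonneg intro!: Bochner_Integration.integral_nonneg)
qed

lemma displacement_cdf_bounds: "0 \<le> displacement_cdf a" "displacement_cdf a \<le> 1"
  using poisson_marks.cdf_marks_bounds[OF marks] unfolding cdf_marks_eq by auto

lemma displacement_cdf_nonpos: "a \<le> 0 \<Longrightarrow> displacement_cdf a = 0"
  by (simp add: displacement_cdf_def)

lemma displacement_cdf_measurable [measurable]: "displacement_cdf \<in> borel_measurable borel"
  using poisson_marks.cdf_marks_mono[OF marks] unfolding cdf_marks_eq
  by (intro borel_measurable_mono monoI)

definition drive2 :: "real \<Rightarrow> 'a \<Rightarrow> real" where
  "drive2 s \<omega> = (\<Sum>i\<in>{i. T i \<omega> < s}. \<nu> * f (s - T i \<omega>))"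

text \<open>Each parent contributes a translate of the density, integrated from its arrival to
  \<open>t\<close>; the substitution \<open>s = T i + x\<close> makes this the distribution function
  at the age \<open>t - T i\<close>.\<close>

lemma compensator_drive2:
  assumes t: "0 \<le> t"
  shows "set_integrable lborel {0..t} (\<lambda>s. drive2 s \<omega>)"
    and "compensator drive2 t \<omega> = (\<Sum>i. \<nu> * displacement_cdf (t - T i \<omega>))"
proof -
  let ?J = "{i. T i \<omega> \<le> t}"
  let ?g = "\<lambda>i s. indicator {T i \<omega><..t} s * f (s - T i \<omega>)"
  have eq: "indicator {0..t} s *\<^sub>R drive2 s \<omega> = (\<Sum>i\<in>?J. \<nu> * ?g i s)" for s
  proof (cases "s \<in> {0..t}")
    case True
    have "{i. T i \<omega> < s} = {i\<in>?J. T i \<omega> < s}" using True by auto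
    then have "drive2 s \<omega> = (\<Sum>i\<in>{i\<in>?J. T i \<omega> < s}. \<nu> * f (s - T i \<omega>))"
      unfolding drive2_def by simp
    also have "\<dots> = (\<Sum>i\<in>?J. if T i \<omega> < s then \<nu> * f (s - T i \<omega>) else 0)"
      by (rule sum.inter_filter) simp
    also have "\<dots> = (\<Sum>i\<in>?J. \<nu> * ?g i s)"
      using True by (intro sum.cong refl) (auto simp: indicator_def)
    finally show ?thesis using True by simp
  next
    case False
    have "s \<notin> {T i \<omega><..t}" for i using False less_trans[OF T_pos[of i \<omega>], of s] by auto
    then show ?thesis using False by simp
  qed
  have intg: "integrable lborel (?g i)" for i
  proof -
    have "integrable lborel (\<lambda>s. f (- T i \<omega> + 1 * s))"
      by (rule lborel_integrable_real_affine[OF f_integrable]) simp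
    then have "integrable lborel (\<lambda>s. f (s - T i \<omega>))" by (simp add: algebra_simps)
    from integrable_mult_indicator[OF _ this, of "{T i \<omega><..t}"] show ?thesis by simp
  qed
  then have int: "integrable lborel (\<lambda>s. \<nu> * ?g i s)" for i by (rule integrable_mult_right)
  have "integrable lborel (\<lambda>s. \<Sum>i\<in>?J. \<nu> * ?g i s)"
    using int by (rule Bochner_Integration.integrable_sum)
  then show "set_integrable lborel {0..t} (\<lambda>s. drive2 s \<omega>)"
    unfolding set_integrable_def eq .
  have "compensator drive2 t \<omega> = (\<Sum>i\<in>?J. \<integral>s. \<nu> * ?g i s \<partial>lborel)"
    unfolding compensator_def set_lebesgue_integral_def eq by (rule Bochner_Integration.integral_sum) (rule int)
  also have "\<dots> = (\<Sum>i\<in>?J. \<nu> * displacement_cdf (t - T i \<omega>))"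
  proof (intro sum.cong refl)
    fix i
    have "(\<integral>s. ?g i s \<partial>lborel) = (\<integral>x. ?g i (T i \<omega> + 1 * x) \<partial>lborel)"
      by (subst lborel_integral_real_affine[of 1 _ "T i \<omega>"]) auto
    also have "\<dots> = displacement_cdf (t - T i \<omega>)"
      unfolding displacement_cdf_def by (intro Bochner_Integration.integral_cong) (auto simp: indicator_def)
    finally show "(\<integral>s. \<nu> * ?g i s \<partial>lborel) = \<nu> * displacement_cdf (t - T i \<omega>)" by simp
  qed
  also have "\<dots> = (\<Sum>i. \<nu> * displacement_cdf (t - T i \<omega>))"
    by (rule suminf_finite[symmetric]) (auto simp: displacement_cdf_nonpos)
  finally show "compensator drive2 t \<omega> = (\<Sum>i. \<nu> * displacement_cdf (t - T i \<omega>))" .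
qed

definition offspring :: "nat \<Rightarrow> real \<Rightarrow> 'a \<Rightarrow> nat" where
  "offspring i t \<omega> = card {j. j < C i \<omega> \<and> T i \<omega> + D i j \<omega> \<le> t}"

lemma offspring_arrived: "offspring i t \<omega> = poisson_marks.arrived (C i) (D i) (t - T i \<omega>) \<omega>"
proof -
  have "{j. j < C i \<omega> \<and> T i \<omega> + D i j \<omega> \<le> t} = {j. j < C i \<omega> \<and> D i j \<omega> \<le> t - T i \<omega>}" by auto
  then show ?thesis by (simp add: offspring_def poisson_marks.arrived_def[OF marks])
qed

lemma offspring_zero: "t < T i \<omega> \<Longrightarrow> offspring i t \<omega> = 0"
  unfolding offspring_arrived by (rule poisson_marks.arrived_nonpos[OF marks]) simp

definition children :: "real \<Rightarrow> 'a \<Rightarrow> nat" where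
  "children t \<omega> = card {q\<in>{q. snd q < C (fst q) \<omega>}. T (fst q) \<omega> + D (fst q) (snd q) \<omega> \<le> t}"

lemma
  shows children_suminf: "real (children t \<omega>) = (\<Sum>i. real (offspring i t \<omega>))"
    and finite_children: "finite {q\<in>{q. snd q < C (fst q) \<omega>}. T (fst q) \<omega> + D (fst q) (snd q) \<omega> \<le> t}"
proof -
  let ?P = "\<lambda>i j. j < C i \<omega> \<and> T i \<omega> + D i j \<omega> \<le> t"
  have P: "?P i j \<Longrightarrow> i \<in> {i. T i \<omega> \<le> t}" for i j
    using D_pos[of i j \<omega>] unfolding mem_Collect_eq by linarith
  have fin: "finite {j. ?P i j}" for i by simp
  have eq: "{q\<in>{q. snd q < C (fst q) \<omega>}. T (fst q) \<omega> + D (fst q) (snd q) \<omega> \<le> t} = {q. ?P (fst q) (snd q)}" by auto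
  show "real (children t \<omega>) = (\<Sum>i. real (offspring i t \<omega>))"
    unfolding children_def eq offspring_def by (rule card_pairs_eq_suminf(1)[OF T_finite P fin])
  show "finite {q\<in>{q. snd q < C (fst q) \<omega>}. T (fst q) \<omega> + D (fst q) (snd q) \<omega> \<le> t}"
    unfolding eq by (rule card_pairs_eq_suminf(2)[OF T_finite P fin])
qed

text \<open>Seen from the parents, the marks are known and displacements are positive, so
  \<open>T i\<close> is only compared with times up to \<open>t\<close>. Seen from source
  \<open>Some i\<close>, the arrival is known and marks are counted up to the present age. For any
  other source the whole cluster is outside information.\<close>

lemma offspring_F: "offspring i t \<in> measurable (F t) (count_space UNIV)"
proof (rule measurable_count_space_eq2_countable[THEN iffD2], intro conjI ballI)
  fix n
  have "Measurable.pred (F t) (\<lambda>\<omega>. offspring i t \<omega> = n)"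
  proof (rule pred_F)
    fix k
    consider "k = None" | "k = Some i" | "k \<noteq> None" "k \<noteq> Some i" by blast
    then show "{\<omega>\<in>space M. offspring i t \<omega> = n} \<in> R k t"
    proof cases
      case 1
      let ?Q = "\<lambda>\<omega>\<^sub>1 \<omega>\<^sub>2. card {j. j < C i \<omega>\<^sub>1 \<and> T i \<omega>\<^sub>2 + D i j \<omega>\<^sub>1 \<le> t} = n"
      have [measurable]: "C i \<in> measurable (E None) (count_space UNIV)" "D i j \<in> borel_measurable (E None)" for j
        by (auto intro: C_E D_E)
      have "{\<omega>\<in>space M. ?Q \<omega> \<omega>} \<in> R None t"
      proof (rule delayed_pair.revealedI[OF delayed, where Q="?Q"])
        have "(\<lambda>z. card {j. j < C i (fst z) \<and> T i (snd z) + D i j (fst z) \<le> t}) \<in> measurable (E None \<Otimes>\<^sub>M S None) (count_space UNIV)"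
          by (rule measurable_card) measurable
        then show "Measurable.pred (E None \<Otimes>\<^sub>M S None) (\<lambda>(\<omega>\<^sub>1, \<omega>\<^sub>2). ?Q \<omega>\<^sub>1 \<omega>\<^sub>2)"
          unfolding case_prod_beta by measurable
        fix \<omega>\<^sub>1
        have "(\<lambda>\<omega>\<^sub>2. card {j. j < C i \<omega>\<^sub>1 \<and> T i \<omega>\<^sub>2 + D i j \<omega>\<^sub>1 \<le> t}) \<in> measurable (points_history M T t) (count_space UNIV)"
        proof (rule measurable_card)
          fix j
          have "Measurable.pred (points_history M T t) (\<lambda>\<omega>\<^sub>2. T i \<omega>\<^sub>2 \<le> t - D i j \<omega>\<^sub>1)"
            using less_imp_le[OF D_pos[of i j \<omega>\<^sub>1]] by (intro points_history_pred) simp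
          then have "Measurable.pred (points_history M T t) (\<lambda>\<omega>\<^sub>2. j < C i \<omega>\<^sub>1 \<and> T i \<omega>\<^sub>2 \<le> t - D i j \<omega>\<^sub>1)"
            by (intro pred_intros_logic) auto
          then show "{\<omega>\<^sub>2\<in>space (points_history M T t). j \<in> {j. j < C i \<omega>\<^sub>1 \<and> T i \<omega>\<^sub>2 + D i j \<omega>\<^sub>1 \<le> t}}
              \<in> sets (points_history M T t)"
            unfolding pred_def le_diff_eq mem_Collect_eq .
        qed
        then have "Measurable.pred (points_history M T t) (?Q \<omega>\<^sub>1)"
          by (rule measurable_compose) simp
        then show "Measurable.pred ((case None of None \<Rightarrow> points_history M T | Some i \<Rightarrow> \<lambda>a. sigma (space M) (marks_history M (C i) (D i) a))
            (t - (case None of None \<Rightarrow> \<lambda>_. 0 | Some i \<Rightarrow> T i) \<omega>\<^sub>1)) (?Q \<omega>\<^sub>1)"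
          by (simp only: option.case diff_0_right)
      qed
      then show ?thesis unfolding 1 offspring_def .
    next
      case 2
      let ?Q = "\<lambda>\<omega>\<^sub>1 \<omega>\<^sub>2. poisson_marks.arrived (C i) (D i) (t - T i \<omega>\<^sub>1) \<omega>\<^sub>2 = n"
      have [measurable]: "T i \<in> borel_measurable (E (Some i))" by (rule T_E) simp
      note [measurable] = C_S D_S
      have "{\<omega>\<in>space M. ?Q \<omega> \<omega>} \<in> R (Some i) t"
      proof (rule delayed_pair.revealedI[OF delayed, where Q="?Q"])
        have "(\<lambda>z. card {j. j < C i (snd z) \<and> D i j (snd z) \<le> t - T i (fst z)}) \<in> measurable (E (Some i) \<Otimes>\<^sub>M S (Some i)) (count_space UNIV)"
          by (rule measurable_card) measurable
        then show "Measurable.pred (E (Some i) \<Otimes>\<^sub>M S (Some i)) (\<lambda>(\<omega>\<^sub>1, \<omega>\<^sub>2). ?Q \<omega>\<^sub>1 \<omega>\<^sub>2)"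
          unfolding case_prod_beta poisson_marks.arrived_def[OF marks] by measurable
        fix \<omega>\<^sub>1
        show "Measurable.pred ((case Some i of None \<Rightarrow> points_history M T | Some i \<Rightarrow> \<lambda>a. sigma (space M) (marks_history M (C i) (D i) a))
            (t - (case Some i of None \<Rightarrow> \<lambda>_. 0 | Some i \<Rightarrow> T i) \<omega>\<^sub>1)) (?Q \<omega>\<^sub>1)"
          using poisson_marks.arrived_history[OF marks, of "t - T i \<omega>\<^sub>1" "t - T i \<omega>\<^sub>1" i n]
          by (simp add: pred_def space_measure_of_conv sigma_algebra.sets_measure_of_eq[OF sigma_algebra_marks_history])
      qed
      then show ?thesis unfolding 2 offspring_arrived .
    next
      case 3
      note [measurable] = T_E[OF 3(1)] C_E[OF 3(2)] D_E[OF 3(2)]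
      have "(\<lambda>\<omega>. offspring i t \<omega>) \<in> measurable (E k) (count_space UNIV)"
        unfolding offspring_def by (rule measurable_card) measurable
      then show ?thesis by (intro R_of_E) measurable
    qed
  qed
  moreover have "offspring i t -` {n} \<inter> space (F t) = {\<omega>\<in>space (F t). offspring i t \<omega> = n}" by auto
  ultimately show "offspring i t -` {n} \<inter> space (F t) \<in> sets (F t)" by (simp add: pred_def)
qed auto

lemma adapted_children: "adapted F children"
  unfolding adapted_def borel_measurable_nat_iff
proof (intro allI impI)
  fix t :: real
  have [measurable]: "(\<lambda>\<omega>. real (offspring i t \<omega>)) \<in> borel_measurable (F t)" for i
    by (rule measurable_compose[OF offspring_F]) simp
  \<comment> \<open>The integer part brings the sum of real counts back to the natural numbers,
    where it equals \<open>children t\<close>.\<close>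
  have "(\<lambda>\<omega>. nat \<lfloor>\<Sum>i. real (offspring i t \<omega>)\<rfloor>) \<in> measurable (F t) (count_space UNIV)" by measurable
  then show "children t \<in> measurable (F t) (count_space UNIV)"
    by (simp add: children_suminf[symmetric])
qed

lemma has_intensity_children: "has_intensity M F children drive2"
proof -
  let ?X = "\<lambda>i t \<omega>. real (offspring i t \<omega>) - \<nu> * displacement_cdf (t - T i \<omega>)"
  have [measurable]: "C i \<in> measurable M (count_space UNIV)" for i by (rule poisson_marks.C[OF marks])
  have card_meas [measurable]: "offspring i t \<in> measurable M (count_space UNIV)" for i t
    unfolding offspring_def[abs_def] by (rule measurable_card) measurable
  have X_meas: "?X i t \<in> borel_measurable M" for i t
    by measurable
  have bound: "integrable M (?X i t)" "summable (\<lambda>i. \<integral>\<omega>. \<bar>?X i t \<omega>\<bar> \<partial>M)" if t: "0 \<le> t" for i t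
  proof -
    \<comment> \<open>A majorant from the source of the marks alone: all children displaced by at
      most \<open>t\<close>, of mean at most \<open>\<nu>\<close>, plus the bound
      \<open>\<nu>\<close> for the compensator. This gives the constant
      \<open>2 * \<nu>\<close>.\<close>
    let ?g = "\<lambda>i \<omega>. ennreal (real (poisson_marks.arrived (C i) (D i) t \<omega>)) + ennreal \<nu>"
    have g: "(\<integral>\<^sup>+\<omega>. indicator {\<omega>\<in>space M. T i \<omega> \<le> t} \<omega> * ?g i \<omega> \<partial>M)
        \<le> ennreal (2 * \<nu>) * ennreal (prob {\<omega>\<in>space M. T i \<omega> \<le> t})" for i
    proof -
      interpret P: independent_pair M "E (Some i)" "S (Some i)" by (rule pair)
      note [measurable] = C_S D_S
      have [measurable]: "poisson_marks.arrived (C i) (D i) t \<in> measurable (S (Some i)) (count_space UNIV)"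
        unfolding poisson_marks.arrived_def[OF marks, abs_def] by (rule measurable_card) measurable
      have [measurable]: "{\<omega>\<in>space M. T i \<omega> \<le> t} \<in> sets (E (Some i))"
        using T_E[of "Some i" i] by (auto simp: borel_measurable_iff_le)
      have "(\<integral>\<^sup>+\<omega>. indicator {\<omega>\<in>space M. T i \<omega> \<le> t} \<omega> * ?g i \<omega> \<partial>M)
          = (\<integral>\<^sup>+\<omega>. indicator {\<omega>\<in>space M. T i \<omega> \<le> t} \<omega> \<partial>M) * (\<integral>\<^sup>+\<omega>. ?g i \<omega> \<partial>M)"
        by (rule P.nn_integral_indep_mult) measurable
      also have "(\<integral>\<^sup>+\<omega>. ?g i \<omega> \<partial>M) = ennreal (\<nu> * displacement_cdf t) + ennreal \<nu>"
        using poisson_marks.arrived_measurable[OF marks, of i t]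
        by (subst nn_integral_add) (auto simp: poisson_marks.nn_integral_arrived[OF marks] cdf_marks_eq emeasure_space_1)
      also have "\<dots> = ennreal (\<nu> * displacement_cdf t + \<nu>)"
        using \<nu> displacement_cdf_bounds by (intro ennreal_plus[symmetric]) auto
      also have "(\<integral>\<^sup>+\<omega>. indicator {\<omega>\<in>space M. T i \<omega> \<le> t} \<omega> \<partial>M) * ennreal (\<nu> * displacement_cdf t + \<nu>)
          \<le> ennreal (prob {\<omega>\<in>space M. T i \<omega> \<le> t}) * ennreal (2 * \<nu>)"
        using \<nu> displacement_cdf_bounds[of t] by (intro mult_mono ennreal_leI) (auto simp: emeasure_eq_measure)
      finally show ?thesis by (simp add: mult.commute)
    qed
    have h: "ennreal \<bar>?X i t \<omega>\<bar> \<le> indicator {\<omega>. T i \<omega> \<le> t} \<omega> * ?g i \<omega>" for i \<omega>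
    proof (cases "T i \<omega> \<le> t")
      case True
      have "{j. j < C i \<omega> \<and> D i j \<omega> \<le> t - T i \<omega>} \<subseteq> {j. j < C i \<omega> \<and> D i j \<omega> \<le> t}"
        using less_imp_le[OF T_pos[of i \<omega>]] by auto
      then have "offspring i t \<omega> \<le> poisson_marks.arrived (C i) (D i) t \<omega>"
        unfolding offspring_arrived poisson_marks.arrived_def[OF marks] by (intro card_mono) auto
      moreover have "0 \<le> \<nu> * displacement_cdf (t - T i \<omega>)" "\<nu> * displacement_cdf (t - T i \<omega>) \<le> \<nu>"
        using \<nu> displacement_cdf_bounds[of "t - T i \<omega>"] by (auto simp: mult_left_le)
      ultimately have "\<bar>?X i t \<omega>\<bar> \<le> real (poisson_marks.arrived (C i) (D i) t \<omega>) + \<nu>" by linarith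
      then show ?thesis using True \<nu> by (simp add: ennreal_leI ennreal_plus[symmetric] del: ennreal_plus)
    qed (simp add: offspring_zero displacement_cdf_nonpos)
    have c: "0 \<le> 2 * \<nu>" using \<nu> by simp
    show "integrable M (?X i t)" by (rule cluster_integrable[OF T X_meas g c h])
    show "summable (\<lambda>i. \<integral>\<omega>. \<bar>?X i t \<omega>\<bar> \<partial>M)" by (rule cluster_summable[OF T X_meas g c h])
  qed
  have fin: "finite {i. real (offspring i t \<omega>) \<noteq> 0}" "finite {i. \<nu> * displacement_cdf (t - T i \<omega>) \<noteq> 0}" for t \<omega>
  proof -
    have "real (offspring i t \<omega>) = 0" "\<nu> * displacement_cdf (t - T i \<omega>) = 0" if "\<not> T i \<omega> \<le> t" for i
      using that by (simp_all add: offspring_zero displacement_cdf_nonpos)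
    then have "{i. real (offspring i t \<omega>) \<noteq> 0} \<subseteq> {i. T i \<omega> \<le> t}" "{i. \<nu> * displacement_cdf (t - T i \<omega>) \<noteq> 0} \<subseteq> {i. T i \<omega> \<le> t}"
      by blast+
    then show "finite {i. real (offspring i t \<omega>) \<noteq> 0}" "finite {i. \<nu> * displacement_cdf (t - T i \<omega>) \<noteq> 0}"
      by (blast intro: finite_subset[OF _ T_finite])+
  qed
  have b: "(\<lambda>\<omega>. \<nu> * displacement_cdf (t - T i \<omega>)) \<in> borel_measurable (F t)" for i t
  proof -
    \<comment> \<open>Truncating the arrival at \<open>t\<close> leaves the term unchanged, as the
      distribution function vanishes at nonpositive arguments, and makes it measurable at time
      \<open>t\<close>.\<close>
    have [measurable]: "(\<lambda>\<omega>. min (T i \<omega>) t) \<in> borel_measurable (F t)"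
      by (rule measurable_min_stopping_time[OF filtration_F stopping_time_T])
    have "(\<lambda>\<omega>. \<nu> * displacement_cdf (t - min (T i \<omega>) t)) \<in> borel_measurable (F t)" by measurable
    moreover have "displacement_cdf (t - min (T i \<omega>) t) = displacement_cdf (t - T i \<omega>)" for \<omega>
      by (cases "T i \<omega> \<le> t") (auto simp: displacement_cdf_nonpos min_def)
    ultimately show ?thesis by simp
  qed
  show ?thesis
  proof (rule has_intensity_cluster[OF filtration_F, where a="\<lambda>i t \<omega>. real (offspring i t \<omega>)" and b="\<lambda>i t \<omega>. \<nu> * displacement_cdf (t - T i \<omega>)"])
    fix i s t A assume st: "0 \<le> s" "s \<le> t" and A: "A \<in> sets (F s)"
    then have t: "0 \<le> t" by simp
    \<comment> \<open>With the arrival fixed in the first copy, this is the martingale of a Poisson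
      number of marks at age \<open>t - T i\<close>.\<close>
    define \<Phi> where "\<Phi> t \<omega>\<^sub>1 \<omega>\<^sub>2 = real (poisson_marks.arrived (C i) (D i) (t - T i \<omega>\<^sub>1) \<omega>\<^sub>2) - \<nu> * displacement_cdf (t - T i \<omega>\<^sub>1)" for t \<omega>\<^sub>1 \<omega>\<^sub>2
    have X: "?X i t = (\<lambda>\<omega>. \<Phi> t \<omega> \<omega>)" for t
      by (simp add: \<Phi>_def offspring_arrived)
    let ?k = "Some i"
    have [measurable]: "T i \<in> borel_measurable (E ?k)" by (rule T_E) simp
    note C_S[measurable] D_S[measurable]
    have [measurable]: "(\<lambda>(\<omega>\<^sub>1, \<omega>\<^sub>2). poisson_marks.arrived (C i) (D i) (t - T i \<omega>\<^sub>1) \<omega>\<^sub>2) \<in> measurable (E ?k \<Otimes>\<^sub>M S ?k) (count_space UNIV)" for t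
      unfolding case_prod_beta poisson_marks.arrived_def[OF marks] by (rule measurable_card) measurable
    have \<Phi>: "(\<lambda>(\<omega>\<^sub>1, \<omega>\<^sub>2). \<Phi> t \<omega>\<^sub>1 \<omega>\<^sub>2) \<in> borel_measurable (E ?k \<Otimes>\<^sub>M S ?k)" for t
      unfolding \<Phi>_def by (simp add: case_prod_beta) measurable
    show "(LINT \<omega>:A|M. ?X i t \<omega>) = (LINT \<omega>:A|M. ?X i s \<omega>)"
      unfolding X
    proof (rule F_martingale[OF \<Phi> \<Phi> _ _ A])
      show "integrable M (\<lambda>\<omega>. \<Phi> t \<omega> \<omega>)" "integrable M (\<lambda>\<omega>. \<Phi> s \<omega> \<omega>)"
        using bound(1)[OF t, of i] bound(1)[OF st(1), of i] unfolding X by auto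
      fix \<omega>\<^sub>1 A' assume "A' \<in> sets ((case ?k of None \<Rightarrow> points_history M T | Some i \<Rightarrow> \<lambda>a. sigma (space M) (marks_history M (C i) (D i) a))
           (s - (case ?k of None \<Rightarrow> (\<lambda>_. 0) | Some i \<Rightarrow> T i) \<omega>\<^sub>1))"
      then have A': "A' \<in> marks_history M (C i) (D i) (s - T i \<omega>\<^sub>1)"
        by (simp add: sigma_algebra.sets_measure_of_eq[OF sigma_algebra_marks_history])
      show "(LINT \<omega>:A'|M. \<Phi> t \<omega>\<^sub>1 \<omega>) = (LINT \<omega>:A'|M. \<Phi> s \<omega>\<^sub>1 \<omega>)"
        using poisson_marks.arrived_martingale[OF marks A', of "t - T i \<omega>\<^sub>1"] st
        unfolding \<Phi>_def cdf_marks_eq by simp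
    qed
  next
    show "children 0 \<omega> = 0" for \<omega>
    proof -
      have "real (children 0 \<omega>) = 0"
        unfolding children_suminf by (simp add: offspring_zero)
      then show ?thesis by simp
    qed
    show "finite {i. real (offspring i t \<omega>) \<noteq> 0}" "finite {i. \<nu> * displacement_cdf (t - T i \<omega>) \<noteq> 0}" for t \<omega>
      by (rule fin)+
  qed (use compensator_drive2 bound b in \<open>auto intro: children_suminf adapted_children\<close>)
qed

end

section \<open>Assembling the bivariate process\<close>

context neyman_scott_clusters
begin

definition process :: "real \<Rightarrow> 'a \<Rightarrow> nat ^ 2" where
  "process t \<omega> = vector [card {i. T i \<omega> \<le> t}, children t \<omega>]"

abbreviation baseline :: "real ^ 2" where "baseline \<equiv> vector [\<mu>, 0]"
abbreviation kernel :: "real \<Rightarrow> real ^ 2 ^ 2" where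
  "kernel \<equiv> \<lambda>u. vector [vector [0, 0], vector [\<nu> * f u, 0]]"

lemma process_nth [simp]:
  "process t \<omega> $ 1 = card {i. T i \<omega> \<le> t}" "process t \<omega> $ 2 = children t \<omega>"
  by (simp_all add: process_def)

text \<open>Coincidences are solved for a displacement, whose law has a density, against times from
  outside its source. Siblings share a source and are separated inside it.\<close>

lemma AE_distinct:
  "AE \<omega> in M. (\<forall>k i j. T k \<omega> \<noteq> T i \<omega> + D i j \<omega>) \<and>
     (\<forall>i j k l. i \<noteq> k \<longrightarrow> T i \<omega> + D i j \<omega> \<noteq> T k \<omega> + D k l \<omega>) \<and>
     (\<forall>i j l. j \<noteq> l \<longrightarrow> D i j \<omega> \<noteq> D i l \<omega>)"
proof -
  have K: "AE \<omega> in M. D i j \<omega> \<noteq> V \<omega>" if "V \<in> borel_measurable (E (Some i))" for i j V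
    by (rule independent_pair.AE_neq[OF pair D_S that distributed_diffuse[OF poisson_marks.D_distr[OF marks]]])
  have "AE \<omega> in M. D i j \<omega> \<noteq> T k \<omega> - T i \<omega>" for i j k
    by (intro K borel_measurable_diff T_E) auto
  moreover have "AE \<omega> in M. i \<noteq> k \<longrightarrow> D i j \<omega> \<noteq> T k \<omega> + D k l \<omega> - T i \<omega>" for i j k l
  proof (cases "i = k")
    case False
    then have "AE \<omega> in M. D i j \<omega> \<noteq> T k \<omega> + D k l \<omega> - T i \<omega>"
      by (intro K borel_measurable_diff borel_measurable_add T_E D_E) auto
    then show ?thesis by eventually_elim simp
  qed simp
  moreover have "AE \<omega> in M. j \<noteq> l \<longrightarrow> D i j \<omega> \<noteq> D i l \<omega>" for i j l
  proof (cases "j = l")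
    case False
    from poisson_marks.AE_marks_distinct[OF marks False, of i] show ?thesis by eventually_elim simp
  qed simp
  ultimately have "AE \<omega> in M. (\<forall>k i j. D i j \<omega> \<noteq> T k \<omega> - T i \<omega>) \<and>
     (\<forall>i j k l. i \<noteq> k \<longrightarrow> D i j \<omega> \<noteq> T k \<omega> + D k l \<omega> - T i \<omega>) \<and>
     (\<forall>i j l. j \<noteq> l \<longrightarrow> D i j \<omega> \<noteq> D i l \<omega>)"
    by (simp add: AE_all_countable)
  then show ?thesis
  proof eventually_elim
    case (elim \<omega>)
    have 1: "T k \<omega> \<noteq> T i \<omega> + D i j \<omega>" for k i j
      using elim by (metis add_diff_cancel_left')
    have 2: "T i \<omega> + D i j \<omega> \<noteq> T k \<omega> + D k l \<omega>" if "i \<noteq> k" for i j k l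
      using elim that by (metis add_diff_cancel_left')
    show ?case by (intro conjI allI impI 1 2) (use elim in simp_all)
  qed
qed

lemma multivariate_counting_process: "multivariate_counting_process M F process"
proof (rule multivariate_counting_processI[OF filtration_F])
  show "adapted F (\<lambda>t \<omega>. process t \<omega> $ i)" for i
    using exhaust_2[of i] adapted_parents adapted_children by auto
  show "AE \<omega> in M. (\<forall>i. counting_path (\<lambda>t. process t \<omega> $ i)) \<and>
      (\<forall>i j t. i \<noteq> j \<longrightarrow> isCont (\<lambda>u. process u \<omega> $ i) t \<or> isCont (\<lambda>u. process u \<omega> $ j) t)"
    using AE_distinct
  proof eventually_elim
    case (elim \<omega>)
    let ?x1 = "\<lambda>i. T i \<omega>" and ?x2 = "\<lambda>q. T (fst q) \<omega> + D (fst q) (snd q) \<omega>"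
    let ?I2 = "{q. snd q < C (fst q) \<omega>}"
    have inj2: "inj_on ?x2 ?I2"
    proof (rule inj_onI)
      fix q q' assume eq: "?x2 q = ?x2 q'"
      then have "fst q = fst q'" using elim by metis
      moreover from this eq have "D (fst q) (snd q) \<omega> = D (fst q) (snd q') \<omega>" by simp
      then have "snd q = snd q'" using elim by metis
      ultimately show "q = q'" by (rule prod_eqI)
    qed
    have inj1: "inj_on ?x1 UNIV" using strict_mono_imp_inj_on[OF T_strict_mono] .
    have c1: "counting_path (\<lambda>t. card {i. T i \<omega> \<le> t})"
      using counting_path_points[OF inj1] by simp
    have c2: "counting_path (\<lambda>t. children t \<omega>)"
      unfolding children_def by (rule counting_path_points[OF inj2]) (auto intro: finite_children[unfolded mem_Collect_eq] add_pos_pos)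
    have i1: "isCont (\<lambda>t. card {i. T i \<omega> \<le> t}) t" if "t \<notin> range ?x1" for t
      using isCont_points[of UNIV ?x1 t] that by simp
    have i2: "isCont (\<lambda>t. children t \<omega>) t" if "t \<notin> ?x2 ` ?I2" for t
      unfolding children_def by (rule isCont_points[OF finite_children that])
    have d12: "t \<notin> range ?x1 \<or> t \<notin> ?x2 ` ?I2" for t
    proof -
      have "?x1 j \<noteq> ?x2 q" for j q by (simp_all only: elim not_False_eq_True)
      then show ?thesis unfolding image_iff by metis
    qed
    define g where "g i = (\<lambda>u. process u \<omega> $ i)" for i
    have g: "isCont (g 1) t \<or> isCont (g 2) t" for t
      using i1[of t] i2[of t] d12[of t] unfolding g_def process_nth by blast
    have "isCont (g i) t \<or> isCont (g j) t" if "i \<noteq> j" for i j t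
      using g[of t] exhaust_2[of i] exhaust_2[of j] that by metis
    moreover have "counting_path (\<lambda>t. process t \<omega> $ i)" for i
      using exhaust_2[of i] c1 c2 by auto
    ultimately show ?case unfolding g_def by blast
  qed
qed

lemma drive: "hawkes_drive baseline kernel process t \<omega> = vector [\<mu>, drive2 t \<omega>]"
proof -
  have zero: "(LINT s:{0..<t}|N. 0) = (0::real)" for N :: "real measure"
    by (simp add: set_lebesgue_integral_def)
  have p: "(LINT s:{0..<t}|interval_measure (\<lambda>u. real (card {i. T i \<omega> \<le> u})). \<nu> * f (t - s)) = drive2 t \<omega>"
  proof -
    have "(\<lambda>s. \<nu> * f (t - s)) \<in> borel_measurable borel" by measurable
    from set_integral_points[OF _ _ this, of UNIV "\<lambda>i. T i \<omega>" t] show ?thesis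
      by (simp only: drive2_def T_finite T_pos UNIV_I simp_thms)
  qed
  show ?thesis
    unfolding vec_eq_iff forall_2
    using p by (simp add: hawkes_drive_def sum_2 zero)
qed

lemma linear_hawkes: "linear_hawkes M F baseline kernel process"
proof -
  have "has_intensity M F (\<lambda>t \<omega>. process t \<omega> $ i) (\<lambda>t \<omega>. hawkes_drive baseline kernel process t \<omega> $ i)" for i
    unfolding drive
    using exhaust_2[of i] has_intensity_parents has_intensity_children by auto
  then show ?thesis
    unfolding linear_hawkes_def using multivariate_counting_process by blast
qed

end

section \<open>Realising a given Neyman--Scott process by clusters\<close>

lemma (in prob_space) distributed_AE_pos:
  fixes X :: "'a \<Rightarrow> real"
  assumes X: "distributed M lborel X (\<lambda>x. ennreal (f x))" and f: "\<And>x. x < 0 \<Longrightarrow> f x = 0"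
  shows "AE \<omega> in M. 0 < X \<omega>"
proof -
  have [measurable]: "X \<in> borel_measurable M" using distributed_measurable[OF X] by simp
  have "emeasure M (X -` {..0} \<inter> space M) = (\<integral>\<^sup>+x. ennreal (f x) * indicator {..0} x \<partial>lborel)"
    by (rule distributed_emeasure[OF X]) simp
  \<comment> \<open>The density vanishes below \<open>0\<close>, and the point \<open>0\<close>
    itself carries no Lebesgue mass.\<close>
  also have "\<dots> = (\<integral>\<^sup>+x. ennreal (f x) * indicator {0} x \<partial>lborel)"
    by (intro nn_integral_cong) (use f in \<open>force simp: indicator_def\<close>)
  also have "\<dots> = 0"
    by (rule nn_integral_null_set) (simp add: null_sets_def)
  finally have "emeasure M (X -` {..0} \<inter> space M) = 0" .
  then show ?thesis
    by (subst AE_iff_measurable[of "X -` {..0} \<inter> space M"]) (auto simp: not_less)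
qed

theorem (in prob_space) neyman_scott_hawkes:
  assumes pos: "0 < \<mu>" "0 < \<nu>" and f: "probability_density_nonneg f"
    and Y: "neyman_scott M \<mu> (poisson_pmf \<nu>) f Y"
  shows "\<exists>F N. linear_hawkes M F (vector [\<mu>, 0] :: real ^ 2)
      ((\<lambda>u. vector [vector [0, 0], vector [\<nu> * f u, 0]]) :: real \<Rightarrow> real ^ 2 ^ 2) N \<and>
    (AE \<omega> in M. \<forall>t\<ge>0. Y t \<omega> = N t \<omega> $ 2)"
proof -
  define orig where "orig P C D0 k = (case k of
             NS_Parents \<Rightarrow> generated_events M P
           | NS_Number i \<Rightarrow> generated_events M (\<lambda>_ :: unit. C i)
           | NS_Displacement i j \<Rightarrow> generated_events M (\<lambda>_ :: unit. D0 i j))"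
    for P :: "real \<Rightarrow> 'a \<Rightarrow> nat" and C :: "nat \<Rightarrow> 'a \<Rightarrow> nat" and D0 :: "nat \<Rightarrow> nat \<Rightarrow> 'a \<Rightarrow> real" and k
  obtain P C D0 where P: "poisson_process M \<mu> P"
    and C: "\<And>i. C i \<in> measurable M (count_space UNIV)"
    and C_distr: "\<And>i. distr M (count_space UNIV) (C i) = measure_pmf (poisson_pmf \<nu>)"
    and D0: "\<And>i j. distributed M lborel (D0 i j) f"
    and ind: "indep_sets (orig P C D0) UNIV"
    and Y: "\<And>\<omega> t. \<omega> \<in> space M \<Longrightarrow> 0 \<le> t \<Longrightarrow> Y t \<omega> = (\<Sum>i<P t \<omega>.
             card {j. j < C i \<omega> \<and> arrival_time (\<lambda>u. P u \<omega>) i + D0 i j \<omega> \<le> t})"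
    using Y unfolding neyman_scott_def orig_def[abs_def] by blast
  define \<G> where "\<G> = orig P C D0"
  have ind: "indep_sets \<G> UNIV" using ind by (simp add: \<G>_def)
  have sa\<G>: "sigma_algebra (space M) (\<G> k)" for k
    unfolding \<G>_def orig_def by (cases k) (simp_all add: sigma_algebra_generated_events)
  have stable: "Int_stable (\<G> k)" for k
  proof -
    interpret sigma_algebra "space M" "\<G> k" by (rule sa\<G>)
    show ?thesis by (auto simp: Int_stable_def)
  qed
  have ev: "\<G> k \<subseteq> events" for k using ind by (auto simp: indep_sets_def)
  have genC: "C i -` A \<inter> space M \<in> \<G> (NS_Number i)" for i A
    unfolding \<G>_def orig_def ns_source.case generated_events_def
    by (intro sigma_sets.Basic CollectI exI[of _ "()"] exI[of _ A]) (simp add: sets_borel_eq_count_space)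
  have genD: "D0 i j -` A \<inter> space M \<in> \<G> (NS_Displacement i j)" if "A \<in> sets borel" for i j A
    unfolding \<G>_def orig_def ns_source.case generated_events_def
    by (intro sigma_sets.Basic CollectI exI[of _ "()"] exI[of _ A]) (simp add: that)
  obtain T where T: "poisson_points M \<mu> T"
    "\<And>i u. {\<omega>\<in>space M. T i \<omega> \<le> u} \<in> null_completion M (generated_events M P)"
    and TP: "AE \<omega> in M. (\<forall>t i. T i \<omega> \<le> t \<longleftrightarrow> i < P t \<omega>) \<and> (\<forall>i. T i \<omega> = arrival_time (\<lambda>t. P t \<omega>) i)"
    using poisson_process_points[OF P pos(1)] by blast
  have f_neg: "\<And>x. x < 0 \<Longrightarrow> f x = 0" using f by (simp add: probability_density_nonneg_def)
  define D where "D i j \<omega> = (if D0 i j \<omega> \<le> 0 then 1 else D0 i j \<omega>)" for i j \<omega>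
  have D0_pos: "AE \<omega> in M. 0 < D0 i j \<omega>" for i j
    by (rule distributed_AE_pos[OF D0 f_neg])
  have genD': "D i j -` A \<inter> space M \<in> \<G> (NS_Displacement i j)" if A: "A \<in> sets borel" for i j A
  proof -
    \<comment> \<open>The repair is a Borel function of \<open>D0 i j\<close>, so the events of the
      repaired displacement stay inside the original source.\<close>
    define g :: "real \<Rightarrow> real" where "g x = (if x \<le> 0 then 1 else x)" for x
    have "g \<in> borel_measurable borel" unfolding g_def by measurable
    then have "g -` A \<in> sets borel" using measurable_sets[of g borel borel A] A by simp
    from genD[OF this] have "D0 i j -` (g -` A) \<inter> space M \<in> \<G> (NS_Displacement i j)" .
    moreover have "D i j = g \<circ> D0 i j" by (auto simp: D_def g_def)
    ultimately show ?thesis by (simp add: vimage_comp)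
  qed
  \<comment> \<open>Regroups the sources by parent: the number and the displacements of parent
    \<open>i\<close> form one block.\<close>
  define I where "I k = (case k of None \<Rightarrow> {NS_Parents} | Some i \<Rightarrow> insert (NS_Number i) (range (NS_Displacement i)))"
    for k :: "nat option"
  have indI: "indep_sets (\<lambda>k. sigma_sets (space M) (\<Union>s\<in>I k. \<G> s)) UNIV"
  proof (rule indep_sets_collect_sigma)
    show "indep_sets \<G> (\<Union>k\<in>UNIV. I k)" by (rule indep_sets_mono_index[OF _ ind]) auto
    show "disjoint_family_on I UNIV" by (auto simp: disjoint_family_on_def I_def split: option.splits)
  qed (rule stable)
  have saI: "sigma_algebra (space M) (sigma_sets (space M) (\<Union>s\<in>I k. \<G> s))" for k
    using ev sets.space_closed[of M] by (blast intro!: sigma_algebra_sigma_sets)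
  have inI: "A \<in> sigma_sets (space M) (\<Union>s\<in>I k. \<G> s)" if "A \<in> \<G> s" "s \<in> I k" for A s k
    using that by (intro sigma_sets.Basic) auto
  define \<S> where "\<S> k = null_completion M (sigma_sets (space M) (\<Union>s\<in>I k. \<G> s))" for k
  have in\<S>: "A \<in> \<S> k" if "A \<in> \<G> s" "s \<in> I k" for A s k
  proof -
    have "sigma_sets (space M) (\<Union>s\<in>I k. \<G> s) \<subseteq> events"
      by (rule sets.sigma_sets_subset) (use ev in blast)
    from subset_null_completion[OF this] show ?thesis unfolding \<S>_def using inI[OF that] by blast
  qed
  have marks: "poisson_marks M (C i) (D i) \<nu> f" for i
  proof (intro poisson_marks.intro poisson_marks_axioms.intro prob_space_axioms pos(2) C C_distr)
    show "distributed M lborel (D i j) f" for j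
      unfolding D_def[abs_def] by (rule distributed_modify[OF D0 D0_pos])
    show "0 < D i j \<omega>" for j \<omega> by (simp add: D_def)
    \<comment> \<open>Inside one cluster the individual sources are kept apart, indexed as
      \<open>poisson_marks\<close> expects.\<close>
    define h where "h k = (case k of None \<Rightarrow> NS_Number i | Some j \<Rightarrow> NS_Displacement i j)" for k
    have "indep_sets (\<lambda>k. sigma_sets (space M) (\<Union>s\<in>{h k}. \<G> s)) UNIV"
    proof (rule indep_sets_collect_sigma)
      show "indep_sets \<G> (\<Union>k\<in>UNIV. {h k})" by (rule indep_sets_mono_index[OF _ ind]) auto
      show "disjoint_family_on (\<lambda>k. {h k}) UNIV"
        by (auto simp: disjoint_family_on_def h_def split: option.splits)
    qed (rule stable)
    then show "indep_sets (\<lambda>k. case k of None \<Rightarrow> {C i -` A \<inter> space M |A. A \<in> UNIV}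
       | Some j \<Rightarrow> {D i j -` A \<inter> space M |A. A \<in> sets borel}) UNIV"
    proof (rule indep_sets_mono_sets)
      fix k
      have "(case k of None \<Rightarrow> {C i -` A \<inter> space M |A. A \<in> UNIV}
       | Some j \<Rightarrow> {D i j -` A \<inter> space M |A. A \<in> sets borel}) \<subseteq> \<G> (h k)"
        by (cases k) (auto simp: h_def genC genD')
      then show "(case k of None \<Rightarrow> {C i -` A \<inter> space M |A. A \<in> UNIV}
       | Some j \<Rightarrow> {D i j -` A \<inter> space M |A. A \<in> sets borel}) \<subseteq> sigma_sets (space M) (\<Union>s\<in>{h k}. \<G> s)"
        by (auto intro: sigma_sets.Basic)
    qed
  qed
  interpret neyman_scott_clusters M \<S> T \<mu> C D \<nu> f
  proof (intro neyman_scott_clusters.intro clusters.intro sources.intro sources_axioms.intro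
      clusters_axioms.intro neyman_scott_clusters_axioms.intro prob_space_axioms marks f pos(1) T(1))
    show "indep_sets \<S> UNIV" unfolding \<S>_def by (rule indep_sets_null_completion[OF indI])
    show "sigma_algebra (space M) (\<S> k)" for k
      unfolding \<S>_def by (rule sigma_algebra_null_completion[OF saI])
    show "{\<omega>\<in>space M. T i \<omega> \<le> u} \<in> \<S> None" for i u
    proof -
      \<comment> \<open>The block of the parents is a single \<sigma>-algebra, which generates
        itself.\<close>
      have "sigma_sets (space M) (\<Union>s\<in>I None. \<G> s) = generated_events M P"
        using sigma_algebra.sigma_sets_eq[OF sa\<G>[of NS_Parents]] by (simp add: I_def \<G>_def orig_def)
      then show ?thesis using T(2) by (simp add: \<S>_def)
    qed
    show "{\<omega>\<in>space M. C i \<omega> = n} \<in> \<S> (Some i)" for i n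
    proof -
      have "C i -` {n} \<inter> space M \<in> \<S> (Some i)" by (rule in\<S>[OF genC]) (simp add: I_def)
      then show ?thesis by (rule back_subst[of "\<lambda>A. A \<in> _"]) auto
    qed
    show "{\<omega>\<in>space M. D i j \<omega> \<le> u} \<in> \<S> (Some i)" for i j u
    proof -
      have "{..u} \<in> sets borel" by simp
      then have "D i j -` {..u} \<inter> space M \<in> \<S> (Some i)" by (rule in\<S>[OF genD']) (simp add: I_def)
      then show ?thesis by (rule back_subst[of "\<lambda>A. A \<in> _"]) auto
    qed
    show "sets ((case k of None \<Rightarrow> points_history M T | Some i \<Rightarrow> (\<lambda>a. sigma (space M) (marks_history M (C i) (D i) a))) a)
      \<subseteq> sets ((case k of None \<Rightarrow> points_history M T | Some i \<Rightarrow> (\<lambda>a. sigma (space M) (marks_history M (C i) (D i) a))) b)"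
      if "a \<le> b" for k a b
      by (cases k) (simp_all add: points_history_mono[OF that] marks_history_mono[OF that]
          sigma_algebra.sets_measure_of_eq[OF sigma_algebra_marks_history])
    show "space ((case k of None \<Rightarrow> points_history M T | Some i \<Rightarrow> (\<lambda>a. sigma (space M) (marks_history M (C i) (D i) a))) a) = space M" for k a
      by (cases k) (simp_all add: space_measure_of_conv)
  qed simp_all
  have "AE \<omega> in M. \<forall>i j. 0 < D0 i j \<omega>"
    using D0_pos by (simp add: AE_all_countable)
  with TP AE_space have "AE \<omega> in M. \<forall>t\<ge>0. Y t \<omega> = process t \<omega> $ 2"
  proof eventually_elim
    case (elim \<omega>)
    show ?case
    proof (intro allI impI)
      fix t :: real assume t: "0 \<le> t"
      have DD: "D i j \<omega> = D0 i j \<omega>" for i j using elim(3) by (simp add: D_def not_le[symmetric])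
      have TT: "{i. T i \<omega> \<le> t} = {..<P t \<omega>}" using elim(1) by auto
      have arr: "arrival_time (\<lambda>u. P u \<omega>) i = T i \<omega>" for i using elim(1) by simp
      have "real (children t \<omega>) = (\<Sum>i\<in>{i. T i \<omega> \<le> t}. real (offspring i t \<omega>))"
        unfolding children_suminf by (rule suminf_finite) (auto simp: offspring_zero)
      also have "\<dots> = real (\<Sum>i<P t \<omega>. offspring i t \<omega>)"
        unfolding TT by simp
      finally have "children t \<omega> = (\<Sum>i<P t \<omega>. offspring i t \<omega>)"
        by (simp only: of_nat_eq_iff)
      then show "Y t \<omega> = process t \<omega> $ 2"
        by (simp only: Y[OF elim(2) t] arr offspring_def DD process_nth)
    qed
  qed
  then show ?thesis using linear_hawkes by blast
qed

theorem proposition6p1: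
  fixes M :: "'a measure" and \<mu>BL \<gamma>BL \<nu>BL :: real and X :: "real \<Rightarrow> 'a \<Rightarrow> nat"
    and M' :: "'b measure" and \<mu>NS \<nu>NS :: real and fNS :: "real \<Rightarrow> real" and Y :: "real \<Rightarrow> 'b \<Rightarrow> nat"
  shows
   "(prob_space M \<and> 0 < \<mu>BL \<and> 0 < \<gamma>BL \<and> 0 < \<nu>BL \<and> bartlett_lewis M \<mu>BL \<gamma>BL \<nu>BL X \<longrightarrow>
      (let \<mu> = vector [\<mu>BL, 0, 0] :: real ^ 3;
           \<phi> = (\<lambda>_. vector [vector [0, 0, 0],
                             vector [\<nu>BL, 0, - \<nu>BL],
                             vector [\<gamma>BL, 0, - \<gamma>BL]]) :: real \<Rightarrow> real ^ 3 ^ 3;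
           h = positive_parts :: real ^ 3 \<Rightarrow> real ^ 3
       in \<exists>F N.
            linear_hawkes M F \<mu> \<phi> N \<and>
            (AE \<omega> in M. \<forall>t\<ge>0. X t \<omega> = N t \<omega> $ 1 + N t \<omega> $ 2) \<and>
            nonlinear_hawkes M F h \<mu> \<phi> N \<and>
            (AE \<omega> in M. \<forall>t\<ge>0. hawkes_drive \<mu> \<phi> N t \<omega> = h (hawkes_drive \<mu> \<phi> N t \<omega>)) \<and>
            (\<forall>x i. 0 \<le> h x $ i) \<and>
            (\<exists>C. C-lipschitz_on UNIV h)))
    \<and>
    (prob_space M' \<and> 0 < \<mu>NS \<and> 0 < \<nu>NS \<and> probability_density_nonneg fNS \<and>
     neyman_scott M' \<mu>NS (poisson_pmf \<nu>NS) fNS Y \<longrightarrow>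
      (let \<mu> = vector [\<mu>NS, 0] :: real ^ 2;
           \<phi> = (\<lambda>u. vector [vector [0, 0],
                             vector [\<nu>NS * fNS u, 0]]) :: real \<Rightarrow> real ^ 2 ^ 2
       in \<exists>F N.
            linear_hawkes M' F \<mu> \<phi> N \<and>
            (AE \<omega> in M'. \<forall>t\<ge>0. Y t \<omega> = N t \<omega> $ 2)))"
  unfolding Let_def
  by (intro conjI impI prob_space.bartlett_lewis_hawkes prob_space.neyman_scott_hawkes) simp_all

end
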